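(* Let $\mathcal{O}\subset\mathbb{R}^d$ be a bounded convex domain and assume (H1), (H2), (H3) and $\|\sigma\|_\infty<\infty$. Then the transition semigroup $(P_t)$ of the reflected diffusion admits a unique invariant probability measure $\mu$, and $$W_2\big(P_t(x,\cdot),\mu\big)\le e^{-\delta t}\Big(\int|x-y|^2\,d\mu(y)\Big)^{1/2}\qquad\forall x\in\bar{\mathcal{O}},\ t>0,$$ where $W_2$ is the Wasserstein distance of order 2 on $\mathbb{R}^d$ with the Euclidean metric.
   Context: Let $B$ be a standard $d$-dimensional Brownian motion on a filtered probability space satisfying the usual conditions. Let $\mathcal{O}\subset\mathbb{R}^d$ be a bounded convex domain with closure $\bar{\mathcal{O}}$. The reflected SDE is $$dX(t)=b(X(t))dt+\sigma(X(t))dB(t)-d\eta(t),\quad X(0)=x\in\bar{\mathcal{O}}.$$ A strong solution is a pair of adapted continuous processes $(X,\eta)$ such that $X$ takes values in $\bar{\mathcal{O}}$, $\eta$ has locally bounded variation with $\eta(0)=0$, $X(t)=x+\int_0^t b(X(s))ds+\int_0^t\sigma(X(s))dB(s)-\eta(t)$, and for every adapted continuous $\bar{\mathcal{O}}$-valued process $Y$, $\int_0^t\langle X(s)-Y(s),d\eta(s)\rangle\ge0$ for all $t$. Under (H1), (H2) such a solution exists and is unique; denote by $X^x$ the solution with $X^x(0)=x$ and by $P_t(x,\cdot)$ the law of $X^x(t)$. (H1): $b:\mathbb{R}^d\to\mathbb{R}^d$ and $\sigma:\mathbb{R}^d\to\mathcal{M}_{d\times d}(\mathbb{R})$ are locally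 Lipschitz. (H2): there is $M>0$ with $|b(x)|^2+|\sigma(x)|^2\le M(1+|x|^2)$ for all $x$. (H3): there is $\delta>0$ with $\|\sigma(x)-\sigma(y)\|_{HS}^2+2\langle x-y,b(x)-b(y)\rangle\le-2\delta|x-y|^2$ for all $x,y\in\mathbb{R}^d$. $\|\sigma\|_\infty=\sup_{x}\sup_{|z|\le1}|\sigma(x)z|$. $W_2(\mu,\nu)=\inf_{\pi\in\Pi(\mu,\nu)}\big(\int|x-y|^2d\pi(x,y)\big)^{1/2}$, $\Pi(\mu,\nu)$ being the set of couplings. *)

theory Defs
  imports "HOL-Probability.Probability"
begin

text \<open>State space: real^'d (Euclidean R^d, d = CARD('d)).  Time is real, only t \<ge> 0 used.
  A filtration is a family F of measures on the sample space of M (sub-sigma-algebras).\<close>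

definition usual_filtration :: "'a measure \<Rightarrow> (real \<Rightarrow> 'a measure) \<Rightarrow> bool" where
  "usual_filtration M F \<longleftrightarrow>
     (\<forall>t. space (F t) = space M \<and> sets (F t) \<subseteq> sets M) \<and>
     (\<forall>s t. s \<le> t \<longrightarrow> sets (F s) \<subseteq> sets (F t)) \<and>
     (\<forall>t. sets (F t) = (\<Inter>s\<in>{t<..}. sets (F s))) \<and>
     (\<forall>A N. A \<in> sets M \<and> emeasure M A = 0 \<and> N \<subseteq> A \<longrightarrow> N \<in> sets (F 0))"

definition adapted :: "(real \<Rightarrow> 'a measure) \<Rightarrow> (real \<Rightarrow> 'a \<Rightarrow> 'b::topological_space) \<Rightarrow> bool" where
  "adapted F X \<longleftrightarrow> (\<forall>t\<ge>0. X t \<in> borel_measurable (F t))"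

definition continuous_paths :: "'a measure \<Rightarrow> (real \<Rightarrow> 'a \<Rightarrow> 'b::topological_space) \<Rightarrow> bool" where
  "continuous_paths M X \<longleftrightarrow> (\<forall>\<omega>\<in>space M. continuous_on {0..} (\<lambda>t. X t \<omega>))"

definition brownian_motion :: "'a measure \<Rightarrow> (real \<Rightarrow> 'a measure) \<Rightarrow> (real \<Rightarrow> 'a \<Rightarrow> real^'d) \<Rightarrow> bool" where
  "brownian_motion M F B \<longleftrightarrow>
     adapted F B \<and> continuous_paths M B \<and> (\<forall>\<omega>\<in>space M. B 0 \<omega> = 0) \<and>
     (\<forall>s t. 0 \<le> s \<and> s < t \<longrightarrow>
        prob_space.indep_vars M (\<lambda>_. borel) (\<lambda>i \<omega>. (B t \<omega> - B s \<omega>) $ i) UNIV \<and>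
        (\<forall>i. distributed M lborel (\<lambda>\<omega>. (B t \<omega> - B s \<omega>) $ i) (normal_density 0 (sqrt (t - s)))) \<and>
        prob_space.indep_set M (sets (F s))
          {(\<lambda>\<omega>. B t \<omega> - B s \<omega>) -` A \<inter> space M | A. A \<in> sets (borel :: (real^'d) measure)})"

definition conv_in_prob :: "'a measure \<Rightarrow> (nat \<Rightarrow> 'a \<Rightarrow> 'b::real_normed_vector) \<Rightarrow> ('a \<Rightarrow> 'b) \<Rightarrow> bool" where
  "conv_in_prob M Z Y \<longleftrightarrow>
     (\<forall>e>0. (\<lambda>n. measure M {\<omega>\<in>space M. e < norm (Z n \<omega> - Y \<omega>)}) \<longlonglongrightarrow> 0)"

text \<open>Ito integral at time t of a continuous adapted matrix-valued integrand H against B: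
  the limit in probability of the left-point Riemann sums along the dyadic partitions of [0,t]
  (for continuous adapted integrands this limit exists and is the Ito integral).\<close>
definition is_ito_integral ::
  "'a measure \<Rightarrow> (real \<Rightarrow> 'a \<Rightarrow> real^'d) \<Rightarrow> (real \<Rightarrow> 'a \<Rightarrow> real^'d^'d) \<Rightarrow> real \<Rightarrow> ('a \<Rightarrow> real^'d) \<Rightarrow> bool" where
  "is_ito_integral M B H t I \<longleftrightarrow>
     conv_in_prob M
       (\<lambda>n \<omega>. \<Sum>k<2^n. H (t * real k / 2^n) \<omega> *v
                 (B (t * real (Suc k) / 2^n) \<omega> - B (t * real k / 2^n) \<omega>)) I"

definition bounded_variation_on :: "(real \<Rightarrow> 'b::real_normed_vector) \<Rightarrow> real \<Rightarrow> bool" where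
  "bounded_variation_on f t \<longleftrightarrow>
     (\<exists>V. \<forall>xs. sorted xs \<and> set xs \<subseteq> {0..t} \<longrightarrow>
        (\<Sum>i<length xs - 1. norm (f (xs ! Suc i) - f (xs ! i))) \<le> V)"

text \<open>Riemann--Stieltjes integral \<open>\<integral>_0^t \<langle>g(s), d f(s)\<rangle>\<close> of a continuous g against a continuous
  path f of bounded variation (limit along dyadic partitions).\<close>
definition rs_integral :: "(real \<Rightarrow> 'b::real_inner) \<Rightarrow> (real \<Rightarrow> 'b) \<Rightarrow> real \<Rightarrow> real" where
  "rs_integral g f t =
     lim (\<lambda>n. \<Sum>k<2^n. g (t * real k / 2^n) \<bullet> (f (t * real (Suc k) / 2^n) - f (t * real k / 2^n)))"

definition strong_solution ::
  "'a measure \<Rightarrow> (real \<Rightarrow> 'a measure) \<Rightarrow> (real \<Rightarrow> 'a \<Rightarrow> real^'d) \<Rightarrow>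
   (real^'d \<Rightarrow> real^'d) \<Rightarrow> (real^'d \<Rightarrow> real^'d^'d) \<Rightarrow> (real^'d) set \<Rightarrow> real^'d \<Rightarrow>
   (real \<Rightarrow> 'a \<Rightarrow> real^'d) \<Rightarrow> (real \<Rightarrow> 'a \<Rightarrow> real^'d) \<Rightarrow> bool" where
  "strong_solution M F B b \<sigma> U x X \<eta> \<longleftrightarrow>
     adapted F X \<and> continuous_paths M X \<and> adapted F \<eta> \<and> continuous_paths M \<eta> \<and>
     (\<forall>\<omega>\<in>space M. \<forall>t\<ge>0. X t \<omega> \<in> closure U) \<and>
     (\<forall>\<omega>\<in>space M. \<eta> 0 \<omega> = 0 \<and> (\<forall>t\<ge>0. bounded_variation_on (\<lambda>s. \<eta> s \<omega>) t)) \<and>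
     (\<forall>t\<ge>0. \<exists>I. is_ito_integral M B (\<lambda>s \<omega>. \<sigma> (X s \<omega>)) t I \<and>
        (AE \<omega> in M. X t \<omega> = x + integral {0..t} (\<lambda>s. b (X s \<omega>)) + I \<omega> - \<eta> t \<omega>)) \<and>
     (\<forall>Y. adapted F Y \<and> continuous_paths M Y \<and> (\<forall>\<omega>\<in>space M. \<forall>t\<ge>0. Y t \<omega> \<in> closure U) \<longrightarrow>
        (AE \<omega> in M. \<forall>t\<ge>0. rs_integral (\<lambda>s. X s \<omega> - Y s \<omega>) (\<lambda>s. \<eta> s \<omega>) t \<ge> 0))"

definition invariant_prob ::
  "(real \<Rightarrow> real^'d \<Rightarrow> (real^'d) measure) \<Rightarrow> (real^'d) set \<Rightarrow> (real^'d) measure \<Rightarrow> bool" where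
  "invariant_prob P S \<mu> \<longleftrightarrow>
     prob_space \<mu> \<and> sets \<mu> = sets borel \<and> emeasure \<mu> S = 1 \<and>
     (\<forall>t\<ge>0. \<forall>A\<in>sets borel. emeasure \<mu> A = (\<integral>\<^sup>+ x\<in>S. emeasure (P t x) A \<partial>\<mu>))"

definition couplings :: "('b::euclidean_space) measure \<Rightarrow> 'b measure \<Rightarrow> ('b \<times> 'b) measure set" where
  "couplings \<mu> \<nu> = {\<pi>. prob_space \<pi> \<and> sets \<pi> = sets borel \<and>
                        distr \<pi> borel fst = \<mu> \<and> distr \<pi> borel snd = \<nu>}"

text \<open>Wasserstein-2 distance (real-valued; finite for the compactly supported measures used here).\<close>
definition W2 :: "('b::euclidean_space) measure \<Rightarrow> 'b measure \<Rightarrow> real" where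
  "W2 \<mu> \<nu> = sqrt (enn2real (INF \<pi>\<in>couplings \<mu> \<nu>. \<integral>\<^sup>+ p. ennreal ((dist (fst p) (snd p))\<^sup>2) \<partial>\<pi>))"

end

theory Submission
  imports Defs
begin

text \<open>
  Both the contraction estimate and the Markov property are transferred from the projected Euler scheme,
  whose one-step map is a deterministic function of the current state and one Brownian increment. The scheme
  projects onto the slightly smaller convex set \<open>Kt \<theta> = (1 - \<theta>) K + \<theta> a0\<close>. Comparing the true solution, with
  coefficients frozen at the grid points, with the scheme, the reflection term of the solution has a favourable
  sign because \<open>K\<close> contains a ball of radius of order \<open>\<theta>\<close> about each point of \<open>Kt \<theta>\<close>, while the projection
  error of the scheme costs only \<open>\<theta>\<close> times its total variation, which is bounded in mean. No Ito formula and
  no moment bound on the variation of \<open>\<eta>\<close> is needed.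

  The synchronous coupling of two schemes contracts at rate \<open>\<delta>\<close> since projections are nonexpansive.
  An invariant measure is a weak limit of the laws at integer times; compactness of the laws on \<open>K\<close> comes from
  Helly's theorem on the line by means of a space-filling curve. Averaging the synchronous coupling over the
  invariant measure gives the bound for \<open>W2\<close>.
\<close>

section \<open>Brownian increments\<close>

text \<open>The shape of the proof is dictated by how little a solution provides. Its stochastic
  integral is known only as a limit in probability of dyadic Riemann sums, at each fixed time
  separately, and its reflection inequality only through a \<open>lim\<close> of dyadic sums, which
  says nothing unless these sums converge. So the equation is used at finitely many grid times with
  an error \<open>residual\<close>, and the reflection inequality with test processes for which
  convergence can be shown. The error \<open>residual\<close> displaces the point against which
  \<eta> is tested. The sign survives if the displaced point is still in \<open>K\<close>, and this
  is why the scheme has to keep a distance of order \<theta> from the boundary. Nothing is assumed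
  about how \<open>X x\<close> depends on \<open>x\<close>, nor is a Markov property: measurability
  in \<open>x\<close> follows from the contraction, the semigroup identity from the scheme. The
  latter is obtained for commensurable times, so invariance is shown at rational times and extended
  by continuity of paths.\<close>

locale bm_space = prob_space M for M :: "'a measure" +
  fixes F :: "real \<Rightarrow> 'a measure" and B :: "real \<Rightarrow> 'a \<Rightarrow> real^'d"
  assumes filt: "usual_filtration M F"
    and BM: "brownian_motion M F B"
begin

lemma filt_space_sets: "\<forall>t. space (F t) = space M \<and> sets (F t) \<subseteq> sets M"
  using filt unfolding usual_filtration_def by (rule conjunct1)

lemma space_F [simp]: "space (F t) = space M"
  using filt_space_sets by simp

lemma sets_F_subset: "sets (F t) \<subseteq> sets M"
  using filt_space_sets by simp

lemma sets_F_mono: "s \<le> t \<Longrightarrow> sets (F s) \<subseteq> sets (F t)"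
proof -
  have "\<forall>s t. s \<le> t \<longrightarrow> sets (F s) \<subseteq> sets (F t)"
    using filt unfolding usual_filtration_def by (elim conjE)
  then show "s \<le> t \<Longrightarrow> sets (F s) \<subseteq> sets (F t)" by simp
qed

lemma measurable_F_M: "f \<in> measurable (F t) N \<Longrightarrow> f \<in> measurable M N"
  using sets_F_subset[of t] by (auto simp: measurable_def)

lemma measurable_F_mono: "f \<in> measurable (F s) N \<Longrightarrow> s \<le> t \<Longrightarrow> f \<in> measurable (F t) N"
  using sets_F_mono[of s t] by (auto simp: measurable_def)

lemma B_measurable: "0 \<le> s \<Longrightarrow> s \<le> t \<Longrightarrow> B s \<in> borel_measurable (F t)"
  using BM measurable_F_mono[of "B s" s borel t] by (auto simp: brownian_motion_def adapted_def)

lemma inc_measurable [measurable]: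
  "0 \<le> s \<Longrightarrow> s \<le> t \<Longrightarrow> (\<lambda>\<omega>. B t \<omega> - B s \<omega>) \<in> borel_measurable M"
  using measurable_F_M[OF B_measurable, of s s] measurable_F_M[OF B_measurable, of t t] by simp

text \<open>\<open>brownian_motion\<close> states independence for the raw family of preimages of
  Borel sets. This family and \<open>F s\<close> are intersection-stable, so independence passes to
  the generated sigma-algebras and from there to \<open>f\<close> and \<open>g\<close>.\<close>

lemma indep_inc:
  assumes "0 \<le> s" "s < t" and f: "f \<in> measurable (F s) N" and g: "g \<in> measurable borel N'"
  shows "indep_var N f N' (\<lambda>\<omega>. g (B t \<omega> - B s \<omega>))"
proof -
  let ?G = "{(\<lambda>\<omega>. B t \<omega> - B s \<omega>) -` A \<inter> space M | A. A \<in> sets (borel :: (real^'d) measure)}"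
  have 1: "indep_set (sets (F s)) ?G"
    using BM assms unfolding brownian_motion_def by blast
  have 2: "sigma_sets (space M) {f -` A \<inter> space M | A. A \<in> sets N} \<subseteq> sets (F s)"
  proof -
    have "{f -` A \<inter> space M | A. A \<in> sets N} \<subseteq> sets (F s)"
      using f by (auto simp: measurable_def)
    from sets.sigma_sets_subset[OF this] show ?thesis by simp
  qed
  have 3: "indep_set (sets (F s)) (sigma_sets (space M) ?G)"
  proof -
    have "indep_set (sigma_sets (space M) (sets (F s))) (sigma_sets (space M) ?G)"
    proof (rule indep_set_sigma_sets[OF 1])
      show "Int_stable (sets (F s))" by (auto simp: Int_stable_def)
      show "Int_stable ?G"
      proof (rule Int_stableI, safe)
        fix A A' :: "(real^'d) set" assume "A \<in> sets borel" "A' \<in> sets borel"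
        then show "\<exists>C. (\<lambda>\<omega>. B t \<omega> - B s \<omega>) -` A \<inter> space M \<inter> ((\<lambda>\<omega>. B t \<omega> - B s \<omega>) -` A' \<inter> space M) =
           (\<lambda>\<omega>. B t \<omega> - B s \<omega>) -` C \<inter> space M \<and> C \<in> sets borel"
          by (intro exI[of _ "A \<inter> A'"]) auto
      qed
    qed
    then show ?thesis using sets.sigma_sets_eq[of "F s"] by simp
  qed
  show ?thesis
    unfolding indep_var_eq
  proof safe
    show "f \<in> measurable M N" using f by (rule measurable_F_M)
    show "(\<lambda>\<omega>. g (B t \<omega> - B s \<omega>)) \<in> measurable M N'"
      using assms by (intro measurable_compose[OF inc_measurable g]) auto
    have 4: "sigma_sets (space M) {(\<lambda>\<omega>. g (B t \<omega> - B s \<omega>)) -` A \<inter> space M |A. A \<in> sets N'} \<subseteq> sigma_sets (space M) ?G"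
    proof (rule sigma_sets_mono', safe)
      fix A assume "A \<in> sets N'"
      then have "g -` A \<in> sets borel" using measurable_sets[OF g] by simp
      then show "\<exists>A'. (\<lambda>\<omega>. g (B t \<omega> - B s \<omega>)) -` A \<inter> space M = (\<lambda>\<omega>. B t \<omega> - B s \<omega>) -` A' \<inter> space M \<and> A' \<in> sets borel"
        by (intro exI[of _ "g -` A"]) auto
    qed
    show "indep_set (sigma_sets (space M) {f -` A \<inter> space M |A. A \<in> sets N})
        (sigma_sets (space M) {(\<lambda>\<omega>. g (B t \<omega> - B s \<omega>)) -` A \<inter> space M |A. A \<in> sets N'})"
      using 2 3 4 unfolding indep_sets2_eq by blast
  qed
qed

lemma inc_component:
  assumes "0 \<le> s" "s < t"
  shows "integrable M (\<lambda>\<omega>. (B t \<omega> - B s \<omega>) $ i)" "(\<integral>\<omega>. (B t \<omega> - B s \<omega>) $ i \<partial>M) = 0"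
    "integrable M (\<lambda>\<omega>. ((B t \<omega> - B s \<omega>) $ i)\<^sup>2)" "(\<integral>\<omega>. ((B t \<omega> - B s \<omega>) $ i)\<^sup>2 \<partial>M) = t - s"
proof -
  let ?X = "\<lambda>\<omega>. (B t \<omega> - B s \<omega>) $ i"
  have D: "distributed M lborel ?X (normal_density 0 (sqrt (t - s)))"
    using BM assms unfolding brownian_motion_def by blast
  have pos: "0 < sqrt (t - s)" using assms by simp
  show "integrable M ?X"
    using distributed_integrable[OF D, of "\<lambda>x. x"] integrable_normal_moment_nz_1[OF pos, of 0] by simp
  show E: "(\<integral>\<omega>. ?X \<omega> \<partial>M) = 0" using normal_distributed_expectation[OF pos D] .
  show "integrable M (\<lambda>\<omega>. (?X \<omega>)\<^sup>2)"
    using distributed_integrable[OF D, of "\<lambda>x. x\<^sup>2"] integrable_normal_moment[OF pos, of 0 2] by simp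
  show "(\<integral>\<omega>. (?X \<omega>)\<^sup>2 \<partial>M) = t - s"
    using normal_distributed_variance[OF pos D] E assms by simp
qed

text \<open>The covariance matrix of an increment is \<open>t - s\<close> times the identity: off
  the diagonal the components are independent and centred.\<close>

lemma inc_component2:
  assumes "0 \<le> s" "s < t"
  shows "integrable M (\<lambda>\<omega>. (B t \<omega> - B s \<omega>) $ i * (B t \<omega> - B s \<omega>) $ j)"
    "(\<integral>\<omega>. (B t \<omega> - B s \<omega>) $ i * (B t \<omega> - B s \<omega>) $ j \<partial>M) = (if i = j then t - s else 0)"
proof -
  let ?X = "\<lambda>i \<omega>. (B t \<omega> - B s \<omega>) $ i"
  have I: "indep_vars (\<lambda>_. borel) ?X UNIV"
    using BM assms unfolding brownian_motion_def by blast
  have *: "integrable M (\<lambda>\<omega>. ?X i \<omega> * ?X j \<omega>) \<and> (\<integral>\<omega>. ?X i \<omega> * ?X j \<omega> \<partial>M) = (if i = j then t - s else 0)"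
  proof (cases "i = j")
    case True
    then show ?thesis using inc_component[OF assms, of i] by (simp add: power2_eq_square)
  next
    case False
    have J: "indep_vars (\<lambda>_. borel) ?X {i, j}" by (rule indep_vars_subset[OF I]) auto
    have int: "k \<in> {i,j} \<Longrightarrow> integrable M (?X k)" for k using inc_component[OF assms] by simp
    show ?thesis
      using indep_vars_lebesgue_integral[OF _ J int] indep_vars_integrable[OF _ J int] False inc_component[OF assms]
      by simp
  qed
  from * show "integrable M (\<lambda>\<omega>. ?X i \<omega> * ?X j \<omega>)" "(\<integral>\<omega>. ?X i \<omega> * ?X j \<omega> \<partial>M) = (if i = j then t - s else 0)" by auto
qed

lemma integral_times_inc:
  fixes f :: "'a \<Rightarrow> real"
  assumes "0 \<le> s" "s < t" and f: "f \<in> borel_measurable (F s)" and fi: "integrable M f"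
    and g: "g \<in> borel_measurable borel" and gi: "integrable M (\<lambda>\<omega>. g (B t \<omega> - B s \<omega>) :: real)"
  shows "integrable M (\<lambda>\<omega>. f \<omega> * g (B t \<omega> - B s \<omega>))"
    "(\<integral>\<omega>. f \<omega> * g (B t \<omega> - B s \<omega>) \<partial>M) = (\<integral>\<omega>. f \<omega> \<partial>M) * (\<integral>\<omega>. g (B t \<omega> - B s \<omega>) \<partial>M)"
proof -
  have iv: "indep_var borel f borel (\<lambda>\<omega>. g (B t \<omega> - B s \<omega>))"
    by (rule indep_inc[OF assms(1,2) f g])
  show "integrable M (\<lambda>\<omega>. f \<omega> * g (B t \<omega> - B s \<omega>))"
    by (rule indep_var_integrable[OF iv fi gi])
  show "(\<integral>\<omega>. f \<omega> * g (B t \<omega> - B s \<omega>) \<partial>M) = (\<integral>\<omega>. f \<omega> \<partial>M) * (\<integral>\<omega>. g (B t \<omega> - B s \<omega>) \<partial>M)"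
    by (rule indep_var_lebesgue_integral[OF iv fi gi])
qed

lemma norm_matrix_power2: "(norm (A :: real^'n^'m))\<^sup>2 = (\<Sum>i\<in>UNIV. \<Sum>j\<in>UNIV. (A $ i $ j)\<^sup>2)"
  by (simp add: norm_vec_def L2_set_def sum_nonneg)

text \<open>On \<open>real^'d^'d\<close> the norm is the Hilbert--Schmidt norm, so this is the one-step Ito isometry.\<close>

lemma one_step_isometry:
  fixes v :: "'a \<Rightarrow> real^'d" and H :: "'a \<Rightarrow> real^'d^'d"
  assumes "0 \<le> s" "s < t"
    and v: "v \<in> borel_measurable (F s)" "integrable M (\<lambda>\<omega>. (norm (v \<omega>))\<^sup>2)"
    and H: "H \<in> borel_measurable (F s)" "\<And>\<omega>. \<omega> \<in> space M \<Longrightarrow> norm (H \<omega>) \<le> c"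
  shows "integrable M (\<lambda>\<omega>. (norm (v \<omega> + H \<omega> *v (B t \<omega> - B s \<omega>)))\<^sup>2)"
    "(\<integral>\<omega>. (norm (v \<omega> + H \<omega> *v (B t \<omega> - B s \<omega>)))\<^sup>2 \<partial>M)
       = (\<integral>\<omega>. (norm (v \<omega>))\<^sup>2 \<partial>M) + (t - s) * (\<integral>\<omega>. (norm (H \<omega>))\<^sup>2 \<partial>M)"
proof -
  let ?D = "\<lambda>\<omega>. B t \<omega> - B s \<omega>"
  have Hc: "\<bar>H \<omega> $ i $ j\<bar> \<le> c" if "\<omega> \<in> space M" for \<omega> i j
    using H(2)[OF that] component_le_norm_cart[of "H \<omega> $ i" j] Finite_Cartesian_Product.norm_nth_le[of "H \<omega>" i] by simp
  have mH: "(\<lambda>\<omega>. H \<omega> $ i $ j) \<in> borel_measurable (F s)" for i j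
    by (rule borel_measurable_continuous_onI[THEN measurable_compose[OF H(1)]]) (intro continuous_intros)
  have mv: "(\<lambda>\<omega>. v \<omega> $ i) \<in> borel_measurable (F s)" for i
    by (rule borel_measurable_continuous_onI[THEN measurable_compose[OF v(1)]]) (intro continuous_intros)
  have mHH: "(\<lambda>\<omega>. H \<omega> $ i $ j * H \<omega> $ i $ l) \<in> borel_measurable (F s)" for i j l using mH by measurable
  have mvH: "(\<lambda>\<omega>. 2 * v \<omega> $ i * H \<omega> $ i $ j) \<in> borel_measurable (F s)" for i j using mv mH by measurable
  have gj: "(\<lambda>x::real^'d. x $ j) \<in> borel_measurable borel" for j by measurable
  have gjl: "(\<lambda>x::real^'d. x $ j * x $ l) \<in> borel_measurable borel" for j l by measurable
  have [measurable]: "v \<in> borel_measurable M" "(\<lambda>\<omega>. 2 * v \<omega> $ i * H \<omega> $ i $ j) \<in> borel_measurable M" for i j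
    by (rule measurable_F_M[OF v(1)]) (rule measurable_F_M[OF mvH])
  \<comment> \<open>\<open>v\<close> is only square integrable, so the cross term is dominated by
    way of \<open>2 * (a * c) \<le> a\<^sup>2 + c\<^sup>2\<close>.\<close>
  have ivH: "integrable M (\<lambda>\<omega>. 2 * v \<omega> $ i * H \<omega> $ i $ j)" for i j
  proof (rule Bochner_Integration.integrable_bound)
    show "integrable M (\<lambda>\<omega>. (norm (v \<omega>))\<^sup>2 + c\<^sup>2)" using v(2) by simp
    show "AE \<omega> in M. norm (2 * v \<omega> $ i * H \<omega> $ i $ j) \<le> norm ((norm (v \<omega>))\<^sup>2 + c\<^sup>2)"
    proof (rule AE_I2)
      fix \<omega> assume w: "\<omega> \<in> space M"
      have "\<bar>v \<omega> $ i\<bar> * \<bar>H \<omega> $ i $ j\<bar> \<le> norm (v \<omega>) * c"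
        using component_le_norm_cart[of "v \<omega>" i] Hc[OF w] by (intro mult_mono) auto
      moreover have "2 * (norm (v \<omega>) * c) \<le> (norm (v \<omega>))\<^sup>2 + c\<^sup>2"
        using sum_squares_bound[of "norm (v \<omega>)" c] by simp
      ultimately show "norm (2 * v \<omega> $ i * H \<omega> $ i $ j) \<le> norm ((norm (v \<omega>))\<^sup>2 + c\<^sup>2)"
        by (simp add: abs_mult)
    qed
  qed measurable
  have cHH: "\<bar>H \<omega> $ i $ j * H \<omega> $ i $ l\<bar> \<le> c * c" if "\<omega> \<in> space M" for \<omega> i j l
    using mult_mono[OF Hc[OF that, of i j] Hc[OF that, of i l]] Hc[OF that, of i j] by (simp add: abs_mult)
  have iHH: "integrable M (\<lambda>\<omega>. H \<omega> $ i $ j * H \<omega> $ i $ l)" for i j l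
    by (rule integrable_const_bound[where B="c * c"]) (use cHH in \<open>auto intro!: AE_I2 measurable_F_M[OF mHH]\<close>)
  note A = integral_times_inc[OF assms(1,2) mvH ivH gj inc_component(1)[OF assms(1,2)]]
  note C = integral_times_inc[OF assms(1,2) mHH iHH gjl inc_component2(1)[OF assms(1,2)]]
  have exp: "(norm (v \<omega> + H \<omega> *v ?D \<omega>))\<^sup>2 = (norm (v \<omega>))\<^sup>2
      + (\<Sum>i\<in>UNIV. \<Sum>j\<in>UNIV. 2 * v \<omega> $ i * H \<omega> $ i $ j * ?D \<omega> $ j)
      + (\<Sum>i\<in>UNIV. \<Sum>j\<in>UNIV. \<Sum>l\<in>UNIV. H \<omega> $ i $ j * H \<omega> $ i $ l * (?D \<omega> $ j * ?D \<omega> $ l))" for \<omega>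
  proof -
    have "(norm (v \<omega> + H \<omega> *v ?D \<omega>))\<^sup>2 = (norm (v \<omega>))\<^sup>2 + 2 * (v \<omega> \<bullet> (H \<omega> *v ?D \<omega>)) + (H \<omega> *v ?D \<omega>) \<bullet> (H \<omega> *v ?D \<omega>)"
      by (simp add: power2_norm_eq_inner inner_add_left inner_add_right inner_commute)
    moreover have "2 * (v \<omega> \<bullet> (H \<omega> *v ?D \<omega>)) = (\<Sum>i\<in>UNIV. \<Sum>j\<in>UNIV. 2 * v \<omega> $ i * H \<omega> $ i $ j * ?D \<omega> $ j)"
      by (simp add: inner_vec_def matrix_vector_mult_def sum_distrib_left mult_ac)
    moreover have "(H \<omega> *v ?D \<omega>) \<bullet> (H \<omega> *v ?D \<omega>) = (\<Sum>i\<in>UNIV. \<Sum>j\<in>UNIV. \<Sum>l\<in>UNIV. H \<omega> $ i $ j * H \<omega> $ i $ l * (?D \<omega> $ j * ?D \<omega> $ l))"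
      by (simp add: inner_vec_def matrix_vector_mult_def sum_product mult_ac)
    ultimately show ?thesis by simp
  qed
  show "integrable M (\<lambda>\<omega>. (norm (v \<omega> + H \<omega> *v ?D \<omega>))\<^sup>2)"
    unfolding exp by (intro Bochner_Integration.integrable_add Bochner_Integration.integrable_sum v(2) A(1) C(1))
  have hi: "integrable M (\<lambda>\<omega>. (H \<omega> $ i $ j)\<^sup>2)" for i j
    using iHH[of i j j] by (simp add: power2_eq_square)
  have "(\<integral>\<omega>. (norm (v \<omega> + H \<omega> *v ?D \<omega>))\<^sup>2 \<partial>M) = (\<integral>\<omega>. (norm (v \<omega>))\<^sup>2 \<partial>M)
      + (\<Sum>i\<in>UNIV. \<Sum>j\<in>UNIV. \<integral>\<omega>. 2 * v \<omega> $ i * H \<omega> $ i $ j * ?D \<omega> $ j \<partial>M)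
      + (\<Sum>i\<in>UNIV. \<Sum>j\<in>UNIV. \<Sum>l\<in>UNIV. \<integral>\<omega>. H \<omega> $ i $ j * H \<omega> $ i $ l * (?D \<omega> $ j * ?D \<omega> $ l) \<partial>M)"
    unfolding exp
    by (simp add: v(2) A(1) C(1) Bochner_Integration.integral_add Bochner_Integration.integral_sum Bochner_Integration.integrable_sum Bochner_Integration.integrable_add del: vector_minus_component)
  also have "\<dots> = (\<integral>\<omega>. (norm (v \<omega>))\<^sup>2 \<partial>M) + (\<Sum>i\<in>UNIV. \<Sum>j\<in>UNIV. (\<integral>\<omega>. (H \<omega> $ i $ j)\<^sup>2 \<partial>M) * (t - s))"
    unfolding A(2) C(2) inc_component(2)[OF assms(1,2)] inc_component2(2)[OF assms(1,2)]
    by (simp add: if_distrib[of "\<lambda>x. _ * x"] sum.delta power2_eq_square cong: if_cong)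
  also have "(\<Sum>i\<in>UNIV. \<Sum>j\<in>UNIV. (\<integral>\<omega>. (H \<omega> $ i $ j)\<^sup>2 \<partial>M) * (t - s)) = (t - s) * (\<integral>\<omega>. (norm (H \<omega>))\<^sup>2 \<partial>M)"
    unfolding norm_matrix_power2
    by (simp add: hi Bochner_Integration.integral_sum Bochner_Integration.integrable_sum sum_distrib_left mult.commute)
  finally show "(\<integral>\<omega>. (norm (v \<omega> + H \<omega> *v ?D \<omega>))\<^sup>2 \<partial>M) = (\<integral>\<omega>. (norm (v \<omega>))\<^sup>2 \<partial>M) + (t - s) * (\<integral>\<omega>. (norm (H \<omega>))\<^sup>2 \<partial>M)" .
qed

end

section \<open>Discrete stochastic integrals and moduli of continuity\<close>

context bm_space
begin

definition dsum :: "real \<Rightarrow> (nat \<Rightarrow> 'a \<Rightarrow> real^'d^'d) \<Rightarrow> nat \<Rightarrow> 'a \<Rightarrow> real^'d" where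
  "dsum h H n \<omega> = (\<Sum>k<n. H k \<omega> *v (B (h * real (Suc k)) \<omega> - B (h * real k) \<omega>))"

lemma dsum_0 [simp]: "dsum h H 0 \<omega> = 0" by (simp add: dsum_def)

lemma dsum_Suc: "dsum h H (Suc n) \<omega> = dsum h H n \<omega> + H n \<omega> *v (B (h * real (Suc n)) \<omega> - B (h * real n) \<omega>)"
  by (simp add: dsum_def)

lemma dsum_diff: "dsum h H n \<omega> - dsum h G n \<omega> = dsum h (\<lambda>k \<omega>. H k \<omega> - G k \<omega>) n \<omega>"
  by (simp add: dsum_def sum_subtractf matrix_vector_mult_diff_rdistrib)

lemma measurable_matrix_vector [measurable]:
  fixes H :: "'b \<Rightarrow> real^'n^'m"
  assumes [measurable]: "H \<in> borel_measurable N" "w \<in> borel_measurable N"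
  shows "(\<lambda>\<omega>. H \<omega> *v w \<omega>) \<in> borel_measurable N"
proof -
  have "(\<lambda>p :: (real^'n^'m) \<times> (real^'n). fst p *v snd p) \<in> borel_measurable borel"
    by (intro borel_measurable_continuous_onI) (auto simp: matrix_vector_mult_def intro!: continuous_intros)
  then have "(\<lambda>\<omega>. fst (H \<omega>, w \<omega>) *v snd (H \<omega>, w \<omega>)) \<in> borel_measurable N"
    by (rule measurable_compose[rotated]) simp
  then show ?thesis by simp
qed

lemma dsum_measurable:
  assumes "0 \<le> h" "\<And>k. k < n \<Longrightarrow> H k \<in> borel_measurable (F (h * real k))"
  shows "dsum h H n \<in> borel_measurable (F (h * real n))"
  using assms(2)
proof (induction n)
  case (Suc n)
  have le: "h * real n \<le> h * real (Suc n)" using assms(1) by (simp add: algebra_simps)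
  have [measurable]: "dsum h H n \<in> borel_measurable (F (h * real (Suc n)))"
    by (rule measurable_F_mono[OF Suc.IH le]) (use Suc.prems in auto)
  have [measurable]: "H n \<in> borel_measurable (F (h * real (Suc n)))"
    by (rule measurable_F_mono[OF Suc.prems le]) auto
  have [measurable]: "B (h * real n) \<in> borel_measurable (F (h * real (Suc n)))"
     "B (h * real (Suc n)) \<in> borel_measurable (F (h * real (Suc n)))"
    using assms(1) le by (auto intro!: B_measurable)
  show ?case unfolding dsum_Suc[abs_def] by measurable
qed (simp add: dsum_def[abs_def])

text \<open>Induction with the sum accumulated so far in the role of \<open>v\<close> in
  \<open>one_step_isometry\<close>; orthogonality of the terms is contained there.\<close>

lemma dsum_isometry:
  assumes "0 < h" "\<And>k. k < n \<Longrightarrow> H k \<in> borel_measurable (F (h * real k))"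
    "\<And>k \<omega>. k < n \<Longrightarrow> \<omega> \<in> space M \<Longrightarrow> norm (H k \<omega>) \<le> c"
  shows "integrable M (\<lambda>\<omega>. (norm (dsum h H n \<omega>))\<^sup>2) \<and>
    (\<integral>\<omega>. (norm (dsum h H n \<omega>))\<^sup>2 \<partial>M) = h * (\<Sum>k<n. \<integral>\<omega>. (norm (H k \<omega>))\<^sup>2 \<partial>M)"
  using assms(2,3)
proof (induction n)
  case (Suc n)
  have IH: "integrable M (\<lambda>\<omega>. (norm (dsum h H n \<omega>))\<^sup>2)"
    "(\<integral>\<omega>. (norm (dsum h H n \<omega>))\<^sup>2 \<partial>M) = h * (\<Sum>k<n. \<integral>\<omega>. (norm (H k \<omega>))\<^sup>2 \<partial>M)"
    using Suc.IH Suc.prems by auto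
  have m: "dsum h H n \<in> borel_measurable (F (h * real n))"
    using assms(1) Suc.prems by (intro dsum_measurable) auto
  have lt: "0 \<le> h * real n" "h * real n < h * real (Suc n)" using assms(1) by auto
  note O = one_step_isometry[OF lt m IH(1), where H="H n" and c=c]
  have "h * real (Suc n) - h * real n = h" by (simp add: algebra_simps)
  with O show ?case using Suc.prems unfolding dsum_Suc IH(2) by (simp add: distrib_left)
qed simp

text \<open>A Kolmogorov-type inequality: exceeding \<open>e\<close> at some index forces the
  stopped sum to exceed \<open>e\<close> at index \<open>n\<close>, and Chebyshev together with the
  isometry bounds that single event.\<close>

lemma dsum_maximal:
  assumes h: "0 < h" and H: "\<And>k. k < n \<Longrightarrow> H k \<in> borel_measurable (F (h * real k))"
    "\<And>k \<omega>. k < n \<Longrightarrow> \<omega> \<in> space M \<Longrightarrow> norm (H k \<omega>) \<le> c" and e: "0 < e"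
  shows "prob {\<omega>\<in>space M. \<exists>k\<le>n. e < norm (dsum h H k \<omega>)} \<le> h * (\<Sum>k<n. \<integral>\<omega>. (norm (H k \<omega>))\<^sup>2 \<partial>M) / e\<^sup>2"
proof -
  text \<open>Stopping the sum when it first exceeds \<open>e\<close> is again a discrete integral, of the integrand \<open>G\<close>.\<close>
  define G where "G k \<omega> = (if \<forall>j\<in>{..k}. norm (dsum h H j \<omega>) \<le> e then H k \<omega> else 0)" for k \<omega>
  have G: "G k \<in> borel_measurable (F (h * real k))" if "k < n" for k
  proof -
    have [measurable]: "H k \<in> borel_measurable (F (h * real k))" using H that by auto
    have [measurable]: "Measurable.pred (F (h * real k)) (\<lambda>\<omega>. \<forall>j\<in>{..k}. norm (dsum h H j \<omega>) \<le> e)"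
    proof (intro pred_intros_finite)
      fix j assume "j \<in> {..k}"
      then have [measurable]: "dsum h H j \<in> borel_measurable (F (h * real k))"
        by (intro measurable_F_mono[OF dsum_measurable]) (use h H \<open>k < n\<close> in auto)
      show "Measurable.pred (F (h * real k)) (\<lambda>\<omega>. norm (dsum h H j \<omega>) \<le> e)" by measurable
    qed simp
    show ?thesis unfolding G_def by measurable
  qed
  have Gle: "norm (G k \<omega>) \<le> norm (H k \<omega>)" for k \<omega> by (auto simp: G_def)
  have Gc: "norm (G k \<omega>) \<le> c" if "k < n" "\<omega> \<in> space M" for k \<omega>
    using Gle[of k \<omega>] H(2)[OF that] by simp
  note iso = dsum_isometry[OF h G Gc]
  have mS: "dsum h H k \<in> borel_measurable M" if "k \<le> n" for k
    by (rule measurable_F_M[OF dsum_measurable]) (use h H that in auto)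
  have mG: "dsum h G n \<in> borel_measurable M"
    by (rule measurable_F_M[OF dsum_measurable]) (use h G in auto)
  have mono: "e < norm (dsum h G n \<omega>)" if ex: "\<exists>k\<le>n. e < norm (dsum h H k \<omega>)" for \<omega>
  proof -
    define k0 where "k0 = (LEAST k. e < norm (dsum h H k \<omega>))"
    from ex obtain k where k: "k \<le> n" "e < norm (dsum h H k \<omega>)" by auto
    have k0: "e < norm (dsum h H k0 \<omega>)" unfolding k0_def using k(2) by (rule LeastI[where P="\<lambda>k. e < norm (dsum h H k \<omega>)"])
    have "k0 \<le> n" unfolding k0_def using Least_le[of "\<lambda>k. e < norm (dsum h H k \<omega>)", OF k(2)] k(1) by simp
    have less: "j < k0 \<Longrightarrow> norm (dsum h H j \<omega>) \<le> e" for j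
      unfolding k0_def using not_less_Least by fastforce
    have "dsum h G n \<omega> = (\<Sum>k<k0. G k \<omega> *v (B (h * real (Suc k)) \<omega> - B (h * real k) \<omega>))"
      unfolding dsum_def
    proof (rule sum.mono_neutral_right)
      show "\<forall>i\<in>{..<n} - {..<k0}. G i \<omega> *v (B (h * real (Suc i)) \<omega> - B (h * real i) \<omega>) = 0"
        using k0 by (auto simp: G_def not_less dest!: bspec[where x=k0])
    qed (use \<open>k0 \<le> n\<close> in auto)
    also have "\<dots> = dsum h H k0 \<omega>"
      unfolding dsum_def by (rule sum.cong) (auto simp: G_def less)
    finally show ?thesis using k0 by simp
  qed
  have ms: "{\<omega>\<in>space M. e < norm (dsum h G n \<omega>)} \<in> events"
    using mG by measurable
  have "prob {\<omega>\<in>space M. \<exists>k\<le>n. e < norm (dsum h H k \<omega>)} \<le> prob {\<omega>\<in>space M. e < norm (dsum h G n \<omega>)}"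
    using mono ms by (intro finite_measure_mono) auto
  also have "\<dots> \<le> prob {\<omega>\<in>space M. e\<^sup>2 \<le> (norm (dsum h G n \<omega>))\<^sup>2}"
  proof (rule finite_measure_mono)
    show "{\<omega> \<in> space M. e < norm (dsum h G n \<omega>)} \<subseteq> {\<omega> \<in> space M. e\<^sup>2 \<le> (norm (dsum h G n \<omega>))\<^sup>2}"
      using e by (auto intro!: power_mono)
    show "{\<omega> \<in> space M. e\<^sup>2 \<le> (norm (dsum h G n \<omega>))\<^sup>2} \<in> events" using mG by measurable
  qed
  also have "\<dots> \<le> (\<integral>\<omega>. (norm (dsum h G n \<omega>))\<^sup>2 \<partial>M) / e\<^sup>2"
    using iso e by (intro integral_Markov_inequality_measure[where A="{}"]) auto
  also have "\<dots> = h * (\<Sum>k<n. \<integral>\<omega>. (norm (G k \<omega>))\<^sup>2 \<partial>M) / e\<^sup>2" using iso by simp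
  also have "\<dots> \<le> h * (\<Sum>k<n. \<integral>\<omega>. (norm (H k \<omega>))\<^sup>2 \<partial>M) / e\<^sup>2"
  proof -
    have "(\<integral>\<omega>. (norm (G k \<omega>))\<^sup>2 \<partial>M) \<le> (\<integral>\<omega>. (norm (H k \<omega>))\<^sup>2 \<partial>M)" if "k < n" for k
    proof (rule integral_mono_AE')
      have [measurable]: "H k \<in> borel_measurable M" using measurable_F_M H that by blast
      show "integrable M (\<lambda>\<omega>. (norm (H k \<omega>))\<^sup>2)"
        by (rule integrable_const_bound[where B="c\<^sup>2"]) (use H(2) that in \<open>auto intro!: AE_I2 power_mono\<close>)
    qed (auto intro!: power_mono Gle)
    then have "(\<Sum>k<n. \<integral>\<omega>. (norm (G k \<omega>))\<^sup>2 \<partial>M) \<le> (\<Sum>k<n. \<integral>\<omega>. (norm (H k \<omega>))\<^sup>2 \<partial>M)" by (intro sum_mono) auto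
    then show ?thesis using h by (intro divide_right_mono mult_left_mono) auto
  qed
  finally show ?thesis .
qed

text \<open>The increments inside a block of \<open>c\<close> steps telescope, so a sum on the
  coarse grid is a sum on the fine grid whose integrand is held at the left end of each block. Sums
  of different mesh thus become discrete integrals against the same increments and can be
  subtracted.\<close>

lemma dsum_coarsen:
  assumes "0 < c"
  shows "dsum (h * real c) (\<lambda>i. H (i * c)) n \<omega> = dsum h (\<lambda>j. H ((j div c) * c)) (n * c) \<omega>"
proof -
  have "(\<Sum>i<n. \<Sum>j\<in>{i*c..<i*c+c}. H ((j div c) * c) \<omega> *v (B (h * real (Suc j)) \<omega> - B (h * real j) \<omega>))
     = dsum h (\<lambda>j. H ((j div c) * c)) (n * c) \<omega>"
    unfolding dsum_def by (rule sum.nat_group)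
  moreover have "(\<Sum>j\<in>{i*c..<i*c+c}. H ((j div c) * c) \<omega> *v (B (h * real (Suc j)) \<omega> - B (h * real j) \<omega>))
     = H (i * c) \<omega> *v (B (h * real c * real (Suc i)) \<omega> - B (h * real c * real i) \<omega>)" for i
  proof -
    have "(\<Sum>j\<in>{i*c..<i*c+c}. H ((j div c) * c) \<omega> *v (B (h * real (Suc j)) \<omega> - B (h * real j) \<omega>))
       = (\<Sum>j\<in>{i*c..<i*c+c}. H (i * c) \<omega> *v (B (h * real (Suc j)) \<omega> - B (h * real j) \<omega>))"
    proof (rule sum.cong)
      fix j assume "j \<in> {i*c..<i*c+c}"
      then have "j div c = i" using assms by (intro div_nat_eqI) (auto simp: algebra_simps)
      then show "H ((j div c) * c) \<omega> *v (B (h * real (Suc j)) \<omega> - B (h * real j) \<omega>)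
        = H (i * c) \<omega> *v (B (h * real (Suc j)) \<omega> - B (h * real j) \<omega>)" by simp
    qed simp
    also have "\<dots> = H (i * c) \<omega> *v (\<Sum>j\<in>{i*c..<i*c+c}. (B (h * real (Suc j)) \<omega> - B (h * real j) \<omega>))"
      by (rule linear_sum[OF matrix_vector_mul_linear, symmetric])
    also have "(\<Sum>j\<in>{i*c..<i*c+c}. (B (h * real (Suc j)) \<omega> - B (h * real j) \<omega>)) = B (h * real (i*c+c)) \<omega> - B (h * real (i*c)) \<omega>"
      by (rule sum_Suc_diff'[of "i*c" "i*c+c" "\<lambda>j. B (h * real j) \<omega>"]) simp
    finally show ?thesis by (simp add: algebra_simps)
  qed
  ultimately show ?thesis by (simp add: dsum_def)
qed

end

section \<open>Modulus of continuity of a path as a random variable\<close>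

definition osc_set :: "real \<Rightarrow> real \<Rightarrow> (real \<times> real) set" where
  "osc_set T h = {p \<in> {0..T} \<times> {0..T}. \<bar>fst p - snd p\<bar> \<le> h}"

definition osc :: "(real \<Rightarrow> 'b::metric_space) \<Rightarrow> real \<Rightarrow> real \<Rightarrow> real" where
  "osc y T h = (SUP p\<in>osc_set T h. dist (y (fst p)) (y (snd p)))"

lemma osc_upper:
  assumes "\<And>u v. u \<in> {0..T} \<Longrightarrow> v \<in> {0..T} \<Longrightarrow> dist (y u) (y v) \<le> c"
    and "u \<in> {0..T}" "v \<in> {0..T}" "\<bar>u - v\<bar> \<le> h"
  shows "dist (y u) (y v) \<le> osc y T h"
proof -
  have "bdd_above ((\<lambda>p. dist (y (fst p)) (y (snd p))) ` osc_set T h)"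
    using assms(1) by (intro bdd_aboveI2[where M=c]) (auto simp: osc_set_def)
  moreover have "(u, v) \<in> osc_set T h" using assms by (auto simp: osc_set_def)
  ultimately show ?thesis unfolding osc_def by (metis (no_types, lifting) cSUP_upper fst_conv snd_conv)
qed

lemma osc_least:
  assumes "\<And>u v. u \<in> {0..T} \<Longrightarrow> v \<in> {0..T} \<Longrightarrow> \<bar>u - v\<bar> \<le> h \<Longrightarrow> dist (y u) (y v) \<le> c" "0 \<le> T" "0 \<le> h"
  shows "osc y T h \<le> c"
proof -
  have "(0, 0) \<in> osc_set T h" using assms by (auto simp: osc_set_def)
  then have ne: "osc_set T h \<noteq> {}" by auto
  show ?thesis unfolding osc_def
    using assms(1) by (intro cSUP_least[OF ne]) (auto simp: osc_set_def)
qed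

lemma osc_tendsto_0:
  fixes y :: "real \<Rightarrow> 'b::metric_space"
  assumes "continuous_on {0..T} y" "0 \<le> T" "h \<longlonglongrightarrow> 0" "\<And>n. 0 \<le> h n"
  shows "(\<lambda>n. osc y T (h n)) \<longlonglongrightarrow> 0"
proof (rule LIMSEQ_I)
  fix r :: real assume "0 < r"
  have "bounded (y ` {0..T})" using assms(1) by (intro compact_imp_bounded compact_continuous_image) auto
  then obtain c where c: "\<And>u v. u \<in> {0..T} \<Longrightarrow> v \<in> {0..T} \<Longrightarrow> dist (y u) (y v) \<le> c"
    unfolding bounded_two_points by blast
  have nonneg: "0 \<le> osc y T (h n)" for n
    using osc_upper[where y=y and T=T and c=c and u=0 and v=0 and h="h n"] c assms by auto
  have "uniformly_continuous_on {0..T} y" using assms(1) by (intro compact_uniformly_continuous) auto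
  then obtain d where d: "d > 0" "\<And>u v. u \<in> {0..T} \<Longrightarrow> v \<in> {0..T} \<Longrightarrow> dist v u < d \<Longrightarrow> dist (y v) (y u) < r / 2"
    unfolding uniformly_continuous_on_def using \<open>0 < r\<close> by (metis half_gt_zero)
  from LIMSEQ_D[OF assms(3) d(1)] obtain N where N: "\<And>n. n \<ge> N \<Longrightarrow> h n < d" by fastforce
  have "osc y T (h n) \<le> r / 2" if "n \<ge> N" for n
    by (rule osc_least) (use d(2) N[OF that] assms in \<open>force simp: dist_real_def less_imp_le\<close>)+
  then show "\<exists>N. \<forall>n\<ge>N. norm (osc y T (h n) - 0) < r"
    using nonneg \<open>0 < r\<close> by (intro exI[of _ N] allI impI) (simp, smt (verit) field_sum_of_halves)
qed

text \<open>For a continuous path the supremum over the closed band \<open>osc_set T h\<close>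
  equals the supremum over a countable subset dense in that band.\<close>

lemma osc_measurable:
  fixes Y :: "real \<Rightarrow> 'a \<Rightarrow> 'b::{metric_space, second_countable_topology}"
  assumes m: "\<And>t. 0 \<le> t \<Longrightarrow> Y t \<in> borel_measurable N" and cont: "\<And>\<omega>. \<omega> \<in> space N \<Longrightarrow> continuous_on {0..} (\<lambda>t. Y t \<omega>)"
    and c: "\<And>\<omega> u v. \<omega> \<in> space N \<Longrightarrow> 0 \<le> u \<Longrightarrow> 0 \<le> v \<Longrightarrow> dist (Y u \<omega>) (Y v \<omega>) \<le> c"
    and "0 \<le> T" "0 \<le> h"
  shows "(\<lambda>\<omega>. osc (\<lambda>t. Y t \<omega>) T h) \<in> borel_measurable N"
proof -
  obtain D where D: "countable D" "D \<subseteq> osc_set T h" "osc_set T h \<subseteq> closure D" by (rule separable)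
  let ?f = "\<lambda>\<omega> p. dist (Y (fst p) \<omega>) (Y (snd p) \<omega>)"
  have ne: "osc_set T h \<noteq> {}" using assms(4,5) by (auto simp: osc_set_def intro!: exI[of _ 0])
  then have Dne: "D \<noteq> {}" using D by auto
  have eq: "osc (\<lambda>t. Y t \<omega>) T h = (SUP p\<in>D. ?f \<omega> p)" if w: "\<omega> \<in> space N" for \<omega>
  proof (rule antisym)
    have bdd: "bdd_above (?f \<omega> ` osc_set T h)"
      using c[OF w] by (intro bdd_aboveI2[where M=c]) (auto simp: osc_set_def)
    have bddD: "bdd_above (?f \<omega> ` D)" by (rule bdd_above_mono[OF bdd]) (use D in auto)
    show "(SUP p\<in>D. ?f \<omega> p) \<le> osc (\<lambda>t. Y t \<omega>) T h"
      unfolding osc_def by (rule cSUP_subset_mono[OF Dne bdd D(2)]) simp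
    have cl: "closed (osc_set T h)"
    proof -
      have "osc_set T h = ({0..T} \<times> {0..T}) \<inter> {p. \<bar>fst p - snd p\<bar> \<le> h}" by (auto simp: osc_set_def)
      then show ?thesis by (auto intro!: closed_Int closed_Times closed_Collect_le continuous_intros)
    qed
    have cf: "continuous_on (closure D) (?f \<omega>)"
    proof (rule continuous_on_subset[of "osc_set T h"])
      show "continuous_on (osc_set T h) (?f \<omega>)"
        by (intro continuous_intros continuous_on_compose2[OF cont[OF w], where f=fst] continuous_on_compose2[OF cont[OF w], where f=snd])
           (auto simp: osc_set_def)
      show "closure D \<subseteq> osc_set T h" using closure_minimal[OF D(2) cl] .
    qed
    have "?f \<omega> p \<le> (SUP p\<in>D. ?f \<omega> p)" if "p \<in> closure D" for p
    proof (rule continuous_le_on_closure[OF cf that])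
      fix p assume "p \<in> D" then show "?f \<omega> p \<le> (SUP p\<in>D. ?f \<omega> p)" by (intro cSUP_upper bddD)
    qed
    then show "osc (\<lambda>t. Y t \<omega>) T h \<le> (SUP p\<in>D. ?f \<omega> p)"
      unfolding osc_def using D(3) by (intro cSUP_least[OF ne]) auto
  qed
  have "(\<lambda>\<omega>. SUP p\<in>D. ?f \<omega> p) \<in> borel_measurable N"
  proof (rule borel_measurable_cSUP[OF D(1)])
    fix p assume "p \<in> D"
    then have "0 \<le> fst p" "0 \<le> snd p" using D by (auto simp: osc_set_def)
    then show "(\<lambda>\<omega>. ?f \<omega> p) \<in> borel_measurable N" using m by simp
  next
    fix \<omega> assume "\<omega> \<in> space N"
    then show "bdd_above (?f \<omega> ` D)"
      using D c by (intro bdd_aboveI2[where M=c]) (auto simp: osc_set_def)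
  qed
  then show ?thesis by (subst measurable_cong[OF eq])
qed

section \<open>The reflection term\<close>

text \<open>A Lipschitz substitute for the indicator of the times after \<open>s\<close>, climbing
  from 0 to 1 on \<open>[s, s + e]\<close>. Continuity makes it usable in a test process, and the
  Lipschitz bound makes the dyadic sums of \<open>rs_integral\<close> converge.\<close>

definition ramp :: "real \<Rightarrow> real \<Rightarrow> real \<Rightarrow> real" where
  "ramp s e u = max 0 (min 1 ((u - s) / e))"

lemma ramp_bounds: "0 \<le> ramp s e u" "ramp s e u \<le> 1"
  by (auto simp: ramp_def)

lemma ramp_before: "0 < e \<Longrightarrow> u \<le> s \<Longrightarrow> ramp s e u = 0"
  using divide_nonpos_pos[of "u - s" e] by (simp add: ramp_def)

lemma ramp_after: "0 < e \<Longrightarrow> s + e \<le> u \<Longrightarrow> ramp s e u = 1"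
  by (simp add: ramp_def max_def min_def field_simps)

lemma ramp_mono: "0 < e \<Longrightarrow> u \<le> v \<Longrightarrow> ramp s e u \<le> ramp s e v"
  unfolding ramp_def by (intro max.mono min.mono divide_right_mono) auto

lemma ramp_lipschitz: "0 < e \<Longrightarrow> u \<le> v \<Longrightarrow> \<bar>ramp s e v - ramp s e u\<bar> \<le> (v - u) / e"
proof -
  assume e: "0 < e" "u \<le> v"
  have "(v - s) / e - (u - s) / e = (v - u) / e" by (simp add: diff_divide_distrib)
  moreover have "(u - s) / e \<le> (v - s) / e" using e by (intro divide_right_mono) auto
  ultimately show ?thesis unfolding ramp_def by (auto simp: max_def min_def)
qed

lemma continuous_ramp: "0 < e \<Longrightarrow> continuous_on A (ramp s e)"
  unfolding ramp_def by (intro continuous_intros) auto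

text \<open>The free constant \<open>c\<close> will be the value of \<open>f\<close> at the foot of
  the ramp, so that the remaining sum is small where the ramp moves.\<close>

lemma sum_by_parts_shift:
  fixes f g :: "nat \<Rightarrow> real"
  shows "(\<Sum>k<n. g k * (f (Suc k) - f k)) = g n * (f n - c) - g 0 * (f 0 - c) - (\<Sum>k<n. (f (Suc k) - c) * (g (Suc k) - g k))"
  by (induction n) (auto simp: algebra_simps)

lemma sum_lessThan_double:
  fixes g :: "nat \<Rightarrow> real"
  shows "(\<Sum>k<2*m. g k) = (\<Sum>k<m. g (2*k) + g (Suc (2*k)))"
  by (induction m) auto

lemma dyadic_variation:
  assumes "bounded_variation_on f t" "0 \<le> t"
  obtains V where "\<And>n. (\<Sum>k<2^n. norm (f (t * real (Suc k) / 2^n) - f (t * real k / 2^n))) \<le> V"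
proof -
  obtain V where V: "\<And>xs. sorted xs \<Longrightarrow> set xs \<subseteq> {0..t} \<Longrightarrow>
        (\<Sum>i<length xs - 1. norm (f (xs ! Suc i) - f (xs ! i))) \<le> V"
    using assms(1) unfolding bounded_variation_on_def by blast
  have "(\<Sum>k<2^n. norm (f (t * real (Suc k) / 2^n) - f (t * real k / 2^n))) \<le> V" for n
  proof -
    let ?xs = "map (\<lambda>k. t * real k / 2^n) [0..<Suc (2^n)]"
    have "sorted ?xs" unfolding sorted_map
      by (rule sorted_wrt_mono_rel[of _ "(\<le>)"]) (use assms(2) in \<open>auto intro!: divide_right_mono mult_left_mono simp del: upt_Suc\<close>)
    moreover have "set ?xs \<subseteq> {0..t}"
    proof
      fix x assume "x \<in> set ?xs"
      then have "\<exists>k\<le>2^n. x = t * real k / 2^n" by (auto simp del: upt_Suc simp: less_Suc_eq_le)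
      then obtain k where k: "k \<le> 2^n" "x = t * real k / 2^n" by blast
      have "real k \<le> 2^n" using k(1) by (metis of_nat_le_iff of_nat_numeral of_nat_power)
      then have "real k / 2^n \<le> 1" by (simp add: field_simps)
      then have "t * (real k / 2^n) \<le> t * 1" using assms(2) by (rule mult_left_mono)
      then show "x \<in> {0..t}" using k assms(2) by auto
    qed
    moreover have "length ?xs - 1 = 2^n" by simp
    ultimately have "(\<Sum>i<2^n. norm (f (?xs ! Suc i) - f (?xs ! i))) \<le> V" using V[of ?xs] by simp
    also have "(\<Sum>i<2^n. norm (f (?xs ! Suc i) - f (?xs ! i))) = (\<Sum>k<2^n. norm (f (t * real (Suc k) / 2^n) - f (t * real k / 2^n)))"
      by (rule sum.cong) (auto simp del: upt_Suc)
    finally show ?thesis .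
  qed
  then show ?thesis using that by blast
qed

lemma convergent_if_geometric_steps:
  fixes S :: "nat \<Rightarrow> real"
  assumes "\<And>n. \<bar>S (Suc n) - S n\<bar> \<le> C / 2^n"
  shows "convergent S"
proof -
  have "summable (\<lambda>n. S (Suc n) - S n)"
  proof (rule summable_comparison_test)
    show "\<exists>N. \<forall>n\<ge>N. norm (S (Suc n) - S n) \<le> C * (1/2)^n"
      using assms by (auto simp: power_one_over field_simps)
    show "summable (\<lambda>n. C * (1/2)^n)" by (intro summable_mult summable_geometric) simp
  qed
  then have "convergent (\<lambda>n. \<Sum>i<n. S (Suc i) - S i)" by (simp add: summable_iff_convergent)
  then have "convergent (\<lambda>n. (\<Sum>i<n. S (Suc i) - S i) + S 0)" by (intro convergent_add convergent_const)
  then show ?thesis by (simp add: sum_lessThan_telescope)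
qed

text \<open>One dyadic refinement changes the sum by the increment of the ramp over half a step
  times the increment of \<open>f\<close> over the other half, summed over the steps; this is of
  order \<open>2^(-n)\<close> times the variation. Convergence must be proved because
  \<open>rs_integral\<close> is a bare \<open>lim\<close>, whose value is unspecified for divergent
  sums.\<close>

lemma ramp_sums_convergent:
  fixes f :: "real \<Rightarrow> real"
  assumes "0 < e" "0 \<le> t"
    and V: "\<And>n. (\<Sum>k<2^n. \<bar>f (t * real (Suc k) / 2^n) - f (t * real k / 2^n)\<bar>) \<le> V"
  shows "convergent (\<lambda>n. \<Sum>k<2^n. ramp s e (t * real k / 2^n) * (f (t * real (Suc k) / 2^n) - f (t * real k / 2^n)))"
    (is "convergent ?S")
proof (rule convergent_if_geometric_steps)
  fix n
  let ?u = "\<lambda>k. t * real k / 2 ^ Suc n"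
  have u: "t * real k / 2^n = ?u (2 * k)" "t * real (Suc k) / 2^n = ?u (Suc (Suc (2*k)))" for k
    by (auto simp: field_simps)
  have d1: "?S (Suc n) - ?S n = (\<Sum>k<2^n. (ramp s e (?u (Suc (2*k))) - ramp s e (?u (2*k))) * (f (?u (Suc (Suc (2*k)))) - f (?u (Suc (2*k)))))"
    unfolding u power_Suc sum_lessThan_double
    by (simp add: sum_subtractf[symmetric] algebra_simps)
  have d2: "\<bar>?S (Suc n) - ?S n\<bar> \<le> (\<Sum>k<2^n. (t / e / 2^n) * \<bar>f (?u (Suc (Suc (2*k)))) - f (?u (Suc (2*k)))\<bar>)"
    unfolding d1
  proof (rule order_trans[OF sum_abs], rule sum_mono)
    fix k
    have "\<bar>ramp s e (?u (Suc (2*k))) - ramp s e (?u (2*k))\<bar> \<le> (?u (Suc (2*k)) - ?u (2*k)) / e"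
      using assms by (intro ramp_lipschitz) (auto simp: field_simps)
    also have "\<dots> \<le> t / e / 2^n" using assms by (simp add: field_simps)
    finally show "\<bar>(ramp s e (?u (Suc (2*k))) - ramp s e (?u (2*k))) * (f (?u (Suc (Suc (2*k)))) - f (?u (Suc (2*k))))\<bar>
      \<le> (t / e / 2^n) * \<bar>f (?u (Suc (Suc (2*k)))) - f (?u (Suc (2*k)))\<bar>"
      unfolding abs_mult by (intro mult_right_mono) auto
  qed
  have d3: "(\<Sum>k<2^n. (t / e / 2^n) * \<bar>f (?u (Suc (Suc (2*k)))) - f (?u (Suc (2*k)))\<bar>) \<le> (t / e / 2^n) * V"
  proof -
    have "(\<Sum>k<2^n. \<bar>f (?u (Suc (Suc (2*k)))) - f (?u (Suc (2*k)))\<bar>)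
       \<le> (\<Sum>k<2*2^n. \<bar>f (?u (Suc k)) - f (?u k)\<bar>)"
      unfolding sum_lessThan_double by (intro sum_mono) simp
    also have "\<dots> \<le> V" using V[of "Suc n"] by simp
    finally show ?thesis unfolding sum_distrib_left[symmetric] using assms by (intro mult_left_mono) auto
  qed
  from order_trans[OF d2 d3] show "\<bar>?S (Suc n) - ?S n\<bar> \<le> (t / e * V) / 2^n" by simp
qed

text \<open>Summation by parts moves the increments onto the ramp. These are nonnegative, add up to
  1, and sit in a small window at \<open>s\<close> where \<open>f\<close> is close to
  \<open>f s\<close>; hence the ramp integral is at most \<open>f t - f s\<close> plus any
  prescribed \<open>w\<close>.\<close>

lemma increment_nonneg_if_ramp_integrals_nonneg:
  fixes f :: "real \<Rightarrow> real"
  assumes "0 \<le> s" "s < t" and cont: "continuous_on {0..t} f"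
    and V: "\<And>n. (\<Sum>k<2^n. \<bar>f (t * real (Suc k) / 2^n) - f (t * real k / 2^n)\<bar>) \<le> V"
    and nonneg: "\<And>j. 0 \<le> lim (\<lambda>n. \<Sum>k<2^n. ramp s (1 / Suc j) (t * real k / 2^n) * (f (t * real (Suc k) / 2^n) - f (t * real k / 2^n)))"
  shows "f s \<le> f t"
proof (rule field_le_epsilon)
  fix w :: real assume w: "0 < w"
  obtain d where d: "d > 0" "\<And>u. u \<in> {0..t} \<Longrightarrow> \<bar>u - s\<bar> < d \<Longrightarrow> \<bar>f u - f s\<bar> < w"
    using cont w assms(1,2) unfolding continuous_on_iff dist_real_def by (metis atLeastAtMost_iff less_imp_le)
  \<comment> \<open>\<open>e < d / 2\<close>, together with a mesh below \<open>d / 2\<close>, keeps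
    every step on which the ramp moves within \<open>d\<close> of \<open>s\<close>;
    \<open>s + e < t\<close> makes the ramp reach 1 before \<open>t\<close>.\<close>
  obtain j where j: "1 / Suc j < min (d / 2) (t - s)"
    using reals_Archimedean[of "min (d / 2) (t - s)"] d assms(2) by (auto simp: inverse_eq_divide)
  define e where "e = 1 / real (Suc j)"
  have e: "0 < e" "e < d / 2" "s + e < t" using j by (auto simp: e_def)
  let ?S = "\<lambda>n. \<Sum>k<2^n. ramp s e (t * real k / 2^n) * (f (t * real (Suc k) / 2^n) - f (t * real k / 2^n))"
  have conv: "?S \<longlonglongrightarrow> lim ?S"
    using ramp_sums_convergent[OF e(1) _ V] assms by (intro convergent_LIMSEQ_iff[THEN iffD1]) auto
  have "(\<lambda>n. t / 2^n) \<longlonglongrightarrow> 0" by (rule LIMSEQ_divide_realpow_zero) simp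
  then have ev: "\<forall>\<^sub>F n in sequentially. t / 2^n < d / 2"
    using d(1) by (intro order_tendstoD(2)) auto
  have "\<forall>\<^sub>F n in sequentially. ?S n \<le> f t - f s + w"
    using ev
  proof eventually_elim
    case (elim n)
    let ?u = "\<lambda>k. t * real k / 2^n"
    let ?g = "\<lambda>k. ramp s e (?u k)"
    have uT: "?u (2^n) = t" by simp
    have e1: "?S n = ?g (2^n) * (f (?u (2^n)) - f s) - ?g 0 * (f (?u 0) - f s) - (\<Sum>k<2^n. (f (?u (Suc k)) - f s) * (?g (Suc k) - ?g k))"
      by (rule sum_by_parts_shift[where f="\<lambda>k. f (?u k)" and g="?g"])
    have e2: "?g (2^n) = 1" "?g 0 = 0" using e assms by (simp_all add: uT ramp_before ramp_after)
    have e3: "- (\<Sum>k<2^n. (f (?u (Suc k)) - f s) * (?g (Suc k) - ?g k)) \<le> (\<Sum>k<2^n. w * (?g (Suc k) - ?g k))"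
      unfolding sum_negf[symmetric]
    proof (rule sum_mono)
      fix k assume k: "k \<in> {..<(2::nat)^n}"
      have k1: "?u k \<le> ?u (Suc k)" using assms by (intro divide_right_mono mult_left_mono) auto
      have k2: "?u (Suc k) = ?u k + t / 2^n" by (simp add: field_simps)
      have kn: "real (Suc k) \<le> 2^n" using k by (metis Suc_leI lessThan_iff of_nat_le_iff of_nat_numeral of_nat_power)
      have k3: "?u (Suc k) \<in> {0..t}"
      proof -
        have "t * real (Suc k) \<le> t * 2^n" using kn assms by (intro mult_left_mono) auto
        then show ?thesis using assms by (auto simp: field_simps)
      qed
      have g0: "?g k \<le> ?g (Suc k)" by (rule ramp_mono[OF e(1) k1])
      show "- ((f (?u (Suc k)) - f s) * (?g (Suc k) - ?g k)) \<le> w * (?g (Suc k) - ?g k)"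
      proof (cases "?u (Suc k) \<le> s \<or> s + e \<le> ?u k")
        case True
        then have "?g (Suc k) = ?g k"
          using k1 e(1) by (auto simp: ramp_before ramp_after)
        then show ?thesis by simp
      next
        case False
        then have "\<bar>?u (Suc k) - s\<bar> < d" using elim e k2 by auto
        then have "\<bar>f (?u (Suc k)) - f s\<bar> < w" using d(2) k3 by blast
        then show ?thesis using g0 unfolding mult_minus_left[symmetric] by (intro mult_right_mono) auto
      qed
    qed
    have e4: "(\<Sum>k<2^n. w * (?g (Suc k) - ?g k)) = w * (?g (2^n) - ?g 0)"
      unfolding sum_distrib_left[symmetric] by (subst sum_lessThan_telescope) simp
    have e5: "?g (2^n) * (f (?u (2^n)) - f s) - ?g 0 * (f (?u 0) - f s) = f t - f s" using e2 by simp
    have e6: "w * (?g (2^n) - ?g 0) = w" unfolding e2 by simp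
    show ?case using e1 e3 e4 e5 e6 by linarith
  qed
  then have "lim ?S \<le> f t - f s + w" by (intro tendsto_upperbound[OF conv]) auto
  moreover have "0 \<le> lim ?S" using nonneg[of j] by (simp add: e_def)
  ultimately show "f s \<le> f t + w" by simp
qed

text \<open>\<open>X\<close> and \<open>\<eta>\<close> are families indexed by the starting point
  and driven by the same \<open>B\<close>, so any two members are synchronously coupled from the
  outset.\<close>

locale reflected_sde = bm_space M F B
  for M :: "'a measure" and F :: "real \<Rightarrow> 'a measure" and B :: "real \<Rightarrow> 'a \<Rightarrow> real^'d" +
  fixes b :: "real^'d \<Rightarrow> real^'d" and \<sigma> :: "real^'d \<Rightarrow> real^'d^'d"
    and U :: "(real^'d) set" and \<delta> :: real
    and X \<eta> :: "real^'d \<Rightarrow> real \<Rightarrow> 'a \<Rightarrow> real^'d"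
  assumes dom: "open U" "U \<noteq> {}" "bounded U" "convex U"
    and b_cont: "continuous_on UNIV b" and \<sigma>_cont: "continuous_on UNIV \<sigma>"
    and delta_pos: "0 < \<delta>"
    and dissipative: "(norm (\<sigma> x - \<sigma> y))\<^sup>2 + 2 * ((x - y) \<bullet> (b x - b y)) \<le> - 2 * \<delta> * (norm (x - y))\<^sup>2"
    and sol: "x \<in> closure U \<Longrightarrow> strong_solution M F B b \<sigma> U x (X x) (\<eta> x)"
begin

abbreviation "K \<equiv> closure U"

lemma K_convex: "convex K" and K_compact: "compact K" and K_closed: "closed K" and K_nonempty: "K \<noteq> {}"
  using dom by (auto simp: convex_closure compact_closure)

context
  fixes x assumes x: "x \<in> K"
begin

lemma X_measurable: "0 \<le> s \<Longrightarrow> s \<le> t \<Longrightarrow> X x s \<in> borel_measurable (F t)"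
  using sol[OF x] measurable_F_mono[of "X x s" s borel t] by (auto simp: strong_solution_def adapted_def)

lemma \<eta>_measurable: "0 \<le> s \<Longrightarrow> s \<le> t \<Longrightarrow> \<eta> x s \<in> borel_measurable (F t)"
  using sol[OF x] measurable_F_mono[of "\<eta> x s" s borel t] by (auto simp: strong_solution_def adapted_def)

lemma X_in_K: "\<omega> \<in> space M \<Longrightarrow> 0 \<le> t \<Longrightarrow> X x t \<omega> \<in> K"
  using sol[OF x] by (auto simp: strong_solution_def)

lemma X_continuous: "\<omega> \<in> space M \<Longrightarrow> continuous_on {0..} (\<lambda>t. X x t \<omega>)"
  using sol[OF x] by (auto simp: strong_solution_def continuous_paths_def)

lemma \<eta>_continuous: "\<omega> \<in> space M \<Longrightarrow> continuous_on {0..} (\<lambda>t. \<eta> x t \<omega>)"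
  using sol[OF x] by (auto simp: strong_solution_def continuous_paths_def)

lemma \<eta>_bounded_variation: "\<omega> \<in> space M \<Longrightarrow> 0 \<le> t \<Longrightarrow> bounded_variation_on (\<lambda>s. \<eta> x s \<omega>) t"
  using sol[OF x] by (auto simp: strong_solution_def)

lemma \<eta>_0: "\<omega> \<in> space M \<Longrightarrow> \<eta> x 0 \<omega> = 0"
  using sol[OF x] by (auto simp: strong_solution_def)

lemma reflection_rs_integral:
  assumes "adapted F Y" "continuous_paths M Y" "\<And>\<omega> t. \<omega> \<in> space M \<Longrightarrow> 0 \<le> t \<Longrightarrow> Y t \<omega> \<in> K"
  shows "AE \<omega> in M. \<forall>t\<ge>0. rs_integral (\<lambda>s. X x s \<omega> - Y s \<omega>) (\<lambda>s. \<eta> x s \<omega>) t \<ge> 0"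
proof -
  have "\<forall>Y. adapted F Y \<and> continuous_paths M Y \<and> (\<forall>\<omega>\<in>space M. \<forall>t\<ge>0. Y t \<omega> \<in> closure U) \<longrightarrow>
        (AE \<omega> in M. \<forall>t\<ge>0. rs_integral (\<lambda>s. X x s \<omega> - Y s \<omega>) (\<lambda>s. \<eta> x s \<omega>) t \<ge> 0)"
    using sol[OF x] unfolding strong_solution_def by (elim conjE)
  then show ?thesis using assms by blast
qed

text \<open>The projection makes the shifted path admissible for every \<omega> and every
  \<open>c\<close>. On a path whose shift stays in \<open>K\<close> it is inactive, and the
  integrand reduces to \<open>ramp s e u *\<^sub>R c\<close>.\<close>

lemma ramp_test_process:
  fixes c :: "real^'d" and s e :: real
  assumes "0 < e"
  defines "Y \<equiv> \<lambda>u \<omega>. closest_point K (X x u \<omega> - ramp s e u *\<^sub>R c)"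
  shows "AE \<omega> in M. \<forall>t\<ge>0. rs_integral (\<lambda>u. X x u \<omega> - Y u \<omega>) (\<lambda>u. \<eta> x u \<omega>) t \<ge> 0"
proof (rule reflection_rs_integral)
  have cp: "continuous_on UNIV (closest_point K)"
    by (rule continuous_on_closest_point) (use K_convex K_closed K_nonempty in auto)
  have cpm: "closest_point K \<in> borel_measurable borel" using cp by (rule borel_measurable_continuous_onI)
  show "adapted F Y" unfolding adapted_def Y_def
  proof (intro allI impI)
    fix t :: real assume "0 \<le> t"
    then have [measurable]: "X x t \<in> borel_measurable (F t)" by (intro X_measurable) auto
    show "(\<lambda>\<omega>. closest_point K (X x t \<omega> - ramp s e t *\<^sub>R c)) \<in> borel_measurable (F t)"
      by (rule measurable_compose[OF _ cpm]) measurable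
  qed
  show "continuous_paths M Y" unfolding continuous_paths_def Y_def
    by (intro ballI continuous_on_compose2[OF cp] continuous_intros X_continuous continuous_ramp assms) auto
  show "Y t \<omega> \<in> K" for t \<omega> unfolding Y_def by (rule closest_point_in_set[OF K_closed K_nonempty])
qed

text \<open>The test process is the solution itself up to time \<open>s\<close> and is then pushed by \<open>- c\<close>.\<close>

lemma reflection_increment:
  assumes s: "0 \<le> s"
  shows "AE \<omega> in M. \<forall>t>s. \<forall>c. \<forall>r>0. (\<forall>u\<in>{s..t}. ball (X x u \<omega> - c) r \<subseteq> K) \<longrightarrow> 0 \<le> c \<bullet> (\<eta> x t \<omega> - \<eta> x s \<omega>)"
proof -
  \<comment> \<open>The exceptional null set depends on the test process, so \<open>c\<close> and
    the ramp width first range over countable sets. General \<open>c\<close> are then recovered on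
    each path by density, so that \<open>c\<close> may depend on \<omega> in any way, even on the
    future; \<open>good_reflection\<close> relies on this.\<close>
  obtain D :: "(real^'d) set" where D: "countable D" "\<And>S. open S \<Longrightarrow> S \<noteq> {} \<Longrightarrow> \<exists>d\<in>D. d \<in> S"
    using countable_dense_setE by metis
  have "AE \<omega> in M. \<forall>c\<in>D. \<forall>j. \<forall>t\<ge>0. rs_integral (\<lambda>u. X x u \<omega> - closest_point K (X x u \<omega> - ramp s (1 / Suc j) u *\<^sub>R c)) (\<lambda>u. \<eta> x u \<omega>) t \<ge> 0"
    unfolding AE_ball_countable[OF D(1)] AE_all_countable by (intro ballI allI ramp_test_process) simp
  then show ?thesis
  proof (rule AE_mp, intro AE_I2 impI allI)
    fix \<omega> t c and r :: real
    assume w: "\<omega> \<in> space M" and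
      rs: "\<forall>c\<in>D. \<forall>j. \<forall>t\<ge>0. rs_integral (\<lambda>u. X x u \<omega> - closest_point K (X x u \<omega> - ramp s (1 / Suc j) u *\<^sub>R c)) (\<lambda>u. \<eta> x u \<omega>) t \<ge> 0"
      and t: "s < t" and r: "0 < r" and b: "\<forall>u\<in>{s..t}. ball (X x u \<omega> - c) r \<subseteq> K"
    \<comment> \<open>The slack \<open>r\<close> lets the inclusion in \<open>K\<close> survive the
      replacement of \<open>c\<close> by a nearby \<open>c'\<close> from the dense set.\<close>
    have *: "0 \<le> c' \<bullet> (\<eta> x t \<omega> - \<eta> x s \<omega>)" if c': "c' \<in> D" "dist c' c < r" for c'
    proof -
      have inK: "X x u \<omega> - ramp s e u *\<^sub>R c' \<in> K" if u: "u \<in> {0..t}" and e: "0 < e" for u e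
      proof (cases "u \<le> s")
        case True then show ?thesis using X_in_K[OF w] u e by (simp add: ramp_before)
      next
        case False
        then have "X x u \<omega> - c' \<in> ball (X x u \<omega> - c) r" using c' by (simp add: dist_norm norm_minus_commute)
        moreover have "ball (X x u \<omega> - c) r \<subseteq> K" using b u False by auto
        ultimately have 1: "X x u \<omega> - c' \<in> K" by blast
        have 2: "X x u \<omega> \<in> K" using X_in_K[OF w] u by auto
        have "(1 - ramp s e u) *\<^sub>R X x u \<omega> + ramp s e u *\<^sub>R (X x u \<omega> - c') \<in> K"
          using ramp_bounds[of s e u] by (intro convexD[OF K_convex 2 1]) auto
        then show ?thesis by (simp add: algebra_simps)
      qed
      obtain V where V: "\<And>n. (\<Sum>k<2^n. norm (\<eta> x (t * real (Suc k) / 2^n) \<omega> - \<eta> x (t * real k / 2^n) \<omega>)) \<le> V"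
        using dyadic_variation[OF \<eta>_bounded_variation[OF w, of t]] s t by auto
      have "c' \<bullet> \<eta> x s \<omega> \<le> c' \<bullet> \<eta> x t \<omega>"
      proof (rule increment_nonneg_if_ramp_integrals_nonneg[OF s t])
        show "continuous_on {0..t} (\<lambda>u. c' \<bullet> \<eta> x u \<omega>)"
          by (intro continuous_intros continuous_on_subset[OF \<eta>_continuous[OF w]]) auto
        show "(\<Sum>k<2^n. \<bar>c' \<bullet> \<eta> x (t * real (Suc k) / 2^n) \<omega> - c' \<bullet> \<eta> x (t * real k / 2^n) \<omega>\<bar>) \<le> norm c' * V" for n
        proof -
          have "(\<Sum>k<2^n. \<bar>c' \<bullet> \<eta> x (t * real (Suc k) / 2^n) \<omega> - c' \<bullet> \<eta> x (t * real k / 2^n) \<omega>\<bar>)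
            \<le> (\<Sum>k<2^n. norm c' * norm (\<eta> x (t * real (Suc k) / 2^n) \<omega> - \<eta> x (t * real k / 2^n) \<omega>))"
            unfolding inner_diff_right[symmetric] by (intro sum_mono Cauchy_Schwarz_ineq2)
          also have "\<dots> \<le> norm c' * V" unfolding sum_distrib_left[symmetric] by (intro mult_left_mono V) simp
          finally show ?thesis .
        qed
        fix j :: nat
        have "0 \<le> rs_integral (\<lambda>u. X x u \<omega> - closest_point K (X x u \<omega> - ramp s (1 / Suc j) u *\<^sub>R c')) (\<lambda>u. \<eta> x u \<omega>) t"
          using rs c' s t by auto
        also have "\<dots> = lim (\<lambda>n. \<Sum>k<2^n. ramp s (1 / Suc j) (t * real k / 2^n) *
                     (c' \<bullet> \<eta> x (t * real (Suc k) / 2^n) \<omega> - c' \<bullet> \<eta> x (t * real k / 2^n) \<omega>))"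
          unfolding rs_integral_def
        proof (intro arg_cong[where f=lim] ext sum.cong refl)
          fix n k assume k: "k \<in> {..<(2::nat)^n}"
          have "real k \<le> 2^n" using k by (metis lessThan_iff less_imp_le of_nat_le_iff of_nat_numeral of_nat_power)
          then have "t * real k \<le> t * 2^n" using s t by (intro mult_left_mono) auto
          then have "t * real k / 2^n \<in> {0..t}" using s t by (auto simp: field_simps)
          from closest_point_self[OF inK[OF this, of "1 / real (Suc j)"]]
          show "(X x (t * real k / 2^n) \<omega> - closest_point K (X x (t * real k / 2^n) \<omega> - ramp s (1 / Suc j) (t * real k / 2^n) *\<^sub>R c'))
              \<bullet> (\<eta> x (t * real (Suc k) / 2^n) \<omega> - \<eta> x (t * real k / 2^n) \<omega>)
            = ramp s (1 / Suc j) (t * real k / 2^n) *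
                     (c' \<bullet> \<eta> x (t * real (Suc k) / 2^n) \<omega> - c' \<bullet> \<eta> x (t * real k / 2^n) \<omega>)"
            by (simp add: inner_diff_right right_diff_distrib)
        qed
        finally show "0 \<le> lim (\<lambda>n. \<Sum>k<2^n. ramp s (1 / Suc j) (t * real k / 2^n) *
                     (c' \<bullet> \<eta> x (t * real (Suc k) / 2^n) \<omega> - c' \<bullet> \<eta> x (t * real k / 2^n) \<omega>))" .
      qed
      then show ?thesis by (simp add: inner_diff_right)
    qed
    let ?\<Delta> = "\<eta> x t \<omega> - \<eta> x s \<omega>"
    show "0 \<le> c \<bullet> ?\<Delta>"
    proof (rule field_le_epsilon)
      fix e :: real assume e: "0 < e"
      define e' where "e' = min r (e / (norm ?\<Delta> + 1))"
      have "0 < e'" using r e by (auto simp: e'_def add_nonneg_pos)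
      then obtain c' where c': "c' \<in> D" "c' \<in> ball c e'" using D(2)[of "ball c e'"] by auto
      then have d: "dist c' c < e'" by (simp add: dist_commute)
      then have "0 \<le> c' \<bullet> ?\<Delta>" using * c' by (auto simp: e'_def)
      also have "\<dots> = c \<bullet> ?\<Delta> + (c' - c) \<bullet> ?\<Delta>" by (simp add: inner_diff_left)
      also have "(c' - c) \<bullet> ?\<Delta> \<le> norm (c' - c) * norm ?\<Delta>" by (rule norm_cauchy_schwarz)
      also have "\<dots> \<le> (e / (norm ?\<Delta> + 1)) * (norm ?\<Delta> + 1)"
        using d e by (intro mult_mono) (auto simp: e'_def dist_norm)
      also have "\<dots> = e" by (simp add: add_nonneg_eq_0_iff)
      finally show "0 \<le> c \<bullet> ?\<Delta> + e" by simp
    qed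
  qed
qed

end

end

section \<open>Left-point sums along grids\<close>

context reflected_sde
begin

text \<open>Bundling a point with its coefficients lets one modulus of continuity control the path,
  the drift and the diffusion matrix together.\<close>

definition \<phi> :: "real^'d \<Rightarrow> (real^'d) \<times> (real^'d) \<times> (real^'d^'d)" where
  "\<phi> z = (z, b z, \<sigma> z)"

lemma \<phi>_continuous: "continuous_on UNIV \<phi>"
  unfolding \<phi>_def[abs_def] by (intro continuous_intros b_cont \<sigma>_cont)

lemma dist_\<phi>: "dist z z' \<le> dist (\<phi> z) (\<phi> z')" "dist (b z) (b z') \<le> dist (\<phi> z) (\<phi> z')" "dist (\<sigma> z) (\<sigma> z') \<le> dist (\<phi> z) (\<phi> z')"
  using dist_fst_le[of "\<phi> z" "\<phi> z'"] dist_snd_le[of "\<phi> z" "\<phi> z'"]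
    dist_fst_le[of "snd (\<phi> z)" "snd (\<phi> z')"] dist_snd_le[of "snd (\<phi> z)" "snd (\<phi> z')"]
  by (auto simp: \<phi>_def)

lemma b_measurable [measurable]: "b \<in> borel_measurable borel"
  and \<sigma>_measurable [measurable]: "\<sigma> \<in> borel_measurable borel"
  and \<phi>_measurable [measurable]: "\<phi> \<in> borel_measurable borel"
  using b_cont \<sigma>_cont \<phi>_continuous by (auto intro: borel_measurable_continuous_onI)

lemma ex_CK: "\<exists>C>0. \<forall>z\<in>K. norm z \<le> C \<and> norm (b z) \<le> C \<and> norm (\<sigma> z) \<le> C \<and> (\<forall>z'\<in>K. dist (\<phi> z) (\<phi> z') \<le> C)"
proof -
  have "compact (\<phi> ` K)" by (rule compact_continuous_image[OF continuous_on_subset[OF \<phi>_continuous] K_compact]) auto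
  then have "bounded (\<phi> ` K)" by (rule compact_imp_bounded)
  then obtain a where a: "\<And>z. z \<in> K \<Longrightarrow> norm (\<phi> z) \<le> a" unfolding bounded_iff by blast
  let ?C = "max 1 (2 * a)"
  show ?thesis
  proof (intro exI[of _ ?C] conjI ballI)
    fix z assume z: "z \<in> K"
    have "norm z \<le> norm (\<phi> z)" "norm (b z) \<le> norm (\<phi> z)" "norm (\<sigma> z) \<le> norm (\<phi> z)"
      using norm_fst_le[of z "snd (\<phi> z)"] norm_snd_le[of "snd (\<phi> z)" z]
        norm_fst_le[of "b z" "\<sigma> z"] norm_snd_le[of "\<sigma> z" "b z"] by (auto simp: \<phi>_def)
    moreover have "0 \<le> norm (\<phi> z)" by simp
    ultimately show "norm z \<le> ?C" "norm (b z) \<le> ?C" "norm (\<sigma> z) \<le> ?C" using a[OF z] by linarith+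
    fix z' assume "z' \<in> K"
    then show "dist (\<phi> z) (\<phi> z') \<le> ?C" using norm_triangle_ineq4[of "\<phi> z" "\<phi> z'"] a[OF z] a[of z'] by (simp add: dist_norm)
  qed simp
qed

text \<open>One constant for all bounds on the compact set \<open>K\<close>, including the
  oscillation of \<open>\<phi>\<close>.\<close>

definition CK :: real where
  "CK = (SOME C. C > 0 \<and> (\<forall>z\<in>K. norm z \<le> C \<and> norm (b z) \<le> C \<and> norm (\<sigma> z) \<le> C \<and> (\<forall>z'\<in>K. dist (\<phi> z) (\<phi> z') \<le> C)))"

lemma CK_pos: "0 < CK"
  and CK: "z \<in> K \<Longrightarrow> norm z \<le> CK" "z \<in> K \<Longrightarrow> norm (b z) \<le> CK" "z \<in> K \<Longrightarrow> norm (\<sigma> z) \<le> CK"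
    "z \<in> K \<Longrightarrow> z' \<in> K \<Longrightarrow> dist (\<phi> z) (\<phi> z') \<le> CK"
  using someI_ex[OF ex_CK] unfolding CK_def[symmetric] by auto

definition modulus :: "real^'d \<Rightarrow> real \<Rightarrow> real \<Rightarrow> 'a \<Rightarrow> real" where
  "modulus x T h \<omega> = osc (\<lambda>t. \<phi> (X x t \<omega>)) T h"

definition ito_sum :: "real^'d \<Rightarrow> real \<Rightarrow> nat \<Rightarrow> 'a \<Rightarrow> real^'d" where
  "ito_sum x h n = dsum h (\<lambda>k \<omega>. \<sigma> (X x (h * real k) \<omega>)) n"

text \<open>The discrepancy between the solution and the path obtained by freezing the coefficients at grid points.\<close>

definition residual :: "real^'d \<Rightarrow> real \<Rightarrow> nat \<Rightarrow> 'a \<Rightarrow> real^'d" where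
  "residual x h k \<omega> = X x (h * real k) \<omega> + \<eta> x (h * real k) \<omega> - x - (\<Sum>j<k. h *\<^sub>R b (X x (h * real j) \<omega>)) - ito_sum x h k \<omega>"

text \<open>A version of the Ito integral up to time \<open>t\<close>, read off from the equation.\<close>

definition ito_part :: "real^'d \<Rightarrow> real \<Rightarrow> 'a \<Rightarrow> real^'d" where
  "ito_part x t \<omega> = X x t \<omega> - x - integral {0..t} (\<lambda>s. b (X x s \<omega>)) + \<eta> x t \<omega>"

context
  fixes x assumes x: "x \<in> K"
begin

lemma X_measurable_M [measurable]: "0 \<le> t \<Longrightarrow> X x t \<in> borel_measurable M"
  using measurable_F_M[OF X_measurable[OF x]] by blast

lemma \<eta>_measurable_M [measurable]: "0 \<le> t \<Longrightarrow> \<eta> x t \<in> borel_measurable M"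
  using measurable_F_M[OF \<eta>_measurable[OF x]] by blast

lemma modulus_measurable [measurable]: "0 \<le> T \<Longrightarrow> 0 \<le> h \<Longrightarrow> modulus x T h \<in> borel_measurable M"
  unfolding modulus_def[abs_def]
proof (rule osc_measurable)
  show "(\<lambda>\<omega>. \<phi> (X x t \<omega>)) \<in> borel_measurable M" if "0 \<le> t" for t
    using that by measurable
  show "continuous_on {0..} (\<lambda>t. \<phi> (X x t \<omega>))" if "\<omega> \<in> space M" for \<omega>
    by (rule continuous_on_compose2[OF \<phi>_continuous X_continuous[OF x that]]) auto
qed (auto intro!: CK X_in_K[OF x])

lemma modulus_upper:
  assumes "\<omega> \<in> space M" "u \<in> {0..T}" "v \<in> {0..T}" "\<bar>u - v\<bar> \<le> h"
  shows "dist (\<phi> (X x u \<omega>)) (\<phi> (X x v \<omega>)) \<le> modulus x T h \<omega>"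
  unfolding modulus_def
  by (rule osc_upper[where c=CK and y="\<lambda>t. \<phi> (X x t \<omega>)", OF _ assms(2-4)]) (use assms(1) in \<open>auto intro!: CK X_in_K[OF x]\<close>)

lemma modulus_bounds:
  assumes "\<omega> \<in> space M" "0 \<le> T" "0 \<le> h"
  shows "0 \<le> modulus x T h \<omega>" "modulus x T h \<omega> \<le> CK"
  using modulus_upper[OF assms(1), of 0 T 0 h] assms osc_least[of T h "\<lambda>t. \<phi> (X x t \<omega>)" CK]
  by (auto simp: modulus_def intro!: CK X_in_K[OF x])

lemma modulus_tendsto_0:
  assumes "\<omega> \<in> space M" "0 \<le> T" "h \<longlonglongrightarrow> 0" "\<And>n. 0 \<le> h n"
  shows "(\<lambda>n. modulus x T (h n) \<omega>) \<longlonglongrightarrow> 0"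
  unfolding modulus_def
  by (intro osc_tendsto_0 continuous_on_compose2[OF \<phi>_continuous continuous_on_subset[OF X_continuous[OF x assms(1)]]]) (use assms in auto)

lemma modulus_sq_integrable: "0 \<le> T \<Longrightarrow> 0 \<le> h \<Longrightarrow> integrable M (\<lambda>\<omega>. (modulus x T h \<omega>)\<^sup>2)"
  by (rule integrable_const_bound[where B="CK\<^sup>2"]) (auto intro!: AE_I2 power_mono modulus_bounds)

lemma modulus_sq_integral_tendsto_0:
  assumes "0 \<le> T" "h \<longlonglongrightarrow> 0" "\<And>n. 0 \<le> h n"
  shows "(\<lambda>n. \<integral>\<omega>. (modulus x T (h n) \<omega>)\<^sup>2 \<partial>M) \<longlonglongrightarrow> 0"
proof -
  have "(\<lambda>n. \<integral>\<omega>. (modulus x T (h n) \<omega>)\<^sup>2 \<partial>M) \<longlonglongrightarrow> (\<integral>\<omega>. 0 \<partial>M)"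
  proof (rule integral_dominated_convergence[where w="\<lambda>_. CK\<^sup>2"])
    show "AE \<omega> in M. (\<lambda>n. (modulus x T (h n) \<omega>)\<^sup>2) \<longlonglongrightarrow> 0"
      using tendsto_power[OF modulus_tendsto_0[OF _ assms], of _ 2] by (intro AE_I2) auto
    show "AE \<omega> in M. norm ((modulus x T (h n) \<omega>)\<^sup>2) \<le> CK\<^sup>2" for n
      using assms by (auto intro!: AE_I2 power_mono modulus_bounds)
  qed (use assms in \<open>auto intro!: borel_measurable_power modulus_measurable\<close>)
  then show ?thesis by simp
qed

lemma \<sigma>X_measurable: "0 \<le> h \<Longrightarrow> (\<lambda>\<omega>. \<sigma> (X x (h * real k) \<omega>)) \<in> borel_measurable (F (h * real k))"
  by (rule measurable_compose[OF X_measurable[OF x] \<sigma>_measurable]) auto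

lemma ito_sum_measurable: "0 \<le> h \<Longrightarrow> ito_sum x h n \<in> borel_measurable (F (h * real n))"
  unfolding ito_sum_def by (intro dsum_measurable \<sigma>X_measurable)

lemma ito_sum_measurable_M [measurable]: "0 \<le> h \<Longrightarrow> ito_sum x h n \<in> borel_measurable M"
  by (rule measurable_F_M[OF ito_sum_measurable])

text \<open>By \<open>dsum_coarsen\<close> the difference is a discrete integral of the change of
  \<sigma> within one coarse step, to which the maximal inequality applies. The bound involves the
  coarse mesh \<open>h * real c\<close> alone, so the fine mesh may afterwards tend to 0 with the
  coarse one fixed.\<close>

lemma ito_sum_refine:
  assumes h: "0 < h" and c: "0 < c" and T: "h * real (n * c) \<le> T" and e: "0 < e"
  shows "prob {\<omega>\<in>space M. \<exists>k\<le>n. e < norm (ito_sum x (h * real c) k \<omega> - ito_sum x h (k * c) \<omega>)}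
      \<le> T * (\<integral>\<omega>. (modulus x T (h * real c) \<omega>)\<^sup>2 \<partial>M) / e\<^sup>2"
proof -
  define G where "G j \<omega> = \<sigma> (X x (h * real ((j div c) * c)) \<omega>) - \<sigma> (X x (h * real j) \<omega>)" for j \<omega>
  have diff: "ito_sum x (h * real c) k \<omega> - ito_sum x h (k * c) \<omega> = dsum h G (k * c) \<omega>" for k \<omega>
  proof -
    have "ito_sum x (h * real c) k \<omega> = dsum (h * real c) (\<lambda>i \<omega>. \<sigma> (X x (h * real (i * c)) \<omega>)) k \<omega>"
      by (simp add: ito_sum_def mult_ac)
    also have "\<dots> = dsum h (\<lambda>j \<omega>. \<sigma> (X x (h * real ((j div c) * c)) \<omega>)) (k * c) \<omega>"
      by (rule dsum_coarsen[OF c])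
    finally show ?thesis unfolding G_def[abs_def] ito_sum_def by (simp add: dsum_diff)
  qed
  have T0: "0 \<le> T" using T h by (meson less_imp_le mult_nonneg_nonneg of_nat_0_le_iff order_trans)
  have divle: "(j div c) * c \<le> j" for j by simp
  have Gm: "G j \<in> borel_measurable (F (h * real j))" for j
  proof -
    have "h * real ((j div c) * c) \<le> h * real j" using h by (intro mult_left_mono of_nat_mono divle) auto
    then have [measurable]: "(\<lambda>\<omega>. \<sigma> (X x (h * real ((j div c) * c)) \<omega>)) \<in> borel_measurable (F (h * real j))"
      using h by (intro measurable_F_mono[OF \<sigma>X_measurable]) auto
    have [measurable]: "(\<lambda>\<omega>. \<sigma> (X x (h * real j) \<omega>)) \<in> borel_measurable (F (h * real j))"
      using h by (intro \<sigma>X_measurable) auto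
    show ?thesis unfolding G_def[abs_def] by measurable
  qed
  have GW: "norm (G j \<omega>) \<le> modulus x T (h * real c) \<omega>" if j: "j < n * c" and w: "\<omega> \<in> space M" for j \<omega>
  proof -
    have jT: "h * real j \<le> T" using j h T by (smt (verit) mult_left_mono of_nat_less_iff)
    have j': "h * real ((j div c) * c) \<le> h * real j" using h by (intro mult_left_mono of_nat_mono divle) auto
    have "real j - real ((j div c) * c) \<le> real c"
      using mod_less_divisor[OF c, of j] div_mult_mod_eq[of j c] by (smt (verit) of_nat_add of_nat_less_iff)
    then have "h * (real j - real ((j div c) * c)) \<le> h * real c" using h by (intro mult_left_mono) auto
    then have "dist (\<phi> (X x (h * real ((j div c) * c)) \<omega>)) (\<phi> (X x (h * real j) \<omega>)) \<le> modulus x T (h * real c) \<omega>"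
      using jT j' h order_trans[OF j' jT] by (intro modulus_upper[OF w]) (auto simp: right_diff_distrib)
    then show ?thesis unfolding G_def dist_norm[symmetric] using dist_\<phi>(3) order_trans by blast
  qed
  have Gc: "norm (G j \<omega>) \<le> CK" if "j < n * c" "\<omega> \<in> space M" for j \<omega>
    using GW[OF that] modulus_bounds(2)[OF that(2) T0, of "h * real c"] h by simp
  have sum: "h * (\<Sum>k<n * c. \<integral>\<omega>. (norm (G k \<omega>))\<^sup>2 \<partial>M) \<le> T * (\<integral>\<omega>. (modulus x T (h * real c) \<omega>)\<^sup>2 \<partial>M)" (is "_ \<le> T * ?E")
  proof -
    have "(\<integral>\<omega>. (norm (G k \<omega>))\<^sup>2 \<partial>M) \<le> ?E" if "k < n * c" for k
      by (rule integral_mono_AE') (use GW that T0 h in \<open>auto intro!: modulus_sq_integrable AE_I2 power_mono\<close>)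
    then have "(\<Sum>k<n * c. \<integral>\<omega>. (norm (G k \<omega>))\<^sup>2 \<partial>M) \<le> (\<Sum>k<n * c. ?E)" by (intro sum_mono) auto
    then have "h * (\<Sum>k<n * c. \<integral>\<omega>. (norm (G k \<omega>))\<^sup>2 \<partial>M) \<le> h * (\<Sum>k<n * c. ?E)" using h by (intro mult_left_mono) auto
    also have "\<dots> = (h * real (n * c)) * ?E" by simp
    also have "\<dots> \<le> T * ?E" using T by (intro mult_right_mono) auto
    finally show ?thesis .
  qed
  have "prob {\<omega>\<in>space M. \<exists>k\<le>n. e < norm (ito_sum x (h * real c) k \<omega> - ito_sum x h (k * c) \<omega>)}
    \<le> prob {\<omega>\<in>space M. \<exists>j\<le>n * c. e < norm (dsum h G j \<omega>)}"
  proof (rule finite_measure_mono)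
    show "{\<omega>\<in>space M. \<exists>k\<le>n. e < norm (ito_sum x (h * real c) k \<omega> - ito_sum x h (k * c) \<omega>)} \<subseteq> {\<omega>\<in>space M. \<exists>j\<le>n * c. e < norm (dsum h G j \<omega>)}"
      unfolding diff using mult_le_mono1[of _ n c] by blast
    have [measurable]: "dsum h G j \<in> borel_measurable M" for j
      by (rule measurable_F_M[OF dsum_measurable[OF _ Gm]]) (use h in auto)
    show "{\<omega>\<in>space M. \<exists>j\<le>n * c. e < norm (dsum h G j \<omega>)} \<in> events" by measurable
  qed
  also have "\<dots> \<le> h * (\<Sum>k<n * c. \<integral>\<omega>. (norm (G k \<omega>))\<^sup>2 \<partial>M) / e\<^sup>2"
    by (rule dsum_maximal[OF h Gm Gc e])
  also have "\<dots> \<le> T * (\<integral>\<omega>. (modulus x T (h * real c) \<omega>)\<^sup>2 \<partial>M) / e\<^sup>2"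
    by (intro divide_right_mono sum) simp
  finally show ?thesis .
qed

lemma drift_riemann_sum:
  assumes w: "\<omega> \<in> space M" and h: "0 \<le> h"
  shows "h * real k \<le> T \<Longrightarrow> norm (integral {0..h * real k} (\<lambda>s. b (X x s \<omega>)) - (\<Sum>j<k. h *\<^sub>R b (X x (h * real j) \<omega>))) \<le> h * real k * modulus x T h \<omega>"
proof (induction k)
  case (Suc k)
  let ?f = "\<lambda>s. b (X x s \<omega>)"
  have cont: "continuous_on {0..} ?f"
    by (rule continuous_on_compose2[OF b_cont X_continuous[OF x w]]) auto
  have le: "0 \<le> h * real k" "h * real k \<le> h * real (Suc k)" using h by (auto intro: mult_left_mono)
  have int: "?f integrable_on {u..v}" if "0 \<le> u" for u v
    by (rule integrable_continuous_real, rule continuous_on_subset[OF cont]) (use that in auto)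
  have split: "integral {0..h * real (Suc k)} ?f = integral {0..h * real k} ?f + integral {h * real k..h * real (Suc k)} ?f"
    by (rule Henstock_Kurzweil_Integration.integral_combine[symmetric]) (use le int in auto)
  have len: "h * real (Suc k) - h * real k = h" by (simp add: algebra_simps)
  have const: "integral {h * real k..h * real (Suc k)} (\<lambda>_. ?f (h * real k)) = h *\<^sub>R ?f (h * real k)"
    using le len by simp
  have "norm (integral {h * real k..h * real (Suc k)} ?f - h *\<^sub>R ?f (h * real k)) = norm (integral {h * real k..h * real (Suc k)} (\<lambda>s. ?f s - ?f (h * real k)))"
    unfolding const[symmetric] by (subst Henstock_Kurzweil_Integration.integral_diff) (use le int in auto)
  also have "\<dots> \<le> modulus x T h \<omega> * (h * real (Suc k) - h * real k)"
  proof (rule integral_bound)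
    show "continuous_on {h * real k..h * real (Suc k)} (\<lambda>s. ?f s - ?f (h * real k))"
      by (intro continuous_intros continuous_on_subset[OF cont]) (use le in auto)
    fix s assume s: "s \<in> {h * real k..h * real (Suc k)}"
    then have "0 \<le> s" "h * real k \<le> T" "s \<le> T" using le Suc.prems by auto
    then have "dist (\<phi> (X x s \<omega>)) (\<phi> (X x (h * real k) \<omega>)) \<le> modulus x T h \<omega>"
      using s le len Suc.prems by (intro modulus_upper[OF w]) auto
    then show "norm (?f s - ?f (h * real k)) \<le> modulus x T h \<omega>"
      unfolding dist_norm[symmetric] using dist_\<phi>(2) order_trans by blast
  qed (use le in auto)
  finally have step: "norm (integral {h * real k..h * real (Suc k)} ?f - h *\<^sub>R ?f (h * real k)) \<le> modulus x T h \<omega> * h"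
    unfolding len .
  have IH: "norm (integral {0..h * real k} ?f - (\<Sum>j<k. h *\<^sub>R ?f (h * real j))) \<le> h * real k * modulus x T h \<omega>"
    using Suc le by auto
  have "integral {0..h * real (Suc k)} ?f - (\<Sum>j<Suc k. h *\<^sub>R ?f (h * real j))
    = (integral {0..h * real k} ?f - (\<Sum>j<k. h *\<^sub>R ?f (h * real j))) + (integral {h * real k..h * real (Suc k)} ?f - h *\<^sub>R ?f (h * real k))"
    unfolding split by simp
  then have "norm (integral {0..h * real (Suc k)} ?f - (\<Sum>j<Suc k. h *\<^sub>R ?f (h * real j))) \<le> h * real k * modulus x T h \<omega> + modulus x T h \<omega> * h"
    using norm_triangle_mono[OF IH step] by metis
  moreover have "h * real (Suc k) * modulus x T h \<omega> = h * real k * modulus x T h \<omega> + modulus x T h \<omega> * h" by (simp add: algebra_simps)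
  ultimately show ?case by metis
qed simp

text \<open>The drift integral is the point at issue; on each path it is a limit of measurable
  Riemann sums.\<close>

lemma ito_part_measurable [measurable]:
  assumes "0 \<le> t" shows "ito_part x t \<in> borel_measurable M"
proof -
  have "(\<lambda>\<omega>. integral {0..t} (\<lambda>s. b (X x s \<omega>))) \<in> borel_measurable M"
  proof (rule borel_measurable_LIMSEQ_metric)
    let ?h = "\<lambda>n. t / real (Suc n)"
    show "(\<lambda>\<omega>. \<Sum>j<Suc n. ?h n *\<^sub>R b (X x (?h n * real j) \<omega>)) \<in> borel_measurable M" for n
    proof -
      have [measurable]: "X x (?h n * real j) \<in> borel_measurable M" for j
        using assms by (intro X_measurable_M) auto
      show ?thesis by measurable
    qed
    fix \<omega> assume w: "\<omega> \<in> space M"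
    have "(\<lambda>n. ?h n) \<longlonglongrightarrow> 0" by (rule lim_const_over_n[THEN LIMSEQ_Suc])
    then have W0: "(\<lambda>n. t * modulus x t (?h n) \<omega>) \<longlonglongrightarrow> 0"
      using assms by (intro tendsto_mult_right_zero modulus_tendsto_0[OF w]) auto
    have "norm ((\<Sum>j<Suc n. ?h n *\<^sub>R b (X x (?h n * real j) \<omega>)) - integral {0..t} (\<lambda>s. b (X x s \<omega>))) \<le> t * modulus x t (?h n) \<omega>" for n
      using drift_riemann_sum[OF w, of "?h n" "Suc n" t] assms by (simp add: norm_minus_commute del: of_nat_Suc sum.lessThan_Suc)
    then show "(\<lambda>n. \<Sum>j<Suc n. ?h n *\<^sub>R b (X x (?h n * real j) \<omega>)) \<longlonglongrightarrow> integral {0..t} (\<lambda>s. b (X x s \<omega>))"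
      by (intro LIM_zero_cancel[where l="integral {0..t} (\<lambda>s. b (X x s \<omega>))"] Lim_null_comparison[OF _ W0]) auto
  qed
  with assms show ?thesis unfolding ito_part_def[abs_def] by measurable
qed

text \<open>The random variable in \<open>is_ito_integral\<close> need not be measurable, while \<open>measure\<close> vanishes on
  nonmeasurable sets; the completeness part of the usual conditions is what makes this harmless.\<close>

lemma ito_part_dyadic:
  assumes t: "0 \<le> t" and e: "0 < e"
  shows "(\<lambda>n. prob {\<omega>\<in>space M. e < norm (ito_sum x (t / 2^n) (2^n) \<omega> - ito_part x t \<omega>)}) \<longlonglongrightarrow> 0"
proof -
  have "\<forall>t\<ge>0. \<exists>I. is_ito_integral M B (\<lambda>s \<omega>. \<sigma> (X x s \<omega>)) t I \<and>
        (AE \<omega> in M. X x t \<omega> = x + integral {0..t} (\<lambda>s. b (X x s \<omega>)) + I \<omega> - \<eta> x t \<omega>)"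
    using sol[OF x] unfolding strong_solution_def by (elim conjE)
  then obtain I where I: "is_ito_integral M B (\<lambda>s \<omega>. \<sigma> (X x s \<omega>)) t I"
    and eq: "AE \<omega> in M. X x t \<omega> = x + integral {0..t} (\<lambda>s. b (X x s \<omega>)) + I \<omega> - \<eta> x t \<omega>" using t by blast
  have lim: "(\<lambda>n. prob {\<omega>\<in>space M. e < norm (ito_sum x (t / 2^n) (2^n) \<omega> - I \<omega>)}) \<longlonglongrightarrow> 0"
    using I e unfolding is_ito_integral_def conv_in_prob_def by (simp add: ito_sum_def dsum_def)
  from eq have "AE \<omega> in M. I \<omega> = ito_part x t \<omega>" by eventually_elim (simp add: ito_part_def)
  then obtain A where A: "{\<omega>\<in>space M. I \<omega> \<noteq> ito_part x t \<omega>} \<subseteq> A" "A \<in> events" "emeasure M A = 0"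
    by (rule AE_E)
  have sub: "N \<in> events" if "N \<subseteq> A" for N
  proof -
    have "\<forall>A N. A \<in> sets M \<and> emeasure M A = 0 \<and> N \<subseteq> A \<longrightarrow> N \<in> sets (F 0)"
      using filt unfolding usual_filtration_def by (elim conjE)
    then show ?thesis using A that sets_F_subset[of 0] by blast
  qed
  have "prob {\<omega>\<in>space M. e < norm (ito_sum x (t / 2^n) (2^n) \<omega> - I \<omega>)} = prob {\<omega>\<in>space M. e < norm (ito_sum x (t / 2^n) (2^n) \<omega> - ito_part x t \<omega>)}" (is "prob ?I = prob ?J") for n
  proof (rule finite_measure_eq_AE)
    have [measurable]: "ito_sum x (t / 2^n) (2^n) \<in> borel_measurable M" "ito_part x t \<in> borel_measurable M"
      using t by (auto intro!: ito_sum_measurable_M ito_part_measurable)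
    show mJ: "?J \<in> events" by measurable
    have IJ: "I \<omega> = ito_part x t \<omega>" if "\<omega> \<in> space M" "\<omega> \<notin> A" for \<omega>
      using subsetD[OF A(1), of \<omega>] that by (cases "I \<omega> = ito_part x t \<omega>") simp_all
    have I_eq: "?I = (?J - A) \<union> (?I \<inter> A)"
    proof (rule set_eqI)
      fix \<omega> show "\<omega> \<in> ?I \<longleftrightarrow> \<omega> \<in> (?J - A) \<union> (?I \<inter> A)"
        by (cases "\<omega> \<in> space M"; cases "\<omega> \<in> A") (simp_all add: IJ)
    qed
    have "?I \<inter> A \<in> events" by (rule sub) (rule Int_lower2)
    then show "?I \<in> events" by (subst I_eq, intro sets.Un sets.Diff mJ A(2))
    show "AE \<omega> in M. (\<omega> \<in> ?I) = (\<omega> \<in> ?J)" using \<open>AE \<omega> in M. I \<omega> = ito_part x t \<omega>\<close> by eventually_elim simp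
  qed
  with lim show ?thesis by simp
qed

text \<open>The Ito integral at time \<open>t = h * real k\<close> is defined through mesh
  \<open>t / 2^n\<close>, whereas a grid common to all \<open>k\<close> has mesh
  \<open>h / 2^n\<close>. The former is the coarsening of the latter by the factor \<open>k\<close>,
  so \<open>ito_sum_refine\<close> bridges the two; \<open>k = 0\<close> is no coarsening and is
  treated apart.\<close>

lemma ito_part_grid:
  assumes h: "0 < h" and e: "0 < e"
  shows "(\<lambda>n. prob {\<omega>\<in>space M. e < norm (ito_sum x (h / 2^n) (k * 2^n) \<omega> - ito_part x (h * real k) \<omega>)}) \<longlonglongrightarrow> 0"
proof (cases "k = 0")
  case True
  then show ?thesis using ito_part_dyadic[of 0 e] e by (simp add: ito_sum_def dsum_def)
next
  case False
  define t where "t = h * real k"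
  have t: "0 < t" using h False by (simp add: t_def)
  have hn: "(\<lambda>n. t / 2^n) \<longlonglongrightarrow> 0" by (rule LIMSEQ_divide_realpow_zero) simp
  let ?A = "\<lambda>n. prob {\<omega>\<in>space M. e / 2 < norm (ito_sum x (t / 2^n) (2^n) \<omega> - ito_part x t \<omega>)}"
  let ?C = "\<lambda>n. t * (\<integral>\<omega>. (modulus x t (t / 2^n) \<omega>)\<^sup>2 \<partial>M) / (e / 2)\<^sup>2"
  have lim: "(\<lambda>n. ?A n + ?C n) \<longlonglongrightarrow> 0 + t * 0 / (e / 2)\<^sup>2"
    using t e hn by (intro tendsto_intros ito_part_dyadic modulus_sq_integral_tendsto_0) auto
  then have lim0: "(\<lambda>n. ?A n + ?C n) \<longlonglongrightarrow> 0" by simp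
  show ?thesis
  proof (rule tendsto_sandwich[OF _ _ tendsto_const lim0])
    show "\<forall>\<^sub>F n in sequentially. prob {\<omega> \<in> space M. e < norm (ito_sum x (h / 2 ^ n) (k * 2 ^ n) \<omega> - ito_part x (h * real k) \<omega>)} \<le> ?A n + ?C n"
    proof (rule always_eventually, rule allI)
      fix n
      have hc: "h / 2^n * real k = t / 2^n" by (simp add: t_def)
      let ?D = "{\<omega>\<in>space M. \<exists>j\<le>2^n. e / 2 < norm (ito_sum x (t / 2^n) j \<omega> - ito_sum x (h / 2^n) (j * k) \<omega>)}"
      have le: "h / 2^n * real (2^n * k) \<le> t" by (simp add: t_def)
      have [measurable]: "ito_sum x (t / 2^n) j \<in> borel_measurable M" "ito_sum x (h / 2^n) j \<in> borel_measurable M" "ito_part x t \<in> borel_measurable M" for j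
        using t h by (auto intro!: ito_sum_measurable_M ito_part_measurable)
      have mD: "?D \<in> events" by measurable
      have D: "prob ?D \<le> ?C n"
        using ito_sum_refine[of "h / 2^n" k "2^n" t "e / 2"] h False e le unfolding hc by simp
      have "prob {\<omega> \<in> space M. e < norm (ito_sum x (h / 2 ^ n) (k * 2 ^ n) \<omega> - ito_part x (h * real k) \<omega>)}
         \<le> prob ({\<omega>\<in>space M. e / 2 < norm (ito_sum x (t / 2^n) (2^n) \<omega> - ito_part x t \<omega>)} \<union> ?D)"
      proof (rule finite_measure_mono)
        show "{\<omega>\<in>space M. e / 2 < norm (ito_sum x (t / 2^n) (2^n) \<omega> - ito_part x t \<omega>)} \<union> ?D \<in> events"
          using mD by (intro sets.Un) measurable
        show "{\<omega> \<in> space M. e < norm (ito_sum x (h / 2 ^ n) (k * 2 ^ n) \<omega> - ito_part x (h * real k) \<omega>)}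
          \<subseteq> {\<omega>\<in>space M. e / 2 < norm (ito_sum x (t / 2^n) (2^n) \<omega> - ito_part x t \<omega>)} \<union> ?D"
        proof (rule subsetI)
          fix \<omega> assume w: "\<omega> \<in> {\<omega> \<in> space M. e < norm (ito_sum x (h / 2 ^ n) (k * 2 ^ n) \<omega> - ito_part x (h * real k) \<omega>)}"
          show "\<omega> \<in> {\<omega>\<in>space M. e / 2 < norm (ito_sum x (t / 2^n) (2^n) \<omega> - ito_part x t \<omega>)} \<union> ?D"
          proof (cases "norm (ito_sum x (t / 2^n) (2^n) \<omega> - ito_sum x (h / 2^n) (2^n * k) \<omega>) \<le> e / 2")
            case True
            then have "e / 2 < norm (ito_sum x (t / 2^n) (2^n) \<omega> - ito_part x t \<omega>)"
              using w norm_triangle_ineq[of "ito_sum x (t / 2^n) (2^n) \<omega> - ito_part x t \<omega>" "ito_sum x (h / 2^n) (2^n * k) \<omega> - ito_sum x (t / 2^n) (2^n) \<omega>"]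
              by (simp add: t_def mult.commute[of k] norm_minus_commute)
            then show ?thesis using w by simp
          next
            case False
            then have "\<omega> \<in> ?D" using w by (auto simp: not_le intro!: exI[of _ "2^n"])
            then show ?thesis by (rule UnI2)
          qed
        qed
      qed
      also have "\<dots> \<le> ?A n + prob ?D"
        by (intro measure_Un_le mD) measurable
      finally show "prob {\<omega> \<in> space M. e < norm (ito_sum x (h / 2 ^ n) (k * 2 ^ n) \<omega> - ito_part x (h * real k) \<omega>)} \<le> ?A n + ?C n"
        using D by simp
    qed
  qed simp
qed

text \<open>Sums of mesh \<open>h\<close> are compared with sums of mesh \<open>h / 2^n\<close> by a
  bound uniform in \<open>n\<close>. Then \<open>n\<close> tends to infinity, and the latter
  converge at each of the finitely many grid times. Each comparison takes half of the threshold
  \<open>2 * e\<close>.\<close>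

lemma ito_part_max:
  assumes h: "0 < h" and e: "0 < e" and T: "h * real N \<le> T"
  shows "prob {\<omega>\<in>space M. \<exists>k\<le>N. 2 * e < norm (ito_sum x h k \<omega> - ito_part x (h * real k) \<omega>)} \<le> T * (\<integral>\<omega>. (modulus x T h \<omega>)\<^sup>2 \<partial>M) / e\<^sup>2"
    (is "prob ?L \<le> ?R")
proof -
  let ?E = "\<lambda>n k. {\<omega>\<in>space M. e < norm (ito_sum x (h / 2^n) (k * 2^n) \<omega> - ito_part x (h * real k) \<omega>)}"
  have lim: "(\<lambda>n. ?R + (\<Sum>k\<le>N. prob (?E n k))) \<longlonglongrightarrow> ?R + (\<Sum>k\<le>N. 0)"
    by (intro tendsto_intros tendsto_sum ito_part_grid h e)
  have "prob ?L \<le> ?R + (\<Sum>k\<le>N. prob (?E n k))" for n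
  proof -
    let ?D = "{\<omega>\<in>space M. \<exists>k\<le>N. e < norm (ito_sum x h k \<omega> - ito_sum x (h / 2^n) (k * 2^n) \<omega>)}"
    have hc: "h / 2^n * real (2^n) = h" by simp
    have D: "prob ?D \<le> ?R"
      using ito_sum_refine[of "h / 2^n" "2^n" N T e] h e T unfolding hc by simp
    have [measurable]: "ito_sum x h k \<in> borel_measurable M" "ito_sum x (h / 2^n) k \<in> borel_measurable M" "ito_part x (h * real k) \<in> borel_measurable M" for k
      using h by (auto intro!: ito_sum_measurable_M ito_part_measurable)
    have mD: "?D \<in> events" by measurable
    have mE: "?E n k \<in> events" for k by measurable
    have "prob ?L \<le> prob (?D \<union> (\<Union>k\<in>{..N}. ?E n k))"
    proof (rule finite_measure_mono)
      show "?D \<union> (\<Union>k\<in>{..N}. ?E n k) \<in> events" using mD mE by (intro sets.Un sets.finite_UN) auto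
      show "?L \<subseteq> ?D \<union> (\<Union>k\<in>{..N}. ?E n k)"
      proof safe
        fix \<omega> k assume w: "\<omega> \<in> space M" "k \<le> N" "2 * e < norm (ito_sum x h k \<omega> - ito_part x (h * real k) \<omega>)"
          and "\<omega> \<notin> (\<Union>k\<in>{..N}. ?E n k)"
        then have "norm (ito_sum x (h / 2^n) (k * 2^n) \<omega> - ito_part x (h * real k) \<omega>) \<le> e" by (auto simp: not_less)
        then have "e < norm (ito_sum x h k \<omega> - ito_sum x (h / 2^n) (k * 2^n) \<omega>)"
          using w(3) norm_triangle_ineq[of "ito_sum x h k \<omega> - ito_sum x (h / 2^n) (k * 2^n) \<omega>" "ito_sum x (h / 2^n) (k * 2^n) \<omega> - ito_part x (h * real k) \<omega>"] by simp
        then show "\<exists>k\<le>N. e < norm (ito_sum x h k \<omega> - ito_sum x (h / 2^n) (k * 2^n) \<omega>)" using w by auto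
      qed
    qed
    also have "\<dots> \<le> prob ?D + prob (\<Union>k\<in>{..N}. ?E n k)"
      using mD mE by (intro measure_Un_le sets.finite_UN) auto
    also have "prob (\<Union>k\<in>{..N}. ?E n k) \<le> (\<Sum>k\<le>N. prob (?E n k))"
      using mE by (intro measure_UNION_le) auto
    finally show ?thesis using D by simp
  qed
  then have "prob ?L \<le> ?R + (\<Sum>k\<le>N. 0)" by (intro LIMSEQ_le_const[OF lim]) auto
  then show ?thesis by simp
qed

lemma residual_measurable: "0 \<le> h \<Longrightarrow> residual x h k \<in> borel_measurable (F (h * real k))"
proof -
  assume h: "0 \<le> h"
  have [measurable]: "X x (h * real k) \<in> borel_measurable (F (h * real k))" "\<eta> x (h * real k) \<in> borel_measurable (F (h * real k))"
    "ito_sum x h k \<in> borel_measurable (F (h * real k))"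
    using h by (auto intro!: X_measurable[OF x] \<eta>_measurable[OF x] ito_sum_measurable)
  have [measurable]: "X x (h * real j) \<in> borel_measurable (F (h * real k))" if "j \<in> {..<k}" for j
    using h that by (intro X_measurable[OF x] mult_left_mono) auto
  show ?thesis unfolding residual_def[abs_def] by measurable
qed

lemma residual_measurable_M [measurable]: "0 \<le> h \<Longrightarrow> residual x h k \<in> borel_measurable M"
  by (rule measurable_F_M[OF residual_measurable])

lemma residual_bad_event:
  assumes T: "0 < T" and e: "0 < e"
  shows "(\<lambda>N. prob {\<omega>\<in>space M. (\<exists>k\<le>N. e < norm (residual x (T / real N) k \<omega>)) \<or> e < modulus x T (T / real N) \<omega>}) \<longlonglongrightarrow> 0"
proof -
  \<comment> \<open>The Ito part of \<open>residual\<close> is allowed \<open>e / 2\<close>, written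
    \<open>2 * (e / 4)\<close> to fit \<open>ito_part_max\<close>; the drift part is allowed
    \<open>e / 2\<close> through \<open>T * e' \<le> e / 2\<close>. One Markov bound at level
    \<open>min e e'\<close> serves both the drift and the event that the modulus exceeds
    \<open>e\<close>.\<close>
  define e' where "e' = min (e / 4) (e / (2 * T))"
  have e': "0 < e'" using T e by (simp add: e'_def)
  let ?h = "\<lambda>N. T / real N"
  let ?E = "\<lambda>N. \<integral>\<omega>. (modulus x T (?h N) \<omega>)\<^sup>2 \<partial>M"
  have lim: "(\<lambda>N. T * ?E N / (e / 4)\<^sup>2 + ?E N / (min e e')\<^sup>2) \<longlonglongrightarrow> T * 0 / (e / 4)\<^sup>2 + 0 / (min e e')\<^sup>2"
    using T e e' by (intro tendsto_intros modulus_sq_integral_tendsto_0 lim_const_over_n) auto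
  then have lim0: "(\<lambda>N. T * ?E N / (e / 4)\<^sup>2 + ?E N / (min e e')\<^sup>2) \<longlonglongrightarrow> 0" by simp
  let ?L = "\<lambda>N. {\<omega>\<in>space M. (\<exists>k\<le>N. e < norm (residual x (?h N) k \<omega>)) \<or> e < modulus x T (?h N) \<omega>}"
  show ?thesis
  proof (rule tendsto_sandwich[OF _ _ tendsto_const lim0])
    show "\<forall>\<^sub>F N in sequentially. prob (?L N) \<le> T * ?E N / (e / 4)\<^sup>2 + ?E N / (min e e')\<^sup>2"
      using eventually_gt_at_top[of 0]
    proof eventually_elim
      case (elim N)
      let ?hN = "T / real N"
      have h: "0 < ?hN" "?hN * real N = T" using T elim by auto
      let ?A = "{\<omega>\<in>space M. \<exists>k\<le>N. 2 * (e / 4) < norm (ito_sum x ?hN k \<omega> - ito_part x (?hN * real k) \<omega>)}"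
      let ?B = "{\<omega>\<in>space M. (min e e')\<^sup>2 \<le> (modulus x T ?hN \<omega>)\<^sup>2}"
      have [measurable]: "ito_sum x ?hN k \<in> borel_measurable M" "ito_part x (?hN * real k) \<in> borel_measurable M" "modulus x T ?hN \<in> borel_measurable M" for k
        using h T by (auto intro!: ito_sum_measurable_M ito_part_measurable modulus_measurable)
      have mA: "?A \<in> events" and mB: "?B \<in> events" by measurable
      have "prob (?L N) \<le> prob (?A \<union> ?B)"
      proof (rule finite_measure_mono)
        show "?A \<union> ?B \<in> events" using mA mB by (rule sets.Un)
        have W0: "min e e' < modulus x T ?hN \<omega> \<Longrightarrow> \<omega> \<in> space M \<Longrightarrow> \<omega> \<in> ?B" for \<omega>
          using e e' power_mono[of "min e e'" _ 2] by simp
        show "?L N \<subseteq> ?A \<union> ?B"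
        proof safe
          fix \<omega> k assume w: "\<omega> \<in> space M" and k: "k \<le> N" and m: "e < norm (residual x ?hN k \<omega>)"
            and notB: "\<not> (min e e')\<^sup>2 \<le> (modulus x T ?hN \<omega>)\<^sup>2"
          have W: "modulus x T ?hN \<omega> \<le> e'" 
          proof (rule ccontr)
            assume "\<not> modulus x T ?hN \<omega> \<le> e'"
            then have "min e e' < modulus x T ?hN \<omega>" by (simp add: min_less_iff_disj not_le)
            from W0[OF this w] notB show False by blast
          qed
          have kT: "?hN * real k \<le> T" using h k T by (metis less_imp_le mult_left_mono of_nat_mono)
          have "?hN * real k * modulus x T ?hN \<omega> \<le> T * e'"
            using kT W modulus_bounds(1)[OF w, of T ?hN] T h by (intro mult_mono) auto
          also have "\<dots> \<le> e / 2" using T unfolding e'_def by (simp add: min_def field_simps)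
          finally have 1: "norm (integral {0..?hN * real k} (\<lambda>s. b (X x s \<omega>)) - (\<Sum>j<k. ?hN *\<^sub>R b (X x (?hN * real j) \<omega>))) \<le> e / 2"
            by (rule order_trans[OF drift_riemann_sum[OF w less_imp_le[OF h(1)] kT]])
          have "residual x ?hN k \<omega> = (ito_part x (?hN * real k) \<omega> - ito_sum x ?hN k \<omega>) + (integral {0..?hN * real k} (\<lambda>s. b (X x s \<omega>)) - (\<Sum>j<k. ?hN *\<^sub>R b (X x (?hN * real j) \<omega>)))"
            by (simp add: residual_def ito_part_def)
          then have "norm (residual x ?hN k \<omega>) \<le> norm (ito_part x (?hN * real k) \<omega> - ito_sum x ?hN k \<omega>) + e / 2"
            using norm_triangle_mono[OF order_refl 1] by metis
          then have "e / 2 < norm (ito_sum x ?hN k \<omega> - ito_part x (?hN * real k) \<omega>)"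
            unfolding norm_minus_commute[of "ito_sum x ?hN k \<omega>"] using m by linarith
          then show "\<exists>k\<le>N. 2 * (e / 4) < norm (ito_sum x ?hN k \<omega> - ito_part x (?hN * real k) \<omega>)" using k by (intro exI[of _ k]) simp
        next
          fix \<omega> assume w: "\<omega> \<in> space M" "e < modulus x T ?hN \<omega>" "\<not> (min e e')\<^sup>2 \<le> (modulus x T ?hN \<omega>)\<^sup>2"
          then have "min e e' < modulus x T ?hN \<omega>" by simp
          from W0[OF this w(1)] w(3) show "\<exists>k\<le>N. 2 * (e / 4) < norm (ito_sum x ?hN k \<omega> - ito_part x (?hN * real k) \<omega>)" by simp
        qed
      qed
      also have "\<dots> \<le> prob ?A + prob ?B" using mA mB by (rule measure_Un_le)
      also have "prob ?A \<le> T * ?E N / (e / 4)\<^sup>2" using ito_part_max[OF h(1) _ eq_refl[OF h(2)], of "e / 4"] e by simp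
      also have "prob ?B \<le> ?E N / (min e e')\<^sup>2"
        using T h e e' by (intro integral_Markov_inequality_measure[where A="{}"] modulus_sq_integrable) auto
      finally show ?case by simp
    qed
  qed simp
qed

end

end

section \<open>The projected Euler scheme\<close>

lemma norm_add_scaleR_power2:
  fixes e y :: "'b::real_inner"
  shows "(norm (e + h *\<^sub>R y))\<^sup>2 = (norm e)\<^sup>2 + 2 * h * (e \<bullet> y) + h\<^sup>2 * (norm y)\<^sup>2"
  unfolding power2_norm_eq_inner
  by (simp add: inner_add_left inner_add_right inner_commute power2_eq_square algebra_simps)

context reflected_sde
begin

lemma ex_inner_ball: "\<exists>a r. 0 < r \<and> cball a r \<subseteq> K"
proof -
  obtain a where a: "a \<in> U" using dom by blast
  obtain r where "0 < r" "cball a r \<subseteq> U" using open_contains_cball[of U] dom(1) a by blast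
  then show ?thesis using closure_subset[of U] by blast
qed

definition a0 :: "real^'d" where "a0 = (SOME a. \<exists>r>0. cball a r \<subseteq> K)"
definition r0 :: real where "r0 = (SOME r. 0 < r \<and> cball a0 r \<subseteq> K)"

lemma r0_pos: "0 < r0" and r0_ball: "cball a0 r0 \<subseteq> K"
proof -
  have "\<exists>a. \<exists>r>0. cball a r \<subseteq> K" using ex_inner_ball by blast
  then have "\<exists>r>0. cball a0 r \<subseteq> K" unfolding a0_def by (rule someI_ex)
  then have "0 < r0 \<and> cball a0 r0 \<subseteq> K" unfolding r0_def by (rule someI_ex)
  then show "0 < r0" "cball a0 r0 \<subseteq> K" by auto
qed

lemma a0_in_K: "a0 \<in> K" using r0_ball r0_pos by auto

text \<open>A homothetic image about an interior point: convexity and compactness are inherited, and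
  each point of \<open>K\<close> has an explicit partner in \<open>Kt \<theta>\<close> at a distance
  of order \<theta>.\<close>

definition Kt :: "real \<Rightarrow> (real^'d) set" where
  "Kt \<theta> = (\<lambda>k. (1 - \<theta>) *\<^sub>R k + \<theta> *\<^sub>R a0) ` K"

lemma Kt_convex: "convex (Kt \<theta>)"
proof -
  have "Kt \<theta> = (\<lambda>z. \<theta> *\<^sub>R a0 + z) ` ((\<lambda>k. (1 - \<theta>) *\<^sub>R k) ` K)" unfolding Kt_def by (auto simp: image_image add.commute)
  then show ?thesis using convex_translation[OF convex_scaling[OF K_convex]] by simp
qed

lemma Kt_compact: "compact (Kt \<theta>)"
  unfolding Kt_def by (intro compact_continuous_image K_compact continuous_intros)

lemma Kt_closed: "closed (Kt \<theta>)" by (rule compact_imp_closed[OF Kt_compact])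

lemma Kt_nonempty: "Kt \<theta> \<noteq> {}" unfolding Kt_def using K_nonempty by simp

lemma Kt_subset: "0 \<le> \<theta> \<Longrightarrow> \<theta> \<le> 1 \<Longrightarrow> Kt \<theta> \<subseteq> K"
  unfolding Kt_def using convexD[OF K_convex _ a0_in_K] by auto

text \<open>The displacement is absorbed into the \<open>a0\<close> part of the convex combination,
  as \<open>\<theta> *\<^sub>R (a0 + (1 / \<theta>) *\<^sub>R v)\<close>.\<close>

lemma Kt_ball:
  assumes "0 < \<theta>" "\<theta> \<le> 1" "z \<in> Kt \<theta>" "norm v \<le> \<theta> * r0"
  shows "z + v \<in> K"
proof -
  obtain k where k: "k \<in> K" "z = (1 - \<theta>) *\<^sub>R k + \<theta> *\<^sub>R a0" using assms(3) unfolding Kt_def by auto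
  have "norm ((1 / \<theta>) *\<^sub>R v) \<le> r0" using assms by (simp add: field_simps)
  then have "a0 + (1 / \<theta>) *\<^sub>R v \<in> K" using r0_ball by (auto simp: dist_norm)
  then have "(1 - \<theta>) *\<^sub>R k + \<theta> *\<^sub>R (a0 + (1 / \<theta>) *\<^sub>R v) \<in> K" using assms by (intro convexD[OF K_convex k(1)]) auto
  then show ?thesis using k assms by (simp add: scaleR_add_right add.assoc)
qed

lemma Kt_inner_ball:
  assumes "0 \<le> \<theta>" "\<theta> \<le> 1" "norm v \<le> r0"
  shows "a0 + (1 - \<theta>) *\<^sub>R v \<in> Kt \<theta>"
proof -
  have "a0 + v \<in> K" using r0_ball assms(3) by (auto simp: dist_norm)
  then show ?thesis unfolding Kt_def by (intro image_eqI[of _ _ "a0 + v"]) (auto simp: algebra_simps)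
qed

definition drift_step :: "real \<Rightarrow> real^'d \<Rightarrow> real^'d \<Rightarrow> real^'d" where
  "drift_step h z w = z + h *\<^sub>R b z + \<sigma> z *v w"

definition step :: "real \<Rightarrow> real \<Rightarrow> real^'d \<Rightarrow> real^'d \<Rightarrow> real^'d" where
  "step \<theta> h z w = closest_point (Kt \<theta>) (drift_step h z w)"

text \<open>The starting point is not projected: it lies in \<open>K\<close>, and the later iterates
  lie in \<open>Kt \<theta>\<close>.\<close>

primrec Z :: "real \<Rightarrow> real \<Rightarrow> real^'d \<Rightarrow> nat \<Rightarrow> 'a \<Rightarrow> real^'d" where
  "Z \<theta> h x 0 = (\<lambda>\<omega>. x)"
| "Z \<theta> h x (Suc k) = (\<lambda>\<omega>. step \<theta> h (Z \<theta> h x k \<omega>) (B (h * real (Suc k)) \<omega> - B (h * real k) \<omega>))"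

lemma closest_point_Kt_measurable [measurable]: "closest_point (Kt \<theta>) \<in> borel_measurable borel"
  by (intro borel_measurable_continuous_onI continuous_on_closest_point Kt_convex Kt_closed Kt_nonempty)

lemma drift_step_measurable [measurable (raw)]:
  assumes [measurable]: "f \<in> borel_measurable N" "g \<in> borel_measurable N"
  shows "(\<lambda>\<omega>. drift_step h (f \<omega>) (g \<omega>)) \<in> borel_measurable N"
  unfolding drift_step_def by measurable

lemma step_measurable [measurable (raw)]:
  assumes [measurable]: "f \<in> borel_measurable N" "g \<in> borel_measurable N"
  shows "(\<lambda>\<omega>. step \<theta> h (f \<omega>) (g \<omega>)) \<in> borel_measurable N"
  unfolding step_def by measurable

lemma step_in_Kt: "step \<theta> h z w \<in> Kt \<theta>"
  unfolding step_def by (rule closest_point_in_set[OF Kt_closed Kt_nonempty])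

lemma Z_in_K: "0 \<le> \<theta> \<Longrightarrow> \<theta> \<le> 1 \<Longrightarrow> x \<in> K \<Longrightarrow> Z \<theta> h x k \<omega> \<in> K"
  using Kt_subset[of \<theta>] step_in_Kt by (cases k) auto

lemma inc_measurable_F:
  "0 \<le> h \<Longrightarrow> (\<lambda>\<omega>. B (h * real (Suc k)) \<omega> - B (h * real k) \<omega>) \<in> borel_measurable (F (h * real (Suc k)))"
proof -
  assume h: "0 \<le> h"
  have [measurable]: "B (h * real k) \<in> borel_measurable (F (h * real (Suc k)))" "B (h * real (Suc k)) \<in> borel_measurable (F (h * real (Suc k)))"
    using h by (auto intro!: B_measurable mult_left_mono)
  show ?thesis by measurable
qed

lemma Z_measurable: "0 \<le> h \<Longrightarrow> Z \<theta> h x k \<in> borel_measurable (F (h * real k))"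
proof (induction k)
  case (Suc k)
  have [measurable]: "Z \<theta> h x k \<in> borel_measurable (F (h * real (Suc k)))"
    by (rule measurable_F_mono[OF Suc.IH]) (use Suc.prems in \<open>auto intro: mult_left_mono\<close>)
  note [measurable] = inc_measurable_F[OF Suc.prems, of k]
  show ?case unfolding Z.simps by measurable
qed simp

lemma Z_measurable_M: "0 \<le> h \<Longrightarrow> Z \<theta> h x k \<in> borel_measurable M"
  by (rule measurable_F_M[OF Z_measurable])

text \<open>The counterpart in the scheme of an increment of \<open>\<eta>\<close>: the outward
  normal displacement that the projection removes.\<close>

definition dz :: "real \<Rightarrow> real \<Rightarrow> real^'d \<Rightarrow> nat \<Rightarrow> 'a \<Rightarrow> real^'d" where
  "dz \<theta> h x k \<omega> = drift_step h (Z \<theta> h x k \<omega>) (B (h * real (Suc k)) \<omega> - B (h * real k) \<omega>) - Z \<theta> h x (Suc k) \<omega>"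

lemma dz_measurable_M: "0 \<le> h \<Longrightarrow> dz \<theta> h x k \<in> borel_measurable M"
proof -
  assume h: "0 \<le> h"
  note [measurable] = Z_measurable_M[OF h] measurable_F_M[OF inc_measurable_F[OF h]]
  show ?thesis unfolding dz_def[abs_def] by measurable
qed

lemma dz_normal: "y \<in> Kt \<theta> \<Longrightarrow> (y - Z \<theta> h x (Suc k) \<omega>) \<bullet> dz \<theta> h x k \<omega> \<le> 0"
  unfolding dz_def Z.simps step_def
  by (subst inner_commute) (rule closest_point_dot[OF Kt_convex Kt_closed])

text \<open>\<open>dz_normal\<close> is tested with the extreme point, in the direction of
  \<open>dz\<close>, of the ball about \<open>a0\<close> inscribed in \<open>Kt \<theta>\<close>.
  Its radius \<open>(1 - \<theta>) * r0\<close> is at least \<open>r0 / 2\<close>.\<close>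

lemma dz_inner:
  assumes "0 \<le> \<theta>" "\<theta> \<le> 1/2"
  shows "r0 / 2 * norm (dz \<theta> h x k \<omega>) \<le> (Z \<theta> h x (Suc k) \<omega> - a0) \<bullet> dz \<theta> h x k \<omega>"
proof -
  let ?d = "dz \<theta> h x k \<omega>"
  have "norm (r0 *\<^sub>R sgn ?d) \<le> r0" using r0_pos by (simp add: norm_sgn)
  from Kt_inner_ball[OF assms(1) _ this] assms
  have "(a0 + (1 - \<theta>) *\<^sub>R (r0 *\<^sub>R sgn ?d) - Z \<theta> h x (Suc k) \<omega>) \<bullet> ?d \<le> 0" by (intro dz_normal) auto
  moreover have "sgn ?d \<bullet> ?d = norm ?d"
    by (cases "?d = 0") (simp_all add: sgn_div_norm power2_norm_eq_inner[symmetric] power2_eq_square)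
  ultimately have "(1 - \<theta>) * r0 * norm ?d \<le> (Z \<theta> h x (Suc k) \<omega> - a0) \<bullet> ?d"
    by (simp add: inner_add_left inner_diff_left)
  moreover have "r0 / 2 * norm ?d \<le> (1 - \<theta>) * r0 * norm ?d"
    using assms r0_pos by (intro mult_right_mono) (auto simp: field_simps)
  ultimately show ?thesis by linarith
qed

text \<open>Turns a pointwise bound on \<open>|v|^2 + h * |H|^2\<close> into an estimate in mean
  after the noise has been added, since the cross term has mean zero. All energy estimates for the
  scheme go through it.\<close>

lemma one_step_scheme:
  fixes v :: "'a \<Rightarrow> real^'d" and H :: "'a \<Rightarrow> real^'d^'d"
  assumes h: "0 < h"
    and v: "v \<in> borel_measurable (F (h * real k))" "\<And>\<omega>. \<omega> \<in> space M \<Longrightarrow> norm (v \<omega>) \<le> c"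
    and H: "H \<in> borel_measurable (F (h * real k))" "\<And>\<omega>. \<omega> \<in> space M \<Longrightarrow> norm (H \<omega>) \<le> c"
    and p: "p \<in> borel_measurable M" "integrable M p"
    and le: "\<And>\<omega>. \<omega> \<in> space M \<Longrightarrow> (norm (v \<omega>))\<^sup>2 + h * (norm (H \<omega>))\<^sup>2 \<le> p \<omega>"
  shows "integrable M (\<lambda>\<omega>. (norm (v \<omega> + H \<omega> *v (B (h * real (Suc k)) \<omega> - B (h * real k) \<omega>)))\<^sup>2)"
    "(\<integral>\<omega>. (norm (v \<omega> + H \<omega> *v (B (h * real (Suc k)) \<omega> - B (h * real k) \<omega>)))\<^sup>2 \<partial>M) \<le> (\<integral>\<omega>. p \<omega> \<partial>M)"
proof -
  have [measurable]: "v \<in> borel_measurable M" "H \<in> borel_measurable M"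
    using v(1) H(1) by (auto intro: measurable_F_M)
  have vi: "integrable M (\<lambda>\<omega>. (norm (v \<omega>))\<^sup>2)"
    by (rule integrable_const_bound[where B="c\<^sup>2"]) (auto intro!: AE_I2 power_mono v)
  have Hi: "integrable M (\<lambda>\<omega>. (norm (H \<omega>))\<^sup>2)"
    by (rule integrable_const_bound[where B="c\<^sup>2"]) (auto intro!: AE_I2 power_mono H)
  have lt: "0 \<le> h * real k" "h * real k < h * real (Suc k)" using h by auto
  note O = one_step_isometry[OF lt v(1) vi H]
  show "integrable M (\<lambda>\<omega>. (norm (v \<omega> + H \<omega> *v (B (h * real (Suc k)) \<omega> - B (h * real k) \<omega>)))\<^sup>2)" by (rule O(1))
  have "h * real (Suc k) - h * real k = h" by (simp add: algebra_simps)
  then have "(\<integral>\<omega>. (norm (v \<omega> + H \<omega> *v (B (h * real (Suc k)) \<omega> - B (h * real k) \<omega>)))\<^sup>2 \<partial>M)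
    = (\<integral>\<omega>. (norm (v \<omega>))\<^sup>2 + h * (norm (H \<omega>))\<^sup>2 \<partial>M)"
    using O(2) vi Hi by simp
  also have "\<dots> \<le> (\<integral>\<omega>. p \<omega> \<partial>M)" by (rule integral_mono) (use vi Hi p le in auto)
  finally show "(\<integral>\<omega>. (norm (v \<omega> + H \<omega> *v (B (h * real (Suc k)) \<omega> - B (h * real k) \<omega>)))\<^sup>2 \<partial>M) \<le> (\<integral>\<omega>. p \<omega> \<partial>M)" .
qed

lemma K_diff_bound: "y \<in> K \<Longrightarrow> z \<in> K \<Longrightarrow> norm (y - z) \<le> 2 * CK"
  using norm_triangle_ineq4[of y z] CK(1)[of y] CK(1)[of z] by linarith

lemma b_diff_bound: "y \<in> K \<Longrightarrow> z \<in> K \<Longrightarrow> norm (b y - b z) \<le> 2 * CK"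
  using norm_triangle_ineq4[of "b y" "b z"] CK(2)[of y] CK(2)[of z] by linarith

lemma \<sigma>_diff_bound: "y \<in> K \<Longrightarrow> z \<in> K \<Longrightarrow> norm (\<sigma> y - \<sigma> z) \<le> 2 * CK"
  using norm_triangle_ineq4[of "\<sigma> y" "\<sigma> z"] CK(3)[of y] CK(3)[of z] by linarith

text \<open>Discrete energy balance: testing the projection against the interior point \<open>a0\<close> bounds its total variation.\<close>

lemma dz_step:
  assumes h: "0 < h" "h \<le> 1" and th: "0 \<le> \<theta>" "\<theta> \<le> 1/2" and x: "x \<in> K"
  shows "integrable M (\<lambda>\<omega>. norm (dz \<theta> h x k \<omega>))"
    "integrable M (\<lambda>\<omega>. (norm (Z \<theta> h x k \<omega> - a0))\<^sup>2)"
    "(\<integral>\<omega>. (norm (Z \<theta> h x (Suc k) \<omega> - a0))\<^sup>2 \<partial>M) + r0 * (\<integral>\<omega>. norm (dz \<theta> h x k \<omega>) \<partial>M)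
      \<le> (\<integral>\<omega>. (norm (Z \<theta> h x k \<omega> - a0))\<^sup>2 \<partial>M) + 6 * CK\<^sup>2 * h"
proof -
  let ?Z = "Z \<theta> h x" and ?d = "dz \<theta> h x k"
  have ZK: "?Z k \<omega> \<in> K" for k \<omega> using Z_in_K th x by simp
  note Zm = Z_measurable[OF less_imp_le[OF h(1)], of \<theta> x]
  note [measurable] = Z_measurable_M[OF less_imp_le[OF h(1)], of \<theta> x] dz_measurable_M[OF less_imp_le[OF h(1)]]
  have "(norm (?Z k \<omega> - a0))\<^sup>2 \<le> (2 * CK)\<^sup>2" for k \<omega>
    by (intro power_mono K_diff_bound ZK a0_in_K) auto
  then have Zi: "integrable M (\<lambda>\<omega>. (norm (?Z k \<omega> - a0))\<^sup>2)" for k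
    by (intro integrable_const_bound[where B="(2 * CK)\<^sup>2"] AE_I2) auto
  then show "integrable M (\<lambda>\<omega>. (norm (?Z k \<omega> - a0))\<^sup>2)" .
  let ?v = "\<lambda>\<omega>. ?Z k \<omega> + h *\<^sub>R b (?Z k \<omega>) - a0" and ?H = "\<lambda>\<omega>. \<sigma> (?Z k \<omega>)"
  \<comment> \<open>The factor 6 consists of 4 from the inner product with the drift (diameter
    \<open>2 * CK\<close>), 1 from the squared drift with \<open>h \<le> 1\<close>, and 1 from the
    noise.\<close>
  have v_le: "(norm (?v \<omega>))\<^sup>2 + h * (norm (?H \<omega>))\<^sup>2 \<le> (norm (?Z k \<omega> - a0))\<^sup>2 + 6 * CK\<^sup>2 * h" for \<omega>
  proof -
    let ?b = "b (?Z k \<omega>)" and ?e = "?Z k \<omega> - a0"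
    have "(norm (?v \<omega>))\<^sup>2 = (norm ?e)\<^sup>2 + 2 * h * (?e \<bullet> ?b) + h\<^sup>2 * (norm ?b)\<^sup>2"
      using norm_add_scaleR_power2[of ?e h ?b] by (simp add: algebra_simps)
    moreover have "2 * h * (?e \<bullet> ?b) \<le> 2 * h * (2 * CK * CK)"
    proof (rule mult_left_mono)
      have "?e \<bullet> ?b \<le> norm ?e * norm ?b" by (rule norm_cauchy_schwarz)
      also have "\<dots> \<le> (2 * CK) * CK" using CK_pos by (intro mult_mono K_diff_bound ZK a0_in_K CK) auto
      finally show "?e \<bullet> ?b \<le> 2 * CK * CK" .
    qed (use h in auto)
    moreover have "h\<^sup>2 * (norm ?b)\<^sup>2 \<le> h * CK\<^sup>2"
      using h CK(2)[OF ZK, of k \<omega>] by (intro mult_mono power_mono) (auto simp: power2_eq_square mult_left_le)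
    moreover have "h * (norm (?H \<omega>))\<^sup>2 \<le> h * CK\<^sup>2"
      using h CK(3)[OF ZK, of k \<omega>] by (intro mult_left_mono power_mono) auto
    moreover have "2 * h * (2 * CK * CK) = 4 * (h * CK\<^sup>2)" "6 * CK\<^sup>2 * h = 6 * (h * CK\<^sup>2)"
      by (simp_all add: power2_eq_square)
    ultimately show ?thesis by linarith
  qed
  have vm: "?v \<in> borel_measurable (F (h * real k))" "?H \<in> borel_measurable (F (h * real k))"
    using Zm by measurable
  have vb: "norm (?v \<omega>) \<le> 3 * CK" "norm (?H \<omega>) \<le> 3 * CK" for \<omega>
  proof -
    have "norm (h *\<^sub>R b (?Z k \<omega>)) \<le> 1 * CK" unfolding norm_scaleR using h by (intro mult_mono CK ZK) auto
    then show "norm (?v \<omega>) \<le> 3 * CK"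
      using norm_triangle_ineq[of "?Z k \<omega> - a0" "h *\<^sub>R b (?Z k \<omega>)"] K_diff_bound[OF ZK a0_in_K, of k \<omega>]
      by (simp add: algebra_simps)
    show "norm (?H \<omega>) \<le> 3 * CK" using CK(3)[OF ZK, of k \<omega>] CK_pos by simp
  qed
  note O = one_step_scheme[OF h(1) vm(1) vb(1) vm(2) vb(2), of "\<lambda>\<omega>. (norm (?Z k \<omega> - a0))\<^sup>2 + 6 * CK\<^sup>2 * h", OF _ _ v_le]
  let ?V = "\<lambda>\<omega>. ?v \<omega> + ?H \<omega> *v (B (h * real (Suc k)) \<omega> - B (h * real k) \<omega>)"
  have V: "?V \<omega> = (?Z (Suc k) \<omega> - a0) + ?d \<omega>" for \<omega>
    by (simp add: dz_def drift_step_def)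
  \<comment> \<open>\<open>?V\<close> is the position before projection, relative to
    \<open>a0\<close>. Its square exceeds that of the projected position by at least twice the inner
    product bounded below in \<open>dz_inner\<close>.\<close>
  have Vge: "(norm (?Z (Suc k) \<omega> - a0))\<^sup>2 + r0 * norm (?d \<omega>) \<le> (norm (?V \<omega>))\<^sup>2" for \<omega>
  proof -
    have "(norm (?V \<omega>))\<^sup>2 = (norm (?Z (Suc k) \<omega> - a0))\<^sup>2 + 2 * ((?Z (Suc k) \<omega> - a0) \<bullet> ?d \<omega>) + (norm (?d \<omega>))\<^sup>2"
      unfolding V power2_norm_eq_inner by (simp add: inner_add_left inner_add_right inner_commute)
    then show ?thesis using dz_inner[OF th, of h x k \<omega>] zero_le_power2[of "norm (?d \<omega>)"] by linarith
  qed
  have Vi: "integrable M (\<lambda>\<omega>. (norm (?V \<omega>))\<^sup>2)" by (rule O(1)) (use Zi in auto)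
  have rd: "integrable M (\<lambda>\<omega>. r0 * norm (?d \<omega>))"
  proof (rule Bochner_Integration.integrable_bound[OF Vi])
    show "AE \<omega> in M. norm (r0 * norm (?d \<omega>)) \<le> norm ((norm (?V \<omega>))\<^sup>2)"
    proof (rule AE_I2)
      fix \<omega>
      have "0 \<le> (norm (?Z (Suc k) \<omega> - a0))\<^sup>2" by (rule zero_le_power2)
      then have "r0 * norm (?d \<omega>) \<le> (norm (?V \<omega>))\<^sup>2" using Vge[of \<omega>] by linarith
      then show "norm (r0 * norm (?d \<omega>)) \<le> norm ((norm (?V \<omega>))\<^sup>2)" using r0_pos by simp
    qed
  qed measurable
  then show di: "integrable M (\<lambda>\<omega>. norm (?d \<omega>))" using r0_pos by simp
  have "(\<integral>\<omega>. (norm (?Z (Suc k) \<omega> - a0))\<^sup>2 \<partial>M) + r0 * (\<integral>\<omega>. norm (?d \<omega>) \<partial>M) = (\<integral>\<omega>. (norm (?Z (Suc k) \<omega> - a0))\<^sup>2 + r0 * norm (?d \<omega>) \<partial>M)"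
    by (subst Bochner_Integration.integral_add[OF Zi rd]) simp
  also have "\<dots> \<le> (\<integral>\<omega>. (norm (?V \<omega>))\<^sup>2 \<partial>M)"
    by (rule integral_mono) (use Zi rd Vi Vge in \<open>auto simp del: Z.simps\<close>)
  also have "\<dots> \<le> (\<integral>\<omega>. (norm (?Z k \<omega> - a0))\<^sup>2 + 6 * CK\<^sup>2 * h \<partial>M)"
    by (rule O(2)) (use Zi in auto)
  also have "\<dots> = (\<integral>\<omega>. (norm (?Z k \<omega> - a0))\<^sup>2 \<partial>M) + 6 * CK\<^sup>2 * h" using Zi by (simp add: prob_space)
  finally show "(\<integral>\<omega>. (norm (?Z (Suc k) \<omega> - a0))\<^sup>2 \<partial>M) + r0 * (\<integral>\<omega>. norm (?d \<omega>) \<partial>M) \<le> (\<integral>\<omega>. (norm (?Z k \<omega> - a0))\<^sup>2 \<partial>M) + 6 * CK\<^sup>2 * h" .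
qed

text \<open>Telescoping of \<open>dz_step\<close>. The bound depends on the horizon
  \<open>h * real N\<close> but neither on the mesh nor on \<theta>, so that \<theta> times the
  total variation vanishes with \<theta>.\<close>

lemma dz_total:
  assumes h: "0 < h" "h \<le> 1" and th: "0 \<le> \<theta>" "\<theta> \<le> 1/2" and x: "x \<in> K"
  shows "r0 * (\<Sum>k<N. \<integral>\<omega>. norm (dz \<theta> h x k \<omega>) \<partial>M) \<le> 4 * CK\<^sup>2 + 6 * CK\<^sup>2 * (h * real N)"
proof -
  let ?A = "\<lambda>k. \<integral>\<omega>. (norm (Z \<theta> h x k \<omega> - a0))\<^sup>2 \<partial>M"
  have "?A N + r0 * (\<Sum>k<N. \<integral>\<omega>. norm (dz \<theta> h x k \<omega>) \<partial>M) \<le> ?A 0 + 6 * CK\<^sup>2 * (h * real N)"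
  proof (induction N)
    case (Suc N)
    then show ?case using dz_step(3)[OF assms, of N] by (simp add: algebra_simps del: Z.simps)
  qed simp
  moreover have "?A 0 \<le> 4 * CK\<^sup>2"
    using power_mono[OF K_diff_bound[OF x a0_in_K] norm_ge_zero, of 2] by (simp add: prob_space power_mult_distrib)
  moreover have "0 \<le> ?A N" by simp
  ultimately show ?thesis by linarith
qed

definition frozen :: "real^'d \<Rightarrow> real \<Rightarrow> nat \<Rightarrow> 'a \<Rightarrow> real^'d" where
  "frozen x h k \<omega> = X x (h * real k) \<omega> - residual x h k \<omega>"

lemma frozen_0: "x \<in> K \<Longrightarrow> \<omega> \<in> space M \<Longrightarrow> frozen x h 0 \<omega> = x"
  by (simp add: frozen_def residual_def ito_sum_def \<eta>_0)

text \<open>Without \<open>residual\<close> the solution obeys an exact recursion of the same form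
  as the scheme, with the increment of \<open>\<eta>\<close> in place of \<open>dz\<close>. The
  coefficients are still evaluated at \<open>X\<close>, not at \<open>frozen\<close>.\<close>

lemma frozen_Suc: "frozen x h (Suc k) \<omega> = frozen x h k \<omega> + h *\<^sub>R b (X x (h * real k) \<omega>)
   + \<sigma> (X x (h * real k) \<omega>) *v (B (h * real (Suc k)) \<omega> - B (h * real k) \<omega>)
   - (\<eta> x (h * real (Suc k)) \<omega> - \<eta> x (h * real k) \<omega>)"
  by (simp add: frozen_def residual_def ito_sum_def dsum_Suc)

text \<open>The modulus of continuity is taken along the path stopped at \<open>h * k\<close>, which makes the good events adapted.\<close>

definition good :: "real^'d \<Rightarrow> real \<Rightarrow> real \<Rightarrow> real \<Rightarrow> nat \<Rightarrow> 'a set" where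
  "good x \<rho> T h k = {\<omega>\<in>space M. (\<forall>j\<le>k. norm (residual x h j \<omega>) \<le> \<rho>) \<and> osc (\<lambda>u. \<phi> (X x (min u (h * real k)) \<omega>)) T h \<le> \<rho>}"

context
  fixes x assumes x: "x \<in> K"
begin

lemma good_measurable:
  assumes "0 \<le> T" "0 \<le> h"
  shows "good x \<rho> T h k \<in> sets (F (h * real k))"
proof -
  have 1: "(\<lambda>\<omega>. osc (\<lambda>u. \<phi> (X x (min u (h * real k)) \<omega>)) T h) \<in> borel_measurable (F (h * real k))"
  proof (rule osc_measurable)
    show "(\<lambda>\<omega>. \<phi> (X x (min t (h * real k)) \<omega>)) \<in> borel_measurable (F (h * real k))" if "0 \<le> t" for t
      using that assms by (intro measurable_compose[OF X_measurable[OF x] \<phi>_measurable]) auto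
    show "continuous_on {0..} (\<lambda>t. \<phi> (X x (min t (h * real k)) \<omega>))" if "\<omega> \<in> space (F (h * real k))" for \<omega>
      by (rule continuous_on_compose2[OF \<phi>_continuous continuous_on_compose2[OF X_continuous[OF x], where f="\<lambda>t. min t (h * real k)"]])
         (use that assms in \<open>auto intro!: continuous_intros\<close>)
    show "dist (\<phi> (X x (min u (h * real k)) \<omega>)) (\<phi> (X x (min v (h * real k)) \<omega>)) \<le> CK"
      if "\<omega> \<in> space (F (h * real k))" "0 \<le> u" "0 \<le> v" for \<omega> u v
      using that assms by (intro CK X_in_K[OF x]) auto
  qed (use assms in auto)
  have 2: "residual x h j \<in> borel_measurable (F (h * real k))" if "j \<le> k" for j
    using assms that by (intro measurable_F_mono[OF residual_measurable[OF x]] mult_left_mono) auto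
  have "good x \<rho> T h k = {\<omega>\<in>space (F (h * real k)). (\<forall>j\<in>{..k}. norm (residual x h j \<omega>) \<le> \<rho>)} \<inter> {\<omega>\<in>space (F (h * real k)). osc (\<lambda>u. \<phi> (X x (min u (h * real k)) \<omega>)) T h \<le> \<rho>}"
    by (auto simp: good_def)
  also have "\<dots> \<in> sets (F (h * real k))"
  proof (rule sets.Int)
    show "{\<omega>\<in>space (F (h * real k)). (\<forall>j\<in>{..k}. norm (residual x h j \<omega>) \<le> \<rho>)} \<in> sets (F (h * real k))"
    proof (rule sets.sets_Collect_finite_All')
      fix j assume "j \<in> {..k}"
      then have [measurable]: "residual x h j \<in> borel_measurable (F (h * real k))" by (intro 2) auto
      show "{\<omega>\<in>space (F (h * real k)). norm (residual x h j \<omega>) \<le> \<rho>} \<in> sets (F (h * real k))" by measurable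
    qed auto
    show "{\<omega>\<in>space (F (h * real k)). osc (\<lambda>u. \<phi> (X x (min u (h * real k)) \<omega>)) T h \<le> \<rho>} \<in> sets (F (h * real k))"
      using 1 by measurable
  qed
  finally show ?thesis .
qed

lemma good_measurable_M: "0 \<le> T \<Longrightarrow> 0 \<le> h \<Longrightarrow> good x \<rho> T h k \<in> events"
  using good_measurable sets_F_subset by blast

text \<open>Stopping contracts the time axis: \<open>min u s\<close> and \<open>min v s\<close> are
  two times in \<open>{0..T}\<close> no farther apart than \<open>u\<close> and \<open>v\<close>,
  and stopping at the later \<open>t\<close> does not affect them.\<close>

lemma osc_stopped_mono:
  assumes w: "\<omega> \<in> space M" and T: "0 \<le> T" "0 \<le> h" and st: "0 \<le> s" "s \<le> t"
  shows "osc (\<lambda>u. \<phi> (X x (min u s) \<omega>)) T h \<le> osc (\<lambda>u. \<phi> (X x (min u t) \<omega>)) T h"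
proof (rule osc_least)
  fix u v assume uv: "u \<in> {0..T}" "v \<in> {0..T}" "\<bar>u - v\<bar> \<le> h"
  have "dist (\<phi> (X x (min (min u s) t) \<omega>)) (\<phi> (X x (min (min v s) t) \<omega>)) \<le> osc (\<lambda>u. \<phi> (X x (min u t) \<omega>)) T h"
    by (rule osc_upper[where y="\<lambda>u. \<phi> (X x (min u t) \<omega>)" and c=CK]) (use w uv st in \<open>auto intro!: CK X_in_K[OF x]\<close>)
  then show "dist (\<phi> (X x (min u s) \<omega>)) (\<phi> (X x (min v s) \<omega>)) \<le> osc (\<lambda>u. \<phi> (X x (min u t) \<omega>)) T h"
    using st by (simp add: min.assoc min.absorb1)
qed (use T in auto)

lemma good_antimono: "0 \<le> T \<Longrightarrow> 0 \<le> h \<Longrightarrow> good x \<rho> T h (Suc k) \<subseteq> good x \<rho> T h k"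
  unfolding good_def using osc_stopped_mono[of _ T h "h * real k" "h * real (Suc k)"]
  by (auto simp: mult_left_mono intro: order_trans)

lemma good_complement:
  assumes "0 \<le> T" "0 \<le> h" "\<omega> \<in> space M" "\<omega> \<notin> good x \<rho> T h N"
  shows "(\<exists>k\<le>N. \<rho> < norm (residual x h k \<omega>)) \<or> \<rho> < modulus x T h \<omega>"
proof -
  have "osc (\<lambda>u. \<phi> (X x (min u (h * real N)) \<omega>)) T h \<le> osc (\<lambda>u. \<phi> (X x (min u (max T (h * real N))) \<omega>)) T h"
    using assms by (intro osc_stopped_mono) auto
  also have "\<dots> = modulus x T h \<omega>"
    unfolding modulus_def osc_def by (intro SUP_cong refl) (auto simp: osc_set_def min_def max_def)
  finally show ?thesis using assms(3,4) unfolding good_def by (auto simp: not_le)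
qed

text \<open>A point within \<rho> of \<open>X x u \<omega> - ?c\<close> differs from the scheme by
  three terms of size at most \<rho>: the movement of the path within the step, the residual, and
  the distance to the centre of that ball. As \<rho> is a quarter of \<open>\<theta> * r0\<close>,
  the point lies in \<open>K\<close> by \<open>Kt_ball\<close>, and
  \<open>reflection_increment\<close> applies to the random vector \<open>?c\<close>. The difference
  is taken at the right end of the step, where the projection acts as well.\<close>

lemma good_reflection:
  assumes h: "0 < h" and th: "0 < \<theta>" "\<theta> \<le> 1" and \<rho>: "\<rho> = \<theta> * r0 / 4"
  shows "AE \<omega> in M. \<forall>k. h * real (Suc k) \<le> T \<longrightarrow> \<omega> \<in> good x \<rho> T h (Suc k) \<longrightarrow>
    0 \<le> (frozen x h (Suc k) \<omega> - Z \<theta> h x (Suc k) \<omega>) \<bullet> (\<eta> x (h * real (Suc k)) \<omega> - \<eta> x (h * real k) \<omega>)"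
proof -
  have "AE \<omega> in M. \<forall>k. \<forall>t>h * real k. \<forall>c. \<forall>r>0. (\<forall>u\<in>{h * real k..t}. ball (X x u \<omega> - c) r \<subseteq> K) \<longrightarrow> 0 \<le> c \<bullet> (\<eta> x t \<omega> - \<eta> x (h * real k) \<omega>)"
    unfolding AE_all_countable using h by (intro allI reflection_increment[OF x]) auto
  then show ?thesis
  proof (rule AE_mp, intro AE_I2 impI allI)
    fix \<omega> k assume w: "\<omega> \<in> space M" and T: "h * real (Suc k) \<le> T" and g: "\<omega> \<in> good x \<rho> T h (Suc k)"
      and *: "\<forall>k. \<forall>t>h * real k. \<forall>c. \<forall>r>0. (\<forall>u\<in>{h * real k..t}. ball (X x u \<omega> - c) r \<subseteq> K) \<longrightarrow> 0 \<le> c \<bullet> (\<eta> x t \<omega> - \<eta> x (h * real k) \<omega>)"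
    let ?c = "frozen x h (Suc k) \<omega> - Z \<theta> h x (Suc k) \<omega>"
    have lt: "h * real k < h * real (Suc k)" "0 \<le> h * real k" using h by auto
    have len: "h * real (Suc k) - h * real k = h" by (simp add: algebra_simps)
    have \<rho>0: "0 < \<rho>" unfolding \<rho> using th r0_pos by simp
    have "ball (X x u \<omega> - ?c) \<rho> \<subseteq> K" if u: "u \<in> {h * real k..h * real (Suc k)}" for u
    proof
      fix y assume y: "y \<in> ball (X x u \<omega> - ?c) \<rho>"
      let ?v = "(X x u \<omega> - X x (h * real (Suc k)) \<omega>) + residual x h (Suc k) \<omega> + (y - (X x u \<omega> - ?c))"
      have eq: "y = Z \<theta> h x (Suc k) \<omega> + ?v" by (simp add: frozen_def)
      have "dist (\<phi> (X x (min u (h * real (Suc k))) \<omega>)) (\<phi> (X x (min (h * real (Suc k)) (h * real (Suc k))) \<omega>)) \<le> osc (\<lambda>u. \<phi> (X x (min u (h * real (Suc k))) \<omega>)) T h"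
      proof (rule osc_upper[where y="\<lambda>u. \<phi> (X x (min u (h * real (Suc k))) \<omega>)" and c=CK])
        show "u \<in> {0..T}" "h * real (Suc k) \<in> {0..T}" using u lt T by auto
        show "\<bar>u - h * real (Suc k)\<bar> \<le> h" using u len by auto
      qed (use w lt in \<open>auto intro!: CK X_in_K[OF x]\<close>)
      also have "\<dots> \<le> \<rho>" using g unfolding good_def by blast
      finally have "dist (\<phi> (X x u \<omega>)) (\<phi> (X x (h * real (Suc k)) \<omega>)) \<le> \<rho>" using u by (simp add: min_def del: of_nat_Suc split: if_splits)
      then have 1: "norm (X x u \<omega> - X x (h * real (Suc k)) \<omega>) \<le> \<rho>"
        using dist_\<phi>(1) order_trans unfolding dist_norm[symmetric] by blast
      have 2: "norm (residual x h (Suc k) \<omega>) \<le> \<rho>" using g unfolding good_def by blast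
      have 3: "norm (y - (X x u \<omega> - ?c)) \<le> \<rho>" using y by (simp add: dist_norm norm_minus_commute del: Z.simps)
      have "norm ?v \<le> \<rho> + \<rho> + \<rho>" by (rule norm_triangle_mono[OF norm_triangle_mono[OF 1 2] 3])
      also have "\<dots> \<le> \<theta> * r0" using \<rho>0 \<rho> by simp
      finally have "Z \<theta> h x (Suc k) \<omega> + ?v \<in> K"
        using th by (intro Kt_ball) (auto simp: step_in_Kt)
      then show "y \<in> K" using eq by metis
    qed
    then show "0 \<le> ?c \<bullet> (\<eta> x (h * real (Suc k)) \<omega> - \<eta> x (h * real k) \<omega>)"
      using * lt \<rho>0 by blast
  qed
qed

end

end

lemma (in prob_space) expectation_le_sqrt:
  fixes Y :: "'a \<Rightarrow> real"
  assumes "Y \<in> borel_measurable M" "integrable M (\<lambda>\<omega>. (Y \<omega>)\<^sup>2)"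
  shows "integrable M Y" "expectation Y \<le> sqrt (expectation (\<lambda>\<omega>. (Y \<omega>)\<^sup>2))"
proof -
  show i: "integrable M Y"
  proof (rule Bochner_Integration.integrable_bound)
    show "integrable M (\<lambda>\<omega>. 1 + (Y \<omega>)\<^sup>2)" using assms(2) by simp
    show "AE \<omega> in M. norm (Y \<omega>) \<le> norm (1 + (Y \<omega>)\<^sup>2)"
    proof (rule AE_I2)
      fix \<omega>
      have "2 * \<bar>Y \<omega>\<bar> \<le> 1 + (Y \<omega>)\<^sup>2" using sum_squares_bound[of 1 "\<bar>Y \<omega>\<bar>"] by simp
      then show "norm (Y \<omega>) \<le> norm (1 + (Y \<omega>)\<^sup>2)" by simp
    qed
  qed (use assms in auto)
  have "0 \<le> variance Y" by simp
  then have "(expectation Y)\<^sup>2 \<le> expectation (\<lambda>\<omega>. (Y \<omega>)\<^sup>2)" using variance_eq[OF i assms(2)] by simp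
  then show "expectation Y \<le> sqrt (expectation (\<lambda>\<omega>. (Y \<omega>)\<^sup>2))" by (rule real_le_rsqrt)
qed

section \<open>Error of the scheme on the good events, and its convergence\<close>

context reflected_sde
begin

definition good_error :: "real^'d \<Rightarrow> real \<Rightarrow> real \<Rightarrow> real \<Rightarrow> nat \<Rightarrow> 'a \<Rightarrow> real" where
  "good_error x \<theta> T h k \<omega> = indicator (good x (\<theta> * r0 / 4) T h k) \<omega> * (norm (frozen x h k \<omega> - Z \<theta> h x k \<omega>))\<^sup>2"

text \<open>The coefficient of \<theta> in the total error: the drift terms over the horizon
  \<open>T\<close>, plus \<open>8 * CK\<close> times the variation bound of
  \<open>dz_total\<close>.\<close>

definition C2 :: "real \<Rightarrow> real" where
  "C2 T = 8 * CK\<^sup>2 * T + 8 * CK * (4 * CK\<^sup>2 + 6 * CK\<^sup>2 * T) / r0"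

context
  fixes x assumes x: "x \<in> K"
begin

lemma frozen_measurable: "0 \<le> h \<Longrightarrow> frozen x h k \<in> borel_measurable (F (h * real k))"
proof -
  assume h: "0 \<le> h"
  have [measurable]: "X x (h * real k) \<in> borel_measurable (F (h * real k))" using h by (intro X_measurable[OF x]) auto
  note [measurable] = residual_measurable[OF x h, of k]
  show ?thesis unfolding frozen_def[abs_def] by measurable
qed

lemma D_bound:
  assumes h: "0 \<le> h" and th: "0 < \<theta>" "\<theta> \<le> 1" and g: "\<omega> \<in> good x \<rho> T h k"
  shows "norm (frozen x h k \<omega> - Z \<theta> h x k \<omega>) \<le> 2 * CK + \<rho>"
proof -
  have w: "\<omega> \<in> space M" and m: "norm (residual x h k \<omega>) \<le> \<rho>" using g by (auto simp: good_def)
  have "norm (X x (h * real k) \<omega> - Z \<theta> h x k \<omega>) \<le> 2 * CK" using w h th by (intro K_diff_bound X_in_K[OF x] Z_in_K x) auto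
  then have "norm ((X x (h * real k) \<omega> - Z \<theta> h x k \<omega>) - residual x h k \<omega>) \<le> 2 * CK + \<rho>"
    using m norm_triangle_ineq4[of "X x (h * real k) \<omega> - Z \<theta> h x k \<omega>" "residual x h k \<omega>"] by linarith
  then show ?thesis by (simp add: frozen_def algebra_simps)
qed

text \<open>Serves to absorb the tolerance \<open>\<theta> * r0 / 4\<close> into
  \<open>CK * \<theta>\<close>.\<close>

lemma r0_le: "r0 \<le> 2 * CK"
proof -
  obtain v :: "real^'d" where v: "norm v = r0" using vector_choose_size[of r0] r0_pos by auto
  have "a0 + v \<in> K" using r0_ball v by (auto simp: dist_norm)
  from K_diff_bound[OF this a0_in_K] v show ?thesis by simp
qed

lemma good_error_measurable_M:
  assumes "0 \<le> T" "0 \<le> h"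
  shows "good_error x \<theta> T h k \<in> borel_measurable M"
proof -
  note [measurable] = good_measurable_M[OF x assms] Z_measurable_M[OF assms(2)] measurable_F_M[OF frozen_measurable[OF assms(2)]]
  show ?thesis unfolding good_error_def[abs_def] by measurable
qed

lemma good_error_integrable:
  assumes "0 \<le> T" "0 \<le> h" "0 < \<theta>" "\<theta> \<le> 1"
  shows "integrable M (good_error x \<theta> T h k)"
proof (rule integrable_const_bound[where B="(2 * CK + \<theta> * r0 / 4)\<^sup>2"])
  show "AE \<omega> in M. norm (good_error x \<theta> T h k \<omega>) \<le> (2 * CK + \<theta> * r0 / 4)\<^sup>2"
    unfolding good_error_def using assms by (auto intro!: AE_I2 power_mono D_bound simp: indicator_def)
  show "good_error x \<theta> T h k \<in> borel_measurable M" by (rule good_error_measurable_M[OF assms(1,2)])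
qed

lemma good_error_0:
  assumes "0 \<le> T" "0 \<le> h" shows "(\<integral>\<omega>. good_error x \<theta> T h 0 \<omega> \<partial>M) = 0"
proof -
  have "(\<integral>\<omega>. good_error x \<theta> T h 0 \<omega> \<partial>M) = (\<integral>\<omega>. 0 \<partial>M)"
    by (rule Bochner_Integration.integral_cong) (auto simp: good_error_def frozen_0[OF x])
  then show ?thesis by simp
qed

text \<open>Before reflection and projection the two recursions differ by
  \<open>?D (Suc k) \<omega> + (?e - ?d \<omega>)\<close>. In its square the product of
  \<open>?D\<close> with the increment \<open>?e\<close> of \<open>\<eta>\<close> is nonnegative by
  \<open>good_reflection\<close>, the product with \<open>?d\<close> costs order \<theta>, and the
  whole is bounded in mean by dissipativity. The indicator put on \<open>v\<close> and
  \<open>H\<close> has index \<open>k\<close>, to be known before the increment; on the smaller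
  event of index \<open>Suc k\<close> it equals 1.\<close>

lemma good_error_step:
  assumes h: "0 < h" "h \<le> 1" and th: "0 < \<theta>" "\<theta> \<le> 1/2" and T: "h * real (Suc k) \<le> T"
  shows "(\<integral>\<omega>. good_error x \<theta> T h (Suc k) \<omega> \<partial>M) \<le> (\<integral>\<omega>. good_error x \<theta> T h k \<omega> \<partial>M)
     + h * (8 * CK\<^sup>2 * \<theta> + 4 * CK\<^sup>2 * h) + 8 * CK * \<theta> * (\<integral>\<omega>. norm (dz \<theta> h x k \<omega>) \<partial>M)"
proof -
  define \<rho> where "\<rho> = \<theta> * r0 / 4"
  have \<rho>: "0 \<le> \<rho>" "\<rho> \<le> CK * \<theta>" using th r0_pos r0_le CK_pos unfolding \<rho>_def by (auto simp: field_simps)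
  have T0: "0 \<le> T" using T h by (smt (verit) mult_nonneg_nonneg of_nat_0_le_iff)
  let ?G = "good x \<rho> T h" and ?Z = "Z \<theta> h x" and ?X = "\<lambda>\<omega>. X x (h * real k) \<omega>" and ?d = "dz \<theta> h x k"
  let ?D = "\<lambda>k \<omega>. frozen x h k \<omega> - ?Z k \<omega>"
  let ?\<Delta> = "\<lambda>\<omega>. B (h * real (Suc k)) \<omega> - B (h * real k) \<omega>"
  define v where "v \<omega> = indicat_real (?G k) \<omega> *\<^sub>R (?D k \<omega> + h *\<^sub>R (b (?X \<omega>) - b (?Z k \<omega>)))" for \<omega>
  define H where "H \<omega> = indicat_real (?G k) \<omega> *\<^sub>R (\<sigma> (?X \<omega>) - \<sigma> (?Z k \<omega>))" for \<omega>
  let ?p = "\<lambda>\<omega>. good_error x \<theta> T h k \<omega> + h * (8 * CK\<^sup>2 * \<theta> + 4 * CK\<^sup>2 * h)"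
  have h0: "0 \<le> h" using h by simp
  have th1: "\<theta> \<le> 1" using th by simp
  have XK: "?X \<omega> \<in> K" if "\<omega> \<in> space M" for \<omega> using that h by (intro X_in_K[OF x]) auto
  have ZK: "?Z j \<omega> \<in> K" for j \<omega> using th by (intro Z_in_K x) auto
  have [measurable]: "?G k \<in> sets (F (h * real k))" "frozen x h k \<in> borel_measurable (F (h * real k))"
    "?Z k \<in> borel_measurable (F (h * real k))" "?X \<in> borel_measurable (F (h * real k))"
    using h by (auto intro!: good_measurable[OF x T0] frozen_measurable Z_measurable X_measurable[OF x])
  have vm: "v \<in> borel_measurable (F (h * real k))" unfolding v_def[abs_def] by measurable
  have Hm: "H \<in> borel_measurable (F (h * real k))" unfolding H_def[abs_def] by measurable
  have vb: "norm (v \<omega>) \<le> 4 * CK + \<rho>" if w: "\<omega> \<in> space M" for \<omega>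
  proof (cases "\<omega> \<in> ?G k")
    case True
    have "norm (h *\<^sub>R (b (?X \<omega>) - b (?Z k \<omega>))) \<le> 1 * (2 * CK)"
      unfolding norm_scaleR using h by (intro mult_mono b_diff_bound XK w ZK) auto
    from norm_triangle_mono[OF D_bound[OF h0 th(1) th1 True] this] True show ?thesis by (simp add: v_def)
  qed (use CK_pos \<rho> in \<open>simp add: v_def\<close>)
  have Hb: "norm (H \<omega>) \<le> 4 * CK + \<rho>" if w: "\<omega> \<in> space M" for \<omega>
    using \<sigma>_diff_bound[OF XK[OF w] ZK, of k \<omega>] CK_pos \<rho>(1) by (cases "\<omega> \<in> ?G k") (auto simp: H_def)
  have le: "(norm (v \<omega>))\<^sup>2 + h * (norm (H \<omega>))\<^sup>2 \<le> ?p \<omega>" if w: "\<omega> \<in> space M" for \<omega>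
  proof (cases "\<omega> \<in> ?G k")
    case True
    let ?db = "b (?X \<omega>) - b (?Z k \<omega>)" and ?ds = "\<sigma> (?X \<omega>) - \<sigma> (?Z k \<omega>)"
    have m: "norm (residual x h k \<omega>) \<le> \<rho>" using True by (auto simp: good_def)
    \<comment> \<open>Dissipativity concerns the pair \<open>X\<close>, \<open>Z\<close>, while
      \<open>?D\<close> contains \<open>frozen\<close>; the mismatch is the residual, of size at
      most \<rho>.\<close>
    have "?D k \<omega> \<bullet> ?db = (?X \<omega> - ?Z k \<omega>) \<bullet> ?db - residual x h k \<omega> \<bullet> ?db"
      by (simp add: frozen_def inner_diff_left)
    moreover have "(norm ?ds)\<^sup>2 + 2 * ((?X \<omega> - ?Z k \<omega>) \<bullet> ?db) \<le> 0"
    proof -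
      have "0 \<le> \<delta> * (norm (?X \<omega> - ?Z k \<omega>))\<^sup>2" using delta_pos by simp
      then show ?thesis using dissipative[of "?X \<omega>" "?Z k \<omega>"] by linarith
    qed
    moreover have "- (residual x h k \<omega> \<bullet> ?db) \<le> (CK * \<theta>) * (2 * CK)"
    proof -
      have "- (residual x h k \<omega> \<bullet> ?db) \<le> norm (residual x h k \<omega>) * norm ?db" using Cauchy_Schwarz_ineq2[of "residual x h k \<omega>" ?db] by linarith
      also have "\<dots> \<le> (CK * \<theta>) * (2 * CK)" using m \<rho> CK_pos th by (intro mult_mono b_diff_bound XK w ZK) auto
      finally show ?thesis .
    qed
    moreover have "4 * CK\<^sup>2 * \<theta> = 2 * ((CK * \<theta>) * (2 * CK))" by (simp add: power2_eq_square)
    ultimately have 1: "2 * (?D k \<omega> \<bullet> ?db) + (norm ?ds)\<^sup>2 \<le> 4 * CK\<^sup>2 * \<theta>" by linarith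
    have "(norm ?db)\<^sup>2 \<le> (2 * CK)\<^sup>2" by (intro power_mono b_diff_bound XK w ZK) auto
    then have 2: "h\<^sup>2 * (norm ?db)\<^sup>2 \<le> h\<^sup>2 * (4 * CK\<^sup>2)" by (intro mult_left_mono) (auto simp: power_mult_distrib)
    have "(norm (v \<omega>))\<^sup>2 + h * (norm (H \<omega>))\<^sup>2 = (norm (?D k \<omega>))\<^sup>2 + h * (2 * (?D k \<omega> \<bullet> ?db) + (norm ?ds)\<^sup>2) + h\<^sup>2 * (norm ?db)\<^sup>2"
      using True norm_add_scaleR_power2[of "?D k \<omega>" h ?db] by (simp add: v_def H_def algebra_simps)
    also have "\<dots> \<le> (norm (?D k \<omega>))\<^sup>2 + h * (4 * CK\<^sup>2 * \<theta>) + h\<^sup>2 * (4 * CK\<^sup>2)"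
      using mult_left_mono[OF 1 h0] 2 by linarith
    also have "\<dots> \<le> (norm (?D k \<omega>))\<^sup>2 + h * (8 * CK\<^sup>2 * \<theta> + 4 * CK\<^sup>2 * h)"
      using h0 th by (simp add: algebra_simps power2_eq_square)
    also have "\<dots> = ?p \<omega>" using True by (simp add: good_error_def \<rho>_def)
    finally show ?thesis .
  next
    case False
    have "0 \<le> h * (8 * CK\<^sup>2 * \<theta> + 4 * CK\<^sup>2 * h)" using h th by simp
    then show ?thesis using False by (simp add: v_def H_def good_error_def \<rho>_def)
  qed
  have pi: "integrable M ?p" using good_error_integrable[OF T0 h0 th(1) th1] by simp
  then have pm: "?p \<in> borel_measurable M" by simp
  note O = one_step_scheme[OF h(1) vm vb Hm Hb pm pi le]
  note di = dz_step(1)[OF h less_imp_le[OF th(1)] th(2) x, of k]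
  have AE: "AE \<omega> in M. good_error x \<theta> T h (Suc k) \<omega> \<le> (norm (v \<omega> + H \<omega> *v ?\<Delta> \<omega>))\<^sup>2 + 8 * CK * \<theta> * norm (?d \<omega>)"
    using good_reflection[OF x h(1) th(1) th1 \<rho>_def, of T] AE_space
  proof eventually_elim
    case (elim \<omega>)
    then have w: "\<omega> \<in> space M" by simp
    show ?case
    proof (cases "\<omega> \<in> ?G (Suc k)")
      case True
      then have g: "\<omega> \<in> ?G k" using good_antimono[OF x T0 h0] by blast
      let ?e = "\<eta> x (h * real (Suc k)) \<omega> - \<eta> x (h * real k) \<omega>"
      have refl: "0 \<le> ?D (Suc k) \<omega> \<bullet> ?e" using elim(1) T True by blast
      have A: "v \<omega> + H \<omega> *v ?\<Delta> \<omega> = ?D (Suc k) \<omega> + (?e - ?d \<omega>)"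
        using g by (simp add: v_def H_def frozen_Suc dz_def drift_step_def matrix_vector_mult_diff_rdistrib algebra_simps del: Z.simps of_nat_Suc)
      have "(norm (?D (Suc k) \<omega>))\<^sup>2 + 2 * (?D (Suc k) \<omega> \<bullet> ?e) - 2 * (?D (Suc k) \<omega> \<bullet> ?d \<omega>) \<le> (norm (v \<omega> + H \<omega> *v ?\<Delta> \<omega>))\<^sup>2"
        unfolding A using norm_add_scaleR_power2[of "?D (Suc k) \<omega>" 1 "?e - ?d \<omega>"] by (simp add: inner_diff_right del: Z.simps of_nat_Suc)
      moreover have "?D (Suc k) \<omega> \<bullet> ?d \<omega> \<le> 4 * CK * \<theta> * norm (?d \<omega>)"
      proof -
        let ?X' = "X x (h * real (Suc k)) \<omega>"
        have X'K: "?X' \<in> K" using w h by (intro X_in_K[OF x]) auto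
        \<comment> \<open>The partner of the solution in \<open>Kt \<theta>\<close>, against which
          \<open>dz_normal\<close> can be tested. It misses the solution by at most
          \<open>2 * CK * \<theta>\<close>, and the residual adds at most
          \<open>CK * \<theta>\<close>.\<close>
        let ?y = "(1 - \<theta>) *\<^sub>R ?X' + \<theta> *\<^sub>R a0"
        have "?y \<in> Kt \<theta>" unfolding Kt_def using X'K by blast
        then have "(?y - ?Z (Suc k) \<omega>) \<bullet> ?d \<omega> \<le> 0" by (rule dz_normal)
        moreover have eqD: "?D (Suc k) \<omega> = (?y - ?Z (Suc k) \<omega>) + (\<theta> *\<^sub>R (?X' - a0) - residual x h (Suc k) \<omega>)"
          by (simp add: frozen_def algebra_simps del: Z.simps of_nat_Suc)
        ultimately have "?D (Suc k) \<omega> \<bullet> ?d \<omega> \<le> (\<theta> *\<^sub>R (?X' - a0) - residual x h (Suc k) \<omega>) \<bullet> ?d \<omega>"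
          unfolding eqD inner_add_left by linarith
        also have "\<dots> \<le> norm (\<theta> *\<^sub>R (?X' - a0) - residual x h (Suc k) \<omega>) * norm (?d \<omega>)" by (rule norm_cauchy_schwarz)
        also have "\<dots> \<le> (4 * CK * \<theta>) * norm (?d \<omega>)"
        proof (rule mult_right_mono)
          have "norm (\<theta> *\<^sub>R (?X' - a0)) \<le> \<theta> * (2 * CK)"
            using th K_diff_bound[OF X'K a0_in_K] by (simp del: of_nat_Suc)
          moreover have "norm (residual x h (Suc k) \<omega>) \<le> \<rho>" using True unfolding good_def by blast
          ultimately have "norm (\<theta> *\<^sub>R (?X' - a0) - residual x h (Suc k) \<omega>) \<le> \<theta> * (2 * CK) + CK * \<theta>"
            using \<rho> norm_triangle_ineq4[of "\<theta> *\<^sub>R (?X' - a0)" "residual x h (Suc k) \<omega>"] by linarith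
          also have "\<dots> \<le> 4 * CK * \<theta>" using th CK_pos by simp
          finally show "norm (\<theta> *\<^sub>R (?X' - a0) - residual x h (Suc k) \<omega>) \<le> 4 * CK * \<theta>" .
        qed simp
        finally show ?thesis .
      qed
      ultimately show ?thesis using refl True by (simp add: good_error_def \<rho>_def del: Z.simps of_nat_Suc)
    next
      case False
      have "0 \<le> (norm (v \<omega> + H \<omega> *v ?\<Delta> \<omega>))\<^sup>2 + 8 * CK * \<theta> * norm (?d \<omega>)" using CK_pos th by (intro add_nonneg_nonneg) auto
      then show ?thesis using False by (simp add: good_error_def \<rho>_def del: Z.simps of_nat_Suc)
    qed
  qed
  have "(\<integral>\<omega>. good_error x \<theta> T h (Suc k) \<omega> \<partial>M) \<le> (\<integral>\<omega>. (norm (v \<omega> + H \<omega> *v ?\<Delta> \<omega>))\<^sup>2 + 8 * CK * \<theta> * norm (?d \<omega>) \<partial>M)"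
    by (rule integral_mono_AE[OF good_error_integrable[OF T0 h0 th(1) th1] _ AE]) (use O(1) di in auto)
  also have "\<dots> = (\<integral>\<omega>. (norm (v \<omega> + H \<omega> *v ?\<Delta> \<omega>))\<^sup>2 \<partial>M) + 8 * CK * \<theta> * (\<integral>\<omega>. norm (?d \<omega>) \<partial>M)"
    using O(1) di by simp
  also have "\<dots> \<le> (\<integral>\<omega>. ?p \<omega> \<partial>M) + 8 * CK * \<theta> * (\<integral>\<omega>. norm (?d \<omega>) \<partial>M)" using O(2) by simp
  also have "(\<integral>\<omega>. ?p \<omega> \<partial>M) = (\<integral>\<omega>. good_error x \<theta> T h k \<omega> \<partial>M) + h * (8 * CK\<^sup>2 * \<theta> + 4 * CK\<^sup>2 * h)"
    using good_error_integrable[OF T0 h0 th(1) th1] by (simp add: prob_space)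
  finally show ?thesis .
qed

lemma good_error_total:
  assumes h: "0 < h" "h \<le> 1" and th: "0 < \<theta>" "\<theta> \<le> 1/2" and T: "h * real N = T"
  shows "(\<integral>\<omega>. good_error x \<theta> T h N \<omega> \<partial>M) \<le> C2 T * \<theta> + 4 * CK\<^sup>2 * T * h"
proof -
  let ?E = "\<lambda>k. \<integral>\<omega>. good_error x \<theta> T h k \<omega> \<partial>M" and ?S = "\<lambda>k. \<Sum>j<k. \<integral>\<omega>. norm (dz \<theta> h x j \<omega>) \<partial>M"
  have T0: "0 \<le> T" using T h by auto
  have "k \<le> N \<Longrightarrow> ?E k \<le> h * real k * (8 * CK\<^sup>2 * \<theta> + 4 * CK\<^sup>2 * h) + 8 * CK * \<theta> * ?S k" for k
  proof (induction k)
    case 0 then show ?case using good_error_0[OF T0 less_imp_le[OF h(1)]] by simp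
  next
    case (Suc k)
    have "h * real (Suc k) \<le> T" unfolding T[symmetric] using Suc.prems h by (intro mult_left_mono) auto
    from good_error_step[OF h th this] Suc show ?case by (simp add: algebra_simps)
  qed
  from this[of N] have "?E N \<le> T * (8 * CK\<^sup>2 * \<theta> + 4 * CK\<^sup>2 * h) + 8 * CK * \<theta> * ?S N" using T by simp
  moreover have "?S N \<le> (4 * CK\<^sup>2 + 6 * CK\<^sup>2 * T) / r0"
    using dz_total[OF h less_imp_le[OF th(1)] th(2) x, of N] T r0_pos by (simp add: field_simps)
  then have "8 * CK * \<theta> * ?S N \<le> 8 * CK * \<theta> * ((4 * CK\<^sup>2 + 6 * CK\<^sup>2 * T) / r0)" using CK_pos th by (intro mult_left_mono) auto
  ultimately show ?thesis unfolding C2_def by (simp add: algebra_simps)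
qed

lemma X_Z_integrable:
  assumes "0 \<le> t" "0 \<le> h" "0 \<le> \<theta>" "\<theta> \<le> 1"
  shows "integrable M (\<lambda>\<omega>. norm (X x t \<omega> - Z \<theta> h x k \<omega>))"
proof -
  note [measurable] = Z_measurable_M[OF assms(2)] X_measurable_M[OF x assms(1)]
  show ?thesis
    by (rule integrable_const_bound[where B="2 * CK"]) (use assms in \<open>auto intro!: AE_I2 K_diff_bound X_in_K[OF x] Z_in_K x\<close>)
qed

text \<open>On the good event the distance splits into the residual and the distance from
  \<open>frozen\<close> to the scheme, known in mean square. On the complement the diameter bound
  \<open>2 * CK\<close> is paid with its probability.\<close>

lemma X_Z_bound:
  assumes T: "0 < T" and N: "0 < N" "T / real N \<le> 1" and th: "0 < \<theta>" "\<theta> \<le> 1/2"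
  shows "(\<integral>\<omega>. norm (X x T \<omega> - Z \<theta> (T / real N) x N \<omega>) \<partial>M)
    \<le> sqrt (C2 T * \<theta> + 4 * CK\<^sup>2 * T * (T / real N)) + CK * \<theta>
      + 2 * CK * prob {\<omega>\<in>space M. (\<exists>k\<le>N. \<theta> * r0 / 4 < norm (residual x (T / real N) k \<omega>)) \<or> \<theta> * r0 / 4 < modulus x T (T / real N) \<omega>}"
proof -
  let ?h = "T / real N"
  define \<rho> where "\<rho> = \<theta> * r0 / 4"
  have \<rho>: "0 \<le> \<rho>" "\<rho> \<le> CK * \<theta>" using th r0_pos r0_le CK_pos unfolding \<rho>_def by (auto simp: field_simps)
  have h: "0 < ?h" "0 \<le> ?h" "?h * real N = T" using T N by auto
  have th1: "\<theta> \<le> 1" "0 \<le> \<theta>" using th by auto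
  let ?G = "good x \<rho> T ?h N" and ?Z = "Z \<theta> ?h x N"
  let ?Bad = "{\<omega>\<in>space M. (\<exists>k\<le>N. \<rho> < norm (residual x ?h k \<omega>)) \<or> \<rho> < modulus x T ?h \<omega>}"
  note G[measurable] = good_measurable_M[OF x less_imp_le[OF T] h(2), of \<rho> N]
  have [measurable]: "residual x ?h k \<in> borel_measurable M" "modulus x T ?h \<in> borel_measurable M" for k
    using h(2) T by (auto intro!: residual_measurable_M[OF x] modulus_measurable[OF x])
  have Bad[measurable]: "?Bad \<in> events" by measurable
  let ?Y = "\<lambda>\<omega>. indicator ?G \<omega> * norm (frozen x ?h N \<omega> - ?Z \<omega>)"
  have Y2: "(?Y \<omega>)\<^sup>2 = good_error x \<theta> T ?h N \<omega>" for \<omega>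
    by (simp add: good_error_def \<rho>_def indicator_def power_mult_distrib)
  note [measurable] = Z_measurable_M[OF h(2), of \<theta> x N] measurable_F_M[OF frozen_measurable[OF h(2)], of N]
  have Y: "integrable M ?Y" "expectation ?Y \<le> sqrt (expectation (\<lambda>\<omega>. (?Y \<omega>)\<^sup>2))"
    by (rule expectation_le_sqrt; use good_error_integrable[OF less_imp_le[OF T] h(2) th(1) th1(1), of N] in \<open>simp add: Y2[abs_def]\<close>)+
  have ptw: "norm (X x T \<omega> - ?Z \<omega>) \<le> ?Y \<omega> + CK * \<theta> + 2 * CK * indicator ?Bad \<omega>" if w: "\<omega> \<in> space M" for \<omega>
  proof (cases "\<omega> \<in> ?G")
    case True
    then have "norm (residual x ?h N \<omega>) \<le> CK * \<theta>" using \<rho> by (auto simp: good_def)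
    moreover have eqX: "X x T \<omega> - ?Z \<omega> = (frozen x ?h N \<omega> - ?Z \<omega>) + residual x ?h N \<omega>" using h(3) by (simp add: frozen_def)
    ultimately have "norm (X x T \<omega> - ?Z \<omega>) \<le> norm (frozen x ?h N \<omega> - ?Z \<omega>) + CK * \<theta>"
      using norm_triangle_ineq[of "frozen x ?h N \<omega> - ?Z \<omega>" "residual x ?h N \<omega>"] unfolding eqX by linarith
    moreover have "0 \<le> 2 * CK * indicator ?Bad \<omega>" using CK_pos by simp
    ultimately show ?thesis using True by simp
  next
    case False
    then have "\<omega> \<in> ?Bad" using good_complement[OF x less_imp_le[OF T] h(2) w] w by blast
    moreover have "norm (X x T \<omega> - ?Z \<omega>) \<le> 2 * CK" using T th1 by (intro K_diff_bound X_in_K[OF x] Z_in_K x w) auto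
    moreover have "0 \<le> CK * \<theta>" using CK_pos th by simp
    ultimately show ?thesis using False by simp
  qed
  have Bi: "integrable M (indicat_real ?Bad)"
    by (rule integrable_real_indicator[OF Bad]) (simp add: emeasure_eq_measure)
  have "(\<integral>\<omega>. norm (X x T \<omega> - ?Z \<omega>) \<partial>M) \<le> (\<integral>\<omega>. ?Y \<omega> + CK * \<theta> + 2 * CK * indicator ?Bad \<omega> \<partial>M)"
    by (rule integral_mono[OF X_Z_integrable[OF less_imp_le[OF T] h(2) th1(2,1)] _ ptw])
       (intro Bochner_Integration.integrable_add Y(1) integrable_const integrable_mult_right Bi)
  also have "\<dots> = expectation ?Y + CK * \<theta> + 2 * CK * prob ?Bad"
  proof -
    have "expectation (indicat_real ?Bad) = prob ?Bad"
      unfolding Bochner_Integration.integral_indicator sets.Int_space_eq2[OF Bad] ..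
    then show ?thesis
      unfolding Bochner_Integration.integral_add[OF Bochner_Integration.integrable_add[OF Y(1) integrable_const] integrable_mult_right[OF Bi]]
        Bochner_Integration.integral_add[OF Y(1) integrable_const] integral_mult_right_zero
      by (simp only: prob_space lebesgue_integral_const scaleR_one)
  qed
  also have "expectation ?Y \<le> sqrt (C2 T * \<theta> + 4 * CK\<^sup>2 * T * ?h)"
    using order_trans[OF Y(2) real_sqrt_le_mono[OF good_error_total[OF h(1) N(2) th h(3), folded Y2]]] by simp
  finally show ?thesis unfolding \<rho>_def by simp
qed

end

text \<open>The order of limits matters: first the mesh tends to \<open>0\<close>, then \<open>\<theta>\<close>.\<close>

lemma scheme_converges:
  assumes T: "0 < T" and e: "0 < e"
  obtains \<theta> where "0 < \<theta>" "\<theta> \<le> 1/2"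
    "\<And>x t. x \<in> K \<Longrightarrow> 0 < t \<Longrightarrow> t \<le> T \<Longrightarrow> \<forall>\<^sub>F N in sequentially. (\<integral>\<omega>. norm (X x t \<omega> - Z \<theta> (t / real N) x N \<omega>) \<partial>M) \<le> e"
proof -
  have "((\<lambda>\<theta>. sqrt (C2 T * \<theta>) + CK * \<theta>) \<longlongrightarrow> sqrt (C2 T * 0) + CK * 0) (at_right 0)"
    by (intro tendsto_intros)
  then have "\<forall>\<^sub>F \<theta> in at_right 0. sqrt (C2 T * \<theta>) + CK * \<theta> < e"
    using e by (intro order_tendstoD(2)) auto
  moreover have "\<forall>\<^sub>F \<theta> in at_right (0::real). \<theta> < 1/2" "\<forall>\<^sub>F \<theta> in at_right (0::real). 0 < \<theta>"
    by (auto simp: eventually_at_right_field intro: exI[of _ "1/2"] exI[of _ "1"])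
  ultimately have "\<forall>\<^sub>F \<theta> in at_right 0. 0 < \<theta> \<and> \<theta> < 1/2 \<and> sqrt (C2 T * \<theta>) + CK * \<theta> < e"
    by eventually_elim auto
  then obtain \<theta> where \<theta>: "0 < \<theta>" "\<theta> < 1/2" "sqrt (C2 T * \<theta>) + CK * \<theta> < e"
    using eventually_happens[of _ "at_right (0::real)"] by auto
  show ?thesis
  proof (rule that[of \<theta>])
    fix x t assume x: "x \<in> K" and t: "0 < t" "t \<le> T"
    \<comment> \<open>Monotonicity in the horizon lets one \<theta> serve all
      \<open>t \<le> T\<close>; \<open>semigroup_approx\<close> uses one scheme at several
      times.\<close>
    have C2: "C2 t \<le> C2 T" unfolding C2_def using t CK_pos r0_pos
      by (intro add_mono mult_left_mono divide_right_mono) auto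
    let ?P = "\<lambda>N. prob {\<omega>\<in>space M. (\<exists>k\<le>N. \<theta> * r0 / 4 < norm (residual x (t / real N) k \<omega>)) \<or> \<theta> * r0 / 4 < modulus x t (t / real N) \<omega>}"
    have "(\<lambda>N. sqrt (C2 T * \<theta> + 4 * CK\<^sup>2 * t * (t / real N)) + CK * \<theta> + 2 * CK * ?P N)
      \<longlonglongrightarrow> sqrt (C2 T * \<theta> + 4 * CK\<^sup>2 * t * 0) + CK * \<theta> + 2 * CK * 0"
      using \<theta> r0_pos by (intro tendsto_intros residual_bad_event[OF x t(1)] lim_const_over_n) auto
    then have 1: "\<forall>\<^sub>F N in sequentially. sqrt (C2 T * \<theta> + 4 * CK\<^sup>2 * t * (t / real N)) + CK * \<theta> + 2 * CK * ?P N < e"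
      using \<theta>(3) by (intro order_tendstoD(2)) auto
    have 2: "\<forall>\<^sub>F N in sequentially. t / real N < 1"
      by (rule order_tendstoD(2)[OF lim_const_over_n]) simp
    show "\<forall>\<^sub>F N in sequentially. (\<integral>\<omega>. norm (X x t \<omega> - Z \<theta> (t / real N) x N \<omega>) \<partial>M) \<le> e"
      using 1 2 eventually_gt_at_top[of 0]
    proof eventually_elim
      case (elim N)
      have "sqrt (C2 t * \<theta> + 4 * CK\<^sup>2 * t * (t / real N)) \<le> sqrt (C2 T * \<theta> + 4 * CK\<^sup>2 * t * (t / real N))"
        using C2 \<theta> by (intro real_sqrt_le_mono add_right_mono mult_right_mono) auto
      then show ?case
        using X_Z_bound[OF x t(1) elim(3) less_imp_le[OF elim(2)] \<theta>(1) less_imp_le[OF \<theta>(2)]] elim(1) by linarith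
    qed
  qed (use \<theta> in auto)
qed

end

section \<open>Markov property and contraction of the scheme\<close>

context bm_space
begin

definition \<xi> :: "real \<Rightarrow> (real^'d) measure" where
  "\<xi> h = distr M borel (\<lambda>\<omega>. B h \<omega> - B 0 \<omega>)"

text \<open>The component laws and their independence determine the joint law, here the image of a
  product of Gaussians that depends on \<open>t - s\<close> alone. This yields stationarity of the
  increments.\<close>

lemma inc_law_PiM:
  assumes "0 \<le> s" "s < t"
  shows "distr M borel (\<lambda>\<omega>. B t \<omega> - B s \<omega>)
    = distr (\<Pi>\<^sub>M i\<in>(UNIV :: 'd set). density lborel (normal_density 0 (sqrt (t - s)))) borel (\<lambda>f. \<Sum>i\<in>UNIV. f i *\<^sub>R axis i 1)"
proof -
  let ?X = "\<lambda>i \<omega>. (B t \<omega> - B s \<omega>) $ i"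
  let ?P = "\<Pi>\<^sub>M i\<in>(UNIV :: 'd set). (borel :: real measure)"
  have I: "indep_vars (\<lambda>_. borel) ?X UNIV"
    and D: "distributed M lborel (?X i) (normal_density 0 (sqrt (t - s)))" for i
    using BM assms unfolding brownian_motion_def by blast+
  have rv: "random_variable borel (?X i)" for i using I by (simp add: indep_vars_def)
  have marg: "distr M borel (?X i) = density lborel (normal_density 0 (sqrt (t - s)))" for i
  proof -
    have "distr M borel (?X i) = distr M lborel (?X i)" by (rule distr_cong) simp_all
    then show ?thesis using distributed_distr_eq_density[OF D[of i]] by simp
  qed
  have joint: "distr M ?P (\<lambda>\<omega>. \<lambda>i\<in>UNIV. ?X i \<omega>) = (\<Pi>\<^sub>M i\<in>(UNIV :: 'd set). density lborel (normal_density 0 (sqrt (t - s))))"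
    using indep_vars_iff_distr_eq_PiM[THEN iffD1, OF UNIV_not_empty rv I] unfolding marg .
  have v: "(\<Sum>i\<in>UNIV. v $ i *\<^sub>R axis i 1) = v" for v :: "real^'d"
    by (simp add: vec_eq_iff axis_def sum.delta if_distrib cong: if_cong)
  have m: "(\<lambda>f. \<Sum>i\<in>UNIV. f i *\<^sub>R axis i 1 :: real^'d) \<in> borel_measurable ?P" by measurable
  have "distr M borel (\<lambda>\<omega>. B t \<omega> - B s \<omega>) = distr (distr M ?P (\<lambda>\<omega>. \<lambda>i\<in>UNIV. ?X i \<omega>)) borel (\<lambda>f. \<Sum>i\<in>UNIV. f i *\<^sub>R axis i 1)"
    by (subst distr_distr[OF m]) (auto intro!: measurable_restrict rv simp: comp_def v simp del: vector_minus_component)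
  then show ?thesis unfolding joint .
qed

lemma inc_law: "0 \<le> s \<Longrightarrow> s < t \<Longrightarrow> distr M borel (\<lambda>\<omega>. B t \<omega> - B s \<omega>) = \<xi> (t - s)"
  unfolding \<xi>_def using inc_law_PiM[of s t] inc_law_PiM[of 0 "t - s"] by simp

lemma prob_space_\<xi>: "0 \<le> h \<Longrightarrow> prob_space (\<xi> h)"
  unfolding \<xi>_def by (intro prob_space_distr inc_measurable) auto

lemma sets_\<xi> [simp, measurable_cong]: "sets (\<xi> h) = sets borel" by (simp add: \<xi>_def)

lemma space_\<xi> [simp]: "space (\<xi> h) = UNIV" by (simp add: \<xi>_def)

text \<open>\<open>Y\<close> and the increment are independent, so their joint law is a product and
  Fubini integrates out the increment with \<open>Y\<close> frozen.\<close>

lemma expectation_inc: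
  fixes g :: "(real^'d) \<times> (real^'d) \<Rightarrow> real"
  assumes "0 \<le> s" "s < t" and Y: "Y \<in> borel_measurable (F s)"
    and g: "g \<in> borel_measurable borel" "\<And>p. \<bar>g p\<bar> \<le> c"
  shows "(\<integral>\<omega>. g (Y \<omega>, B t \<omega> - B s \<omega>) \<partial>M) = (\<integral>\<omega>. (\<integral>w. g (Y \<omega>, w) \<partial>\<xi> (t - s)) \<partial>M)"
proof -
  let ?D = "\<lambda>\<omega>. B t \<omega> - B s \<omega>"
  have iv: "indep_var borel Y borel ?D"
    using indep_inc[OF assms(1,2) Y, of "\<lambda>x. x" borel] by simp
  have rY[measurable]: "Y \<in> borel_measurable M" by (rule measurable_F_M[OF Y])
  have rD[measurable]: "?D \<in> borel_measurable M" using assms by simp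
  have joint: "distr M borel Y \<Otimes>\<^sub>M \<xi> (t - s) = distr M (borel \<Otimes>\<^sub>M borel) (\<lambda>\<omega>. (Y \<omega>, ?D \<omega>))"
    using iv unfolding indep_var_distribution_eq inc_law[OF assms(1,2)] by (elim conjE)
  interpret x: prob_space "\<xi> (t - s)" using assms by (intro prob_space_\<xi>) simp
  interpret Y: prob_space "distr M borel Y" by (rule prob_space_distr) simp
  interpret pair_prob_space "distr M borel Y" "\<xi> (t - s)" ..
  have gm[measurable]: "g \<in> borel_measurable (borel \<Otimes>\<^sub>M borel)" using g(1) by (simp add: borel_prod)
  have "(\<integral>\<omega>. g (Y \<omega>, ?D \<omega>) \<partial>M) = (\<integral>p. g p \<partial>distr M (borel \<Otimes>\<^sub>M borel) (\<lambda>\<omega>. (Y \<omega>, ?D \<omega>)))"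
    by (subst integral_distr) auto
  also have "distr M (borel \<Otimes>\<^sub>M borel) (\<lambda>\<omega>. (Y \<omega>, ?D \<omega>)) = distr M borel Y \<Otimes>\<^sub>M \<xi> (t - s)"
    by (rule joint[symmetric])
  also have "(\<integral>p. g p \<partial>(distr M borel Y \<Otimes>\<^sub>M \<xi> (t - s))) = (\<integral>z. (\<integral>w. g (z, w) \<partial>\<xi> (t - s)) \<partial>distr M borel Y)"
    by (rule integral_fst'[symmetric], rule P.integrable_const_bound[where B=c]) (use g(2) in auto)
  also have "\<dots> = (\<integral>\<omega>. (\<integral>w. g (Y \<omega>, w) \<partial>\<xi> (t - s)) \<partial>M)"
    by (rule integral_distr) auto
  finally show ?thesis .
qed

end

context reflected_sde
begin

text \<open>The one-step transition operator of the scheme, the same at every step because the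
  increments are stationary.\<close>

definition Q :: "real \<Rightarrow> real \<Rightarrow> (real^'d \<Rightarrow> real) \<Rightarrow> real^'d \<Rightarrow> real" where
  "Q \<theta> h f z = (\<integral>w. f (step \<theta> h z w) \<partial>\<xi> h)"

lemma Q_measurable:
  assumes [measurable]: "f \<in> borel_measurable borel" and h: "0 \<le> h"
  shows "Q \<theta> h f \<in> borel_measurable borel"
proof -
  interpret x: prob_space "\<xi> h" using h by (rule prob_space_\<xi>)
  have "(\<lambda>p. f (step \<theta> h (fst p) (snd p))) \<in> borel_measurable (borel \<Otimes>\<^sub>M \<xi> h)" by measurable
  then have "case_prod (\<lambda>z w. f (step \<theta> h z w)) \<in> borel_measurable (borel \<Otimes>\<^sub>M \<xi> h)" by (simp add: case_prod_beta')
  from x.borel_measurable_lebesgue_integral[OF this] show ?thesis by (simp add: Q_def[abs_def])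
qed

lemma Q_bound:
  assumes "\<And>z. \<bar>f z\<bar> \<le> c" "0 \<le> h"
  shows "\<bar>Q \<theta> h f z\<bar> \<le> c"
proof -
  interpret x: prob_space "\<xi> h" using assms by (intro prob_space_\<xi>)
  have c: "0 \<le> c" using assms(1)[of 0] by linarith
  have "\<bar>Q \<theta> h f z\<bar> \<le> (\<integral>w. c \<partial>\<xi> h)"
    unfolding Q_def real_norm_def[symmetric]
    by (rule order_trans[OF integral_norm_bound integral_mono_AE']) (use assms c in auto)
  then show ?thesis using x.prob_space by simp
qed

text \<open>Integrating out the last increment replaces \<open>f\<close> by
  \<open>Q \<theta> h f\<close> and leaves one step less, hence an induction with \<open>f\<close>
  arbitrary.\<close>

lemma scheme_markov:
  assumes h: "0 < h" and f: "f \<in> borel_measurable borel" "\<And>z. \<bar>f z\<bar> \<le> c"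
  shows "(\<integral>\<omega>. f (Z \<theta> h x n \<omega>) \<partial>M) = (Q \<theta> h ^^ n) f x"
  using f
proof (induction n arbitrary: f)
  case 0
  then show ?case by (simp add: prob_space)
next
  case (Suc n)
  note [measurable] = Suc.prems(1)
  have lt: "0 \<le> h * real n" "h * real n < h * real (Suc n)" using h by auto
  have len: "h * real (Suc n) - h * real n = h" by (simp add: algebra_simps)
  have g: "(\<lambda>p. f (step \<theta> h (fst p) (snd p))) \<in> borel_measurable borel"
    unfolding borel_prod[symmetric] by measurable
  have "(\<integral>\<omega>. f (Z \<theta> h x (Suc n) \<omega>) \<partial>M) = (\<integral>\<omega>. Q \<theta> h f (Z \<theta> h x n \<omega>) \<partial>M)"
    using expectation_inc[OF lt Z_measurable[OF less_imp_le[OF h]] g Suc.prems(2)] unfolding len Q_def by simp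
  also have "\<dots> = (Q \<theta> h ^^ n) (Q \<theta> h f) x"
    using h by (intro Suc.IH Q_measurable Q_bound Suc.prems) auto
  finally show ?case by (simp add: funpow_swap1)
qed

lemma Q_funpow:
  assumes h: "0 < h" and f: "f \<in> borel_measurable borel" "\<And>z. \<bar>f z\<bar> \<le> c"
  shows "(Q \<theta> h ^^ n) f \<in> borel_measurable borel" "\<bar>(Q \<theta> h ^^ n) f z\<bar> \<le> c"
proof -
  have "(Q \<theta> h ^^ n) f \<in> borel_measurable borel \<and> (\<forall>z. \<bar>(Q \<theta> h ^^ n) f z\<bar> \<le> c)"
    by (induction n) (use assms in \<open>auto intro: Q_measurable Q_bound\<close>)
  then show "(Q \<theta> h ^^ n) f \<in> borel_measurable borel" "\<bar>(Q \<theta> h ^^ n) f z\<bar> \<le> c" by auto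
qed

lemma scheme_semigroup:
  assumes h: "0 < h" and f: "f \<in> borel_measurable borel" "\<And>z. \<bar>f z\<bar> \<le> c"
  shows "(\<integral>\<omega>. f (Z \<theta> h x (n + k) \<omega>) \<partial>M) = (\<integral>\<omega>. (Q \<theta> h ^^ k) f (Z \<theta> h x n \<omega>) \<partial>M)"
  unfolding scheme_markov[OF h f] scheme_markov[OF h Q_funpow[OF h f]] by (simp add: funpow_add)

text \<open>A projected step is no worse than the unprojected one, for which dissipativity gives the
  factor \<open>1 - 2 * \<delta> * h\<close> and the explicit drift costs
  \<open>4 * CK\<^sup>2 * h\<^sup>2\<close>. With \<open>2 * \<delta> * h \<le> 1\<close> the factor
  is nonnegative, so the estimate can be iterated; the accumulated cost still vanishes with
  \<open>h\<close>.\<close>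

lemma scheme_contraction:
  assumes h: "0 < h" "h \<le> 1" "2 * \<delta> * h \<le> 1" and th: "0 \<le> \<theta>" "\<theta> \<le> 1" and x: "x \<in> K" and y: "y \<in> K"
  shows "integrable M (\<lambda>\<omega>. (norm (Z \<theta> h x n \<omega> - Z \<theta> h y n \<omega>))\<^sup>2)"
    "(\<integral>\<omega>. (norm (Z \<theta> h x n \<omega> - Z \<theta> h y n \<omega>))\<^sup>2 \<partial>M) \<le> exp (- 2 * \<delta> * (h * real n)) * (norm (x - y))\<^sup>2 + 4 * CK\<^sup>2 * h * (h * real n)"
proof -
  let ?D = "\<lambda>n \<omega>. Z \<theta> h x n \<omega> - Z \<theta> h y n \<omega>"
  have h0: "0 \<le> h" using h by simp
  have ZK: "Z \<theta> h x n \<omega> \<in> K" "Z \<theta> h y n \<omega> \<in> K" for n \<omega> using Z_in_K th x y by auto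
  note [measurable] = Z_measurable_M[OF h0]
  have "(norm (?D n \<omega>))\<^sup>2 \<le> (2 * CK)\<^sup>2" for n \<omega> by (intro power_mono K_diff_bound ZK) auto
  then have int: "integrable M (\<lambda>\<omega>. (norm (?D n \<omega>))\<^sup>2)" for n
    by (intro integrable_const_bound[where B="(2 * CK)\<^sup>2"] AE_I2) auto
  then show "integrable M (\<lambda>\<omega>. (norm (?D n \<omega>))\<^sup>2)" .
  have step: "(\<integral>\<omega>. (norm (?D (Suc n) \<omega>))\<^sup>2 \<partial>M) \<le> (1 - 2 * \<delta> * h) * (\<integral>\<omega>. (norm (?D n \<omega>))\<^sup>2 \<partial>M) + 4 * CK\<^sup>2 * h\<^sup>2" for n
  proof -
    let ?X = "\<lambda>\<omega>. Z \<theta> h x n \<omega>" and ?Y = "\<lambda>\<omega>. Z \<theta> h y n \<omega>"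
    let ?\<Delta> = "\<lambda>\<omega>. B (h * real (Suc n)) \<omega> - B (h * real n) \<omega>"
    let ?v = "\<lambda>\<omega>. ?D n \<omega> + h *\<^sub>R (b (?X \<omega>) - b (?Y \<omega>))" and ?H = "\<lambda>\<omega>. \<sigma> (?X \<omega>) - \<sigma> (?Y \<omega>)"
    let ?p = "\<lambda>\<omega>. (1 - 2 * \<delta> * h) * (norm (?D n \<omega>))\<^sup>2 + 4 * CK\<^sup>2 * h\<^sup>2"
    have [measurable]: "?X \<in> borel_measurable (F (h * real n))" "?Y \<in> borel_measurable (F (h * real n))"
      using h0 by (auto intro: Z_measurable)
    have vm: "?v \<in> borel_measurable (F (h * real n))" "?H \<in> borel_measurable (F (h * real n))" by measurable
    have vb: "norm (?v \<omega>) \<le> 4 * CK" "norm (?H \<omega>) \<le> 4 * CK" for \<omega>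
    proof -
      have "norm (h *\<^sub>R (b (?X \<omega>) - b (?Y \<omega>))) \<le> 1 * (2 * CK)"
        unfolding norm_scaleR using h by (intro mult_mono b_diff_bound ZK) auto
      from norm_triangle_mono[OF K_diff_bound[OF ZK] this] show "norm (?v \<omega>) \<le> 4 * CK" by simp
      show "norm (?H \<omega>) \<le> 4 * CK" using \<sigma>_diff_bound[OF ZK] CK_pos by (smt (verit))
    qed
    have le: "(norm (?v \<omega>))\<^sup>2 + h * (norm (?H \<omega>))\<^sup>2 \<le> ?p \<omega>" for \<omega>
    proof -
      let ?db = "b (?X \<omega>) - b (?Y \<omega>)"
      have "(norm (?H \<omega>))\<^sup>2 + 2 * (?D n \<omega> \<bullet> ?db) \<le> - 2 * \<delta> * (norm (?D n \<omega>))\<^sup>2" by (rule dissipative)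
      then have 1: "h * ((norm (?H \<omega>))\<^sup>2 + 2 * (?D n \<omega> \<bullet> ?db)) \<le> h * (- 2 * \<delta> * (norm (?D n \<omega>))\<^sup>2)" using h0 by (rule mult_left_mono)
      have "(norm ?db)\<^sup>2 \<le> (2 * CK)\<^sup>2" by (intro power_mono b_diff_bound ZK) auto
      then have 2: "h\<^sup>2 * (norm ?db)\<^sup>2 \<le> h\<^sup>2 * (4 * CK\<^sup>2)" by (intro mult_left_mono) (auto simp: power_mult_distrib)
      have "(norm (?v \<omega>))\<^sup>2 + h * (norm (?H \<omega>))\<^sup>2 = (norm (?D n \<omega>))\<^sup>2 + h * ((norm (?H \<omega>))\<^sup>2 + 2 * (?D n \<omega> \<bullet> ?db)) + h\<^sup>2 * (norm ?db)\<^sup>2"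
        unfolding norm_add_scaleR_power2[of "?D n \<omega>"] by (simp add: algebra_simps)
      also have "\<dots> \<le> (norm (?D n \<omega>))\<^sup>2 + h * (- 2 * \<delta> * (norm (?D n \<omega>))\<^sup>2) + h\<^sup>2 * (4 * CK\<^sup>2)" using 1 2 by linarith
      also have "\<dots> = ?p \<omega>" by (simp add: algebra_simps)
      finally show ?thesis .
    qed
    have pi: "integrable M ?p" using int by simp
    note O = one_step_scheme[OF h(1) vm(1) vb(1) vm(2) vb(2) _ pi le]
    have "(\<integral>\<omega>. (norm (?D (Suc n) \<omega>))\<^sup>2 \<partial>M) \<le> (\<integral>\<omega>. (norm (?v \<omega> + ?H \<omega> *v ?\<Delta> \<omega>))\<^sup>2 \<partial>M)"
    proof (rule integral_mono[OF int])
      show "integrable M (\<lambda>\<omega>. (norm (?v \<omega> + ?H \<omega> *v ?\<Delta> \<omega>))\<^sup>2)" using O(1) pi by simp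
      fix \<omega>
      have "norm (?D (Suc n) \<omega>) \<le> norm (drift_step h (?X \<omega>) (?\<Delta> \<omega>) - drift_step h (?Y \<omega>) (?\<Delta> \<omega>))"
        unfolding Z.simps step_def dist_norm[symmetric] by (rule closest_point_lipschitz[OF Kt_convex Kt_closed Kt_nonempty])
      also have "drift_step h (?X \<omega>) (?\<Delta> \<omega>) - drift_step h (?Y \<omega>) (?\<Delta> \<omega>) = ?v \<omega> + ?H \<omega> *v ?\<Delta> \<omega>"
        by (simp add: drift_step_def matrix_vector_mult_diff_rdistrib algebra_simps)
      finally show "(norm (?D (Suc n) \<omega>))\<^sup>2 \<le> (norm (?v \<omega> + ?H \<omega> *v ?\<Delta> \<omega>))\<^sup>2" by (rule power_mono) simp
    qed
    also have "\<dots> \<le> (\<integral>\<omega>. ?p \<omega> \<partial>M)" using O(2) pi by simp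
    also have "\<dots> = (1 - 2 * \<delta> * h) * (\<integral>\<omega>. (norm (?D n \<omega>))\<^sup>2 \<partial>M) + 4 * CK\<^sup>2 * h\<^sup>2" using int by (simp add: prob_space)
    finally show ?thesis .
  qed
  show "(\<integral>\<omega>. (norm (?D n \<omega>))\<^sup>2 \<partial>M) \<le> exp (- 2 * \<delta> * (h * real n)) * (norm (x - y))\<^sup>2 + 4 * CK\<^sup>2 * h * (h * real n)"
  proof (induction n)
    case 0 then show ?case by (simp add: prob_space)
  next
    case (Suc n)
    let ?E = "exp (- 2 * \<delta> * (h * real n)) * (norm (x - y))\<^sup>2" and ?R = "4 * CK\<^sup>2 * h * (h * real n)"
    have "(\<integral>\<omega>. (norm (?D (Suc n) \<omega>))\<^sup>2 \<partial>M) \<le> (1 - 2 * \<delta> * h) * (?E + ?R) + 4 * CK\<^sup>2 * h\<^sup>2"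
      using step[of n] mult_left_mono[OF Suc.IH, of "1 - 2 * \<delta> * h"] h by linarith
    also have "(1 - 2 * \<delta> * h) * (?E + ?R) \<le> exp (- 2 * \<delta> * h) * ?E + ?R"
    proof -
      have "1 - 2 * \<delta> * h \<le> exp (- 2 * \<delta> * h)" using exp_ge_add_one_self[of "- 2 * \<delta> * h"] by simp
      then have "(1 - 2 * \<delta> * h) * ?E \<le> exp (- 2 * \<delta> * h) * ?E" by (rule mult_right_mono) simp
      moreover have "(1 - 2 * \<delta> * h) * ?R \<le> 1 * ?R" using h delta_pos by (intro mult_right_mono) auto
      ultimately show ?thesis by (simp only: distrib_left mult_1)
    qed
    also have "exp (- 2 * \<delta> * h) * ?E = exp (- 2 * \<delta> * (h * real (Suc n))) * (norm (x - y))\<^sup>2"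
      by (simp add: exp_add[symmetric] algebra_simps)
    finally show ?case by (simp add: algebra_simps power2_eq_square)
  qed
qed

end

section \<open>Contraction and semigroup property of the reflected diffusion\<close>

lemma norm_integral_le_integral:
  fixes f :: "'a \<Rightarrow> 'b::{banach, second_countable_topology}"
  assumes "integrable M f" "integrable M g" "\<And>x. x \<in> space M \<Longrightarrow> norm (f x) \<le> g x"
  shows "norm (\<integral>x. f x \<partial>M) \<le> (\<integral>x. g x \<partial>M)"
  by (rule order_trans[OF integral_norm_bound integral_mono[OF integrable_norm]]) (use assms in auto)

context reflected_sde
begin

definition P :: "real \<Rightarrow> (real^'d \<Rightarrow> real) \<Rightarrow> real^'d \<Rightarrow> real" where
  "P t f x = (\<integral>\<omega>. f (X x t \<omega>) \<partial>M)"

lemma X_diff_integrable: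
  assumes "x \<in> K" "y \<in> K" "0 \<le> t"
  shows "integrable M (\<lambda>\<omega>. (norm (X x t \<omega> - X y t \<omega>))\<^sup>2)" "integrable M (\<lambda>\<omega>. norm (X x t \<omega> - X y t \<omega>))"
proof -
  note [measurable] = X_measurable_M[OF assms(1,3)] X_measurable_M[OF assms(2,3)]
  have b: "norm (X x t \<omega> - X y t \<omega>) \<le> 2 * CK" if "\<omega> \<in> space M" for \<omega>
    using assms that by (intro K_diff_bound X_in_K) auto
  show "integrable M (\<lambda>\<omega>. norm (X x t \<omega> - X y t \<omega>))"
    by (rule integrable_const_bound[where B="2 * CK"]) (use b in auto)
  show "integrable M (\<lambda>\<omega>. (norm (X x t \<omega> - X y t \<omega>))\<^sup>2)"
    by (rule integrable_const_bound[where B="(2 * CK)\<^sup>2"]) (use power_mono[OF b norm_ge_zero, of _ 2] in auto)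
qed

lemma grid_eventually_small:
  "0 < e \<Longrightarrow> \<forall>\<^sub>F N in sequentially. t / real N < e"
  by (rule order_tendstoD(2)[OF lim_const_over_n])

lemma X_contraction:
  assumes x: "x \<in> K" and y: "y \<in> K" and t: "0 < t"
  shows "(\<integral>\<omega>. (norm (X x t \<omega> - X y t \<omega>))\<^sup>2 \<partial>M) \<le> exp (- 2 * \<delta> * t) * (norm (x - y))\<^sup>2"
proof (rule field_le_epsilon)
  fix e :: real assume e: "0 < e"
  \<comment> \<open>Two approximation errors occur, each multiplied by
    \<open>4 * CK\<close>.\<close>
  let ?e = "e / (8 * CK)"
  have e': "0 < ?e" using e CK_pos by simp
  obtain \<theta> where th: "0 < \<theta>" "\<theta> \<le> 1/2" and
    conv: "\<And>x s. x \<in> K \<Longrightarrow> 0 < s \<Longrightarrow> s \<le> t \<Longrightarrow> \<forall>\<^sub>F N in sequentially. (\<integral>\<omega>. norm (X x s \<omega> - Z \<theta> (s / real N) x N \<omega>) \<partial>M) \<le> ?e"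
    using scheme_converges[OF t e'] by blast
  let ?A = "\<integral>\<omega>. (norm (X x t \<omega> - X y t \<omega>))\<^sup>2 \<partial>M"
  have lim: "(\<lambda>N. exp (- 2 * \<delta> * t) * (norm (x - y))\<^sup>2 + 4 * CK\<^sup>2 * (t / real N) * t + e)
    \<longlonglongrightarrow> exp (- 2 * \<delta> * t) * (norm (x - y))\<^sup>2 + 4 * CK\<^sup>2 * 0 * t + e"
    by (intro tendsto_intros lim_const_over_n)
  have "\<forall>\<^sub>F N in sequentially. ?A \<le> exp (- 2 * \<delta> * t) * (norm (x - y))\<^sup>2 + 4 * CK\<^sup>2 * (t / real N) * t + e"
    using conv[OF x t order_refl] conv[OF y t order_refl] eventually_gt_at_top[of 0]
      grid_eventually_small[OF zero_less_one, of t] grid_eventually_small[OF zero_less_one, of "2 * \<delta> * t"]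
  proof eventually_elim
    case (elim N)
    let ?h = "t / real N"
    let ?Zx = "Z \<theta> ?h x N" and ?Zy = "Z \<theta> ?h y N"
    have h: "0 < ?h" "?h \<le> 1" "2 * \<delta> * ?h \<le> 1" "?h * real N = t" using elim t by auto
    have th': "0 \<le> \<theta>" "\<theta> \<le> 1" using th by auto
    note Zc = scheme_contraction[OF h(1,2,3) th' x y, of N, unfolded h(4)]
    note ix = X_Z_integrable[OF x less_imp_le[OF t] less_imp_le[OF h(1)] th', of N]
    note iy = X_Z_integrable[OF y less_imp_le[OF t] less_imp_le[OF h(1)] th', of N]
    \<comment> \<open>A difference of squares factors, and the sum of the two distances is at most
      \<open>4 * CK\<close>; convergence of the scheme in first mean therefore suffices.\<close>
    have ptw: "(norm (X x t \<omega> - X y t \<omega>))\<^sup>2 \<le> (norm (?Zx \<omega> - ?Zy \<omega>))\<^sup>2 + 4 * CK * (norm (X x t \<omega> - ?Zx \<omega>) + norm (X y t \<omega> - ?Zy \<omega>))"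
      if w: "\<omega> \<in> space M" for \<omega>
    proof -
      let ?p = "norm (X x t \<omega> - X y t \<omega>)" and ?q = "norm (?Zx \<omega> - ?Zy \<omega>)" and ?r = "norm (X x t \<omega> - ?Zx \<omega>) + norm (X y t \<omega> - ?Zy \<omega>)"
      have "X x t \<omega> - X y t \<omega> = (?Zx \<omega> - ?Zy \<omega>) + ((X x t \<omega> - ?Zx \<omega>) - (X y t \<omega> - ?Zy \<omega>))" by simp
      then have pq: "?p \<le> ?q + ?r" by (smt (verit) norm_triangle_ineq norm_triangle_ineq4)
      have pb: "?p \<le> 2 * CK" "?q \<le> 2 * CK" using w t th' x y by (intro K_diff_bound X_in_K Z_in_K; auto)+
      show ?thesis
      proof (cases "?p \<le> ?q")
        case True
        then have "?p\<^sup>2 \<le> ?q\<^sup>2" by (rule power_mono) simp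
        moreover have "0 \<le> 4 * CK * ?r" using CK_pos by simp
        ultimately show ?thesis by linarith
      next
        case False
        have "?p\<^sup>2 - ?q\<^sup>2 = (?p - ?q) * (?p + ?q)" by (simp add: power2_eq_square algebra_simps)
        also have "\<dots> \<le> ?r * (4 * CK)" using False pq pb by (intro mult_mono) auto
        finally show ?thesis by (simp add: mult.commute)
      qed
    qed
    have "?A \<le> (\<integral>\<omega>. (norm (?Zx \<omega> - ?Zy \<omega>))\<^sup>2 + 4 * CK * (norm (X x t \<omega> - ?Zx \<omega>) + norm (X y t \<omega> - ?Zy \<omega>)) \<partial>M)"
      by (rule integral_mono[OF X_diff_integrable(1)[OF x y less_imp_le[OF t]] _ ptw]) (use Zc(1) ix iy in auto)
    also have "\<dots> = (\<integral>\<omega>. (norm (?Zx \<omega> - ?Zy \<omega>))\<^sup>2 \<partial>M) + 4 * CK * ((\<integral>\<omega>. norm (X x t \<omega> - ?Zx \<omega>) \<partial>M) + (\<integral>\<omega>. norm (X y t \<omega> - ?Zy \<omega>) \<partial>M))"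
      using Zc(1) ix iy by simp
    also have "\<dots> \<le> (\<integral>\<omega>. (norm (?Zx \<omega> - ?Zy \<omega>))\<^sup>2 \<partial>M) + 4 * CK * (?e + ?e)"
      using elim CK_pos by (intro add_left_mono mult_left_mono add_mono) auto
    also have "4 * CK * (?e + ?e) = e" using CK_pos by simp
    finally show ?case using Zc(2) by linarith
  qed
  from tendsto_lowerbound[OF lim this] show "?A \<le> exp (- 2 * \<delta> * t) * (norm (x - y))\<^sup>2 + e" by simp
qed

lemma X_contraction_L1:
  assumes x: "x \<in> K" and y: "y \<in> K" and t: "0 < t"
  shows "(\<integral>\<omega>. norm (X x t \<omega> - X y t \<omega>) \<partial>M) \<le> exp (- \<delta> * t) * norm (x - y)"
proof -
  have [measurable]: "X x t \<in> borel_measurable M" "X y t \<in> borel_measurable M"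
    using x y t by (auto intro: X_measurable_M)
  have "(\<integral>\<omega>. norm (X x t \<omega> - X y t \<omega>) \<partial>M) \<le> sqrt (\<integral>\<omega>. (norm (X x t \<omega> - X y t \<omega>))\<^sup>2 \<partial>M)"
    by (rule expectation_le_sqrt(2)[OF _ X_diff_integrable(1)[OF x y less_imp_le[OF t]]]) measurable
  also have "\<dots> \<le> sqrt ((exp (- \<delta> * t) * norm (x - y))\<^sup>2)"
  proof (rule real_sqrt_le_mono)
    have "exp (- \<delta> * t) * exp (- \<delta> * t) = exp (- 2 * \<delta> * t)" by (simp add: mult_exp_exp)
    then show "(\<integral>\<omega>. (norm (X x t \<omega> - X y t \<omega>))\<^sup>2 \<partial>M) \<le> (exp (- \<delta> * t) * norm (x - y))\<^sup>2"
      unfolding power_mult_distrib power2_eq_square[of "exp _"] using X_contraction[OF assms] by simp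
  qed
  finally show ?thesis by simp
qed

lemma expectation_lipschitz_diff:
  fixes f :: "real^'d \<Rightarrow> real"
  assumes f: "L-lipschitz_on UNIV f" "\<And>z. \<bar>f z\<bar> \<le> c"
    and m: "V \<in> borel_measurable M" "W' \<in> borel_measurable M" and i: "integrable M (\<lambda>\<omega>. norm (V \<omega> - W' \<omega>))"
  shows "\<bar>(\<integral>\<omega>. f (V \<omega>) \<partial>M) - (\<integral>\<omega>. f (W' \<omega>) \<partial>M)\<bar> \<le> L * (\<integral>\<omega>. norm (V \<omega> - W' \<omega>) \<partial>M)"
proof -
  have fm: "f \<in> borel_measurable borel" by (rule borel_measurable_continuous_onI[OF lipschitz_on_continuous_on[OF f(1)]])
  have fi: "integrable M (\<lambda>\<omega>. f (V \<omega>))" "integrable M (\<lambda>\<omega>. f (W' \<omega>))"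
    using f(2) measurable_compose[OF m(1) fm] measurable_compose[OF m(2) fm]
    by (auto intro!: integrable_const_bound[where B=c])
  have "\<bar>(\<integral>\<omega>. f (V \<omega>) \<partial>M) - (\<integral>\<omega>. f (W' \<omega>) \<partial>M)\<bar> = norm (\<integral>\<omega>. f (V \<omega>) - f (W' \<omega>) \<partial>M)"
    using fi by simp
  also have "\<dots> \<le> (\<integral>\<omega>. L * norm (V \<omega> - W' \<omega>) \<partial>M)"
    by (rule norm_integral_le_integral)
       (use fi i lipschitz_onD[OF f(1)] in \<open>auto simp: dist_norm\<close>)
  also have "\<dots> = L * (\<integral>\<omega>. norm (V \<omega> - W' \<omega>) \<partial>M)" by simp
  finally show ?thesis .
qed

lemma P_lipschitz:
  assumes f: "L-lipschitz_on UNIV f" "\<And>z. \<bar>f z\<bar> \<le> c" and x: "x \<in> K" and y: "y \<in> K" and t: "0 < t"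
  shows "\<bar>P t f x - P t f y\<bar> \<le> L * exp (- \<delta> * t) * norm (x - y)"
proof -
  have "\<bar>P t f x - P t f y\<bar> \<le> L * (\<integral>\<omega>. norm (X x t \<omega> - X y t \<omega>) \<partial>M)"
    unfolding P_def using t x y by (intro expectation_lipschitz_diff[OF f] X_measurable_M X_diff_integrable) auto
  also have "\<dots> \<le> L * (exp (- \<delta> * t) * norm (x - y))"
    by (intro mult_left_mono X_contraction_L1 assms lipschitz_on_nonneg[OF f(1)])
  finally show ?thesis by simp
qed

text \<open>Points outside \<open>K\<close> carry no information, so kernels and functions on \<open>K\<close> are extended by the nearest-point projection.\<close>

definition pK :: "real^'d \<Rightarrow> real^'d" where "pK = closest_point K"

lemma pK_in: "pK x \<in> K" unfolding pK_def by (rule closest_point_in_set[OF K_closed K_nonempty])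

lemma pK_self: "x \<in> K \<Longrightarrow> pK x = x" unfolding pK_def by (rule closest_point_self)

lemma pK_lipschitz: "dist (pK x) (pK y) \<le> dist x y"
  unfolding pK_def by (rule closest_point_lipschitz[OF K_convex K_closed K_nonempty])

definition PK :: "real \<Rightarrow> (real^'d \<Rightarrow> real) \<Rightarrow> real^'d \<Rightarrow> real" where "PK t f x = P t f (pK x)"

lemma PK_lipschitz:
  assumes f: "L-lipschitz_on UNIV f" "\<And>z. \<bar>f z\<bar> \<le> c" and t: "0 < t"
  shows "(L * exp (- \<delta> * t))-lipschitz_on UNIV (PK t f)"
proof (rule lipschitz_onI)
  show "0 \<le> L * exp (- \<delta> * t)" using lipschitz_on_nonneg[OF f(1)] by simp
  fix x y
  have "dist (PK t f x) (PK t f y) \<le> (L * exp (- \<delta> * t)) * dist (pK x) (pK y)"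
    unfolding PK_def dist_norm real_norm_def using P_lipschitz[OF f pK_in pK_in t] by simp
  also have "\<dots> \<le> (L * exp (- \<delta> * t)) * dist x y"
    using lipschitz_on_nonneg[OF f(1)] by (intro mult_left_mono pK_lipschitz) simp
  finally show "dist (PK t f x) (PK t f y) \<le> (L * exp (- \<delta> * t)) * dist x y" .
qed

lemma P_bound: "(\<And>z. \<bar>f z\<bar> \<le> c) \<Longrightarrow> \<bar>P t f x\<bar> \<le> c"
proof -
  assume f: "\<And>z. \<bar>f z\<bar> \<le> c"
  have c: "0 \<le> c" using f[of 0] by linarith
  have "\<bar>P t f x\<bar> \<le> (\<integral>w. c \<partial>M)"
    unfolding P_def real_norm_def[symmetric]
    by (rule order_trans[OF integral_norm_bound integral_mono_AE']) (use f c in auto)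
  then show ?thesis by (simp add: prob_space)
qed

text \<open>The scheme contracts up to its discretisation error, so the iterates of \<open>Q\<close>
  are Lipschitz up to an additive defect that vanishes with the mesh.\<close>

lemma Q_funpow_almost_lipschitz:
  assumes f: "L-lipschitz_on UNIV f" "\<And>z. \<bar>f z\<bar> \<le> c"
    and h: "0 < h" "h \<le> 1" "2 * \<delta> * h \<le> 1" and th: "0 \<le> \<theta>" "\<theta> \<le> 1" and x: "x \<in> K" and y: "y \<in> K"
  shows "\<bar>(Q \<theta> h ^^ n) f x - (Q \<theta> h ^^ n) f y\<bar> \<le> L * (norm (x - y) + sqrt (4 * CK\<^sup>2 * h * (h * real n)))"
proof -
  have fm: "f \<in> borel_measurable borel" by (rule borel_measurable_continuous_onI[OF lipschitz_on_continuous_on[OF f(1)]])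
  note Zc = scheme_contraction[OF h th x y, of n]
  have Zm: "Z \<theta> h z n \<in> borel_measurable M" for z using h by (intro Z_measurable_M) simp
  then have nm: "(\<lambda>\<omega>. norm (Z \<theta> h x n \<omega> - Z \<theta> h y n \<omega>)) \<in> borel_measurable M" by measurable
  note E = expectation_le_sqrt[OF nm Zc(1)]
  have "\<bar>(Q \<theta> h ^^ n) f x - (Q \<theta> h ^^ n) f y\<bar> \<le> L * (\<integral>\<omega>. norm (Z \<theta> h x n \<omega> - Z \<theta> h y n \<omega>) \<partial>M)"
    unfolding scheme_markov[OF h(1) fm f(2), symmetric] by (intro expectation_lipschitz_diff[OF f] Zm E(1))
  also have "\<dots> \<le> L * (norm (x - y) + sqrt (4 * CK\<^sup>2 * h * (h * real n)))"
  proof (rule mult_left_mono[OF _ lipschitz_on_nonneg[OF f(1)]])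
    have "exp (- 2 * \<delta> * (h * real n)) * (norm (x - y))\<^sup>2 \<le> 1 * (norm (x - y))\<^sup>2"
      using h delta_pos by (intro mult_right_mono) auto
    then have "(\<integral>\<omega>. (norm (Z \<theta> h x n \<omega> - Z \<theta> h y n \<omega>))\<^sup>2 \<partial>M) \<le> (norm (x - y))\<^sup>2 + 4 * CK\<^sup>2 * h * (h * real n)"
      using Zc(2) by linarith
    then have "sqrt (\<integral>\<omega>. (norm (Z \<theta> h x n \<omega> - Z \<theta> h y n \<omega>))\<^sup>2 \<partial>M) \<le> sqrt ((norm (x - y))\<^sup>2 + 4 * CK\<^sup>2 * h * (h * real n))"
      by (rule real_sqrt_le_mono)
    also have "\<dots> \<le> sqrt ((norm (x - y))\<^sup>2) + sqrt (4 * CK\<^sup>2 * h * (h * real n))"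
      using h by (intro sqrt_add_le_add_sqrt) auto
    finally show "(\<integral>\<omega>. norm (Z \<theta> h x n \<omega> - Z \<theta> h y n \<omega>) \<partial>M) \<le> norm (x - y) + sqrt (4 * CK\<^sup>2 * h * (h * real n))"
      using E(2) by simp
  qed
  finally show ?thesis .
qed

text \<open>All times are multiples of \<tau>, so the grids of mesh \<open>\<tau> / real N\<close>
  hit each of them and the Markov property of the scheme splits at step \<open>p * N\<close>. Three
  replacements cost \<open>L * e\<close> each: the solution at the final time by the scheme, the
  scheme at the intermediate time by the solution, and the iterate of \<open>Q\<close> by
  \<open>PK\<close>.\<close>

lemma semigroup_approx:
  fixes p q :: nat
  assumes f: "L-lipschitz_on UNIV f" "\<And>z. \<bar>f z\<bar> \<le> c"
    and \<tau>: "0 < \<tau>" and p: "0 < p" and q: "0 < q" and x: "x \<in> K" and e: "0 < e"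
  shows "\<bar>P (real (p + q) * \<tau>) f x - P (real p * \<tau>) (PK (real q * \<tau>) f) x\<bar> \<le> 3 * L * e"
proof -
  let ?s = "real p * \<tau>" and ?t = "real q * \<tau>" and ?u = "real (p + q) * \<tau>"
  have pos: "0 < ?s" "0 < ?t" "0 < ?u" using \<tau> p q by auto
  have le: "?s \<le> ?u" "?t \<le> ?u" using \<tau> by auto
  have L: "0 \<le> L" by (rule lipschitz_on_nonneg[OF f(1)])
  obtain \<theta> where th: "0 < \<theta>" "\<theta> \<le> 1/2" and
    conv: "\<And>x s. x \<in> K \<Longrightarrow> 0 < s \<Longrightarrow> s \<le> ?u \<Longrightarrow> \<forall>\<^sub>F N in sequentially. (\<integral>\<omega>. norm (X x s \<omega> - Z \<theta> (s / real N) x N \<omega>) \<partial>M) \<le> e"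
    using scheme_converges[OF pos(3) e] by blast
  have th': "0 \<le> \<theta>" "\<theta> \<le> 1" using th by auto
  let ?h = "\<lambda>N. \<tau> / real N"
  have conv': "\<forall>\<^sub>F N in sequentially. (\<integral>\<omega>. norm (X z (real r * \<tau>) \<omega> - Z \<theta> (?h N) z (r * N) \<omega>) \<partial>M) \<le> e"
    if z: "z \<in> K" and r: "0 < r" "r \<le> p + q" for z r
  proof -
    have "0 < real r * \<tau>" "real r * \<tau> \<le> ?u" using r \<tau> by (auto simp del: of_nat_add)
    from conv[OF z this] have ev: "\<forall>\<^sub>F N in sequentially. (\<integral>\<omega>. norm (X z (real r * \<tau>) \<omega> - Z \<theta> (real r * \<tau> / real N) z N \<omega>) \<partial>M) \<le> e" .
    have "filterlim (\<lambda>N. r * N) sequentially sequentially"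
      using r by (intro mult_nat_left_at_top)
    from eventually_compose_filterlim[OF ev this] r show ?thesis by simp
  qed
  have fm: "f \<in> borel_measurable borel" by (rule borel_measurable_continuous_onI[OF lipschitz_on_continuous_on[OF f(1)]])
  let ?F = "PK ?t f"
  have Fm[measurable]: "?F \<in> borel_measurable borel"
    by (rule borel_measurable_continuous_onI[OF lipschitz_on_continuous_on[OF PK_lipschitz[OF f pos(2)]]])
  have Fb: "\<bar>?F z\<bar> \<le> c" for z unfolding PK_def by (rule P_bound[OF f(2)])
  let ?q = "\<lambda>N. (Q \<theta> (?h N) ^^ (q * N)) f"
  \<comment> \<open>The replacement of the iterated \<open>Q\<close> by \<open>PK\<close> is valid
    for \<open>N\<close> beyond a threshold depending on the starting point, which is random here.
    \<open>?g\<close> is the excess over \<open>L * e\<close>: it is eventually 0 on each path and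
    bounded, hence it vanishes in mean.\<close>
  let ?g = "\<lambda>N \<omega>. max (\<bar>?q N (X x ?s \<omega>) - ?F (X x ?s \<omega>)\<bar> - L * e) 0"
  note [measurable] = X_measurable_M[OF x less_imp_le[OF pos(1)]]
  let ?A = "\<bar>P ?u f x - P ?s ?F x\<bar>"
  let ?R = "\<lambda>N. L * e + L * (e + sqrt (4 * CK\<^sup>2 * ?h N * ?t)) + (L * e + (\<integral>\<omega>. ?g N \<omega> \<partial>M))"
  have qm: "?q N \<in> borel_measurable borel" and qb: "\<bar>?q N z\<bar> \<le> c" if "0 < N" for N z
    using that \<tau> by (auto intro!: Q_funpow fm f(2))
  \<comment> \<open>Indexed by \<open>Suc N\<close> since the mesh \<open>\<tau> / real N\<close>
    degenerates to 0 at \<open>N = 0\<close>.\<close>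
  have glim: "(\<lambda>N. \<integral>\<omega>. ?g (Suc N) \<omega> \<partial>M) \<longlonglongrightarrow> (\<integral>\<omega>. 0 \<partial>M)"
  proof (rule integral_dominated_convergence[where w="\<lambda>_. 2 * c"])
    have [measurable]: "?q (Suc N) \<in> borel_measurable borel" for N by (rule qm) simp
    show "?g (Suc N) \<in> borel_measurable M" for N by measurable
    show "AE \<omega> in M. norm (?g (Suc N) \<omega>) \<le> 2 * c" for N
    proof (rule AE_I2)
      fix \<omega>
      have "\<bar>?q (Suc N) (X x ?s \<omega>)\<bar> \<le> c" by (rule qb) simp
      moreover have "0 \<le> L * e" using L e by simp
      ultimately show "norm (?g (Suc N) \<omega>) \<le> 2 * c" using Fb[of "X x ?s \<omega>"] by auto
    qed
    show "AE \<omega> in M. (\<lambda>N. ?g (Suc N) \<omega>) \<longlonglongrightarrow> 0"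
    proof (rule AE_I2)
      fix \<omega> assume w: "\<omega> \<in> space M"
      let ?z = "X x ?s \<omega>"
      have zK: "?z \<in> K" using w pos by (intro X_in_K[OF x]) auto
      have "\<forall>\<^sub>F N in sequentially. ?g N \<omega> = 0"
        using conv'[OF zK q le_add2] eventually_gt_at_top[of 0]
      proof eventually_elim
        case (elim N)
        have h: "0 < ?h N" using elim \<tau> by simp
        have "\<bar>?F ?z - ?q N ?z\<bar> \<le> L * (\<integral>\<omega>. norm (X ?z ?t \<omega> - Z \<theta> (?h N) ?z (q * N) \<omega>) \<partial>M)"
          unfolding PK_def pK_self[OF zK] P_def scheme_markov[OF h fm f(2), symmetric]
          using h pos th' by (intro expectation_lipschitz_diff[OF f] X_measurable_M[OF zK] Z_measurable_M X_Z_integrable[OF zK]) auto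
        also have "\<dots> \<le> L * e" using elim L by (intro mult_left_mono) auto
        finally show ?case by (simp add: abs_minus_commute)
      qed
      then have "\<forall>\<^sub>F N in sequentially. ?g (Suc N) \<omega> = 0" by (subst eventually_sequentially_Suc)
      then show "(\<lambda>N. ?g (Suc N) \<omega>) \<longlonglongrightarrow> 0" by (rule tendsto_eventually)
    qed
  qed auto
  have hlim: "(\<lambda>N. ?h (Suc N)) \<longlonglongrightarrow> 0" by (rule LIMSEQ_Suc[OF lim_const_over_n])
  have lim: "(\<lambda>N. ?R (Suc N)) \<longlonglongrightarrow> L * e + L * (e + sqrt (4 * CK\<^sup>2 * 0 * ?t)) + (L * e + (\<integral>\<omega>. 0 \<partial>M))"
    by (intro tendsto_intros glim hlim)
  have ev: "\<forall>\<^sub>F N in sequentially. ?A \<le> ?R N"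
    using conv'[OF x add_pos_pos[OF p q] order_refl] conv'[OF x p le_add1] eventually_gt_at_top[of 0]
      grid_eventually_small[OF zero_less_one, of \<tau>] grid_eventually_small[OF zero_less_one, of "2 * \<delta> * \<tau>"]
  proof eventually_elim
    case (elim N)
    have h: "0 < ?h N" "0 \<le> ?h N" "?h N \<le> 1" "2 * \<delta> * ?h N \<le> 1" using elim \<tau> by auto
    have hq: "?h N * real (q * N) = ?t" using elim by simp
    note iu = X_Z_integrable[OF x less_imp_le[OF pos(3)] h(2) th', of "(p + q) * N"]
    note is' = X_Z_integrable[OF x less_imp_le[OF pos(1)] h(2) th', of "p * N"]
    note [measurable] = Z_measurable_M[OF h(2)] qm[OF elim(3)]
    have 1: "\<bar>P ?u f x - (\<integral>\<omega>. f (Z \<theta> (?h N) x ((p + q) * N) \<omega>) \<partial>M)\<bar> \<le> L * e"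
    proof -
      have "\<bar>P ?u f x - (\<integral>\<omega>. f (Z \<theta> (?h N) x ((p + q) * N) \<omega>) \<partial>M)\<bar> \<le> L * (\<integral>\<omega>. norm (X x ?u \<omega> - Z \<theta> (?h N) x ((p + q) * N) \<omega>) \<partial>M)"
        unfolding P_def using pos h by (intro expectation_lipschitz_diff[OF f] X_measurable_M[OF x] Z_measurable_M iu) auto
      also have "\<dots> \<le> L * e" using elim(1) p L by (intro mult_left_mono) auto
      finally show ?thesis .
    qed
    have 2: "(\<integral>\<omega>. f (Z \<theta> (?h N) x ((p + q) * N) \<omega>) \<partial>M) = (\<integral>\<omega>. ?q N (Z \<theta> (?h N) x (p * N) \<omega>) \<partial>M)"
      unfolding add_mult_distrib by (rule scheme_semigroup[OF h(1) fm f(2)])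
    have qi: "integrable M (\<lambda>\<omega>. ?q N (Z \<theta> (?h N) x (p * N) \<omega>))" "integrable M (\<lambda>\<omega>. ?q N (X x ?s \<omega>))"
      by (rule integrable_const_bound[where B=c]; use qb[OF elim(3)] in simp)+
    have Fi: "integrable M (\<lambda>\<omega>. ?F (X x ?s \<omega>))"
      by (rule integrable_const_bound[where B=c]) (use Fb in auto)
    have 3: "\<bar>(\<integral>\<omega>. ?q N (Z \<theta> (?h N) x (p * N) \<omega>) \<partial>M) - (\<integral>\<omega>. ?q N (X x ?s \<omega>) \<partial>M)\<bar> \<le> L * (e + sqrt (4 * CK\<^sup>2 * ?h N * ?t))"
    proof -
      have "\<bar>(\<integral>\<omega>. ?q N (Z \<theta> (?h N) x (p * N) \<omega>) \<partial>M) - (\<integral>\<omega>. ?q N (X x ?s \<omega>) \<partial>M)\<bar>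
        = norm (\<integral>\<omega>. ?q N (Z \<theta> (?h N) x (p * N) \<omega>) - ?q N (X x ?s \<omega>) \<partial>M)" using qi by simp
      also have "\<dots> \<le> (\<integral>\<omega>. L * (norm (X x ?s \<omega> - Z \<theta> (?h N) x (p * N) \<omega>) + sqrt (4 * CK\<^sup>2 * ?h N * ?t)) \<partial>M)"
      proof (rule norm_integral_le_integral)
        fix \<omega> assume w: "\<omega> \<in> space M"
        have K: "Z \<theta> (?h N) x (p * N) \<omega> \<in> K" "X x ?s \<omega> \<in> K" using w th' pos x by (auto intro!: Z_in_K X_in_K)
        show "norm (?q N (Z \<theta> (?h N) x (p * N) \<omega>) - ?q N (X x ?s \<omega>)) \<le> L * (norm (X x ?s \<omega> - Z \<theta> (?h N) x (p * N) \<omega>) + sqrt (4 * CK\<^sup>2 * ?h N * ?t))"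
          using Q_funpow_almost_lipschitz[OF f h(1,3,4) th' K, of "q * N"] unfolding hq norm_minus_commute[of "X x ?s \<omega>"] by simp
      qed (use qi is' in auto)
      also have "\<dots> = L * ((\<integral>\<omega>. norm (X x ?s \<omega> - Z \<theta> (?h N) x (p * N) \<omega>) \<partial>M) + sqrt (4 * CK\<^sup>2 * ?h N * ?t))"
        using is' by (simp add: prob_space del: real_sqrt_mult)
      also have "\<dots> \<le> L * (e + sqrt (4 * CK\<^sup>2 * ?h N * ?t))" using elim(2) L by (intro mult_left_mono add_right_mono) auto
      finally show ?thesis .
    qed
    have 4: "\<bar>(\<integral>\<omega>. ?q N (X x ?s \<omega>) \<partial>M) - P ?s ?F x\<bar> \<le> L * e + (\<integral>\<omega>. ?g N \<omega> \<partial>M)"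
    proof -
      have gi: "integrable M (?g N)"
        using qi(2) Fi by (intro integrable_max) auto
      have "\<bar>(\<integral>\<omega>. ?q N (X x ?s \<omega>) \<partial>M) - P ?s ?F x\<bar> = norm (\<integral>\<omega>. ?q N (X x ?s \<omega>) - ?F (X x ?s \<omega>) \<partial>M)"
        unfolding P_def using qi Fi by simp
      also have "\<dots> \<le> (\<integral>\<omega>. L * e + ?g N \<omega> \<partial>M)"
        by (rule norm_integral_le_integral) (use qi Fi gi in auto)
      also have "\<dots> = L * e + (\<integral>\<omega>. ?g N \<omega> \<partial>M)" using gi by (simp add: prob_space)
      finally show ?thesis .
    qed
    show ?case using 1 3 4 unfolding 2 by linarith
  qed
  have "\<forall>\<^sub>F N in sequentially. ?A \<le> ?R (Suc N)" using ev by (subst eventually_sequentially_Suc)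
  from tendsto_lowerbound[OF lim this] show ?thesis by simp
qed

lemma semigroup:
  fixes p q :: nat
  assumes f: "L-lipschitz_on UNIV f" "\<And>z. \<bar>f z\<bar> \<le> c"
    and \<tau>: "0 < \<tau>" and p: "0 < p" and q: "0 < q" and x: "x \<in> K"
  shows "P (real (p + q) * \<tau>) f x = P (real p * \<tau>) (PK (real q * \<tau>) f) x"
proof -
  have L: "0 \<le> L" by (rule lipschitz_on_nonneg[OF f(1)])
  have "\<bar>P (real (p + q) * \<tau>) f x - P (real p * \<tau>) (PK (real q * \<tau>) f) x\<bar> \<le> 0"
  proof (rule field_le_epsilon)
    fix e :: real assume e: "0 < e"
    have "0 < e / (3 * L + 1)" using e L by simp
    from semigroup_approx[OF assms this]
    have "\<bar>P (real (p + q) * \<tau>) f x - P (real p * \<tau>) (PK (real q * \<tau>) f) x\<bar> \<le> 3 * L * (e / (3 * L + 1))" .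
    also have "\<dots> \<le> e" using e L by (simp add: field_simps)
    finally show "\<bar>P (real (p + q) * \<tau>) f x - P (real p * \<tau>) (PK (real q * \<tau>) f) x\<bar> \<le> 0 + e" by simp
  qed
  then show ?thesis by simp
qed

end

section \<open>Weak limits on compact sets\<close>

text \<open>A clipped cosine: 2-periodic, 0 on \<open>[0, 1/3]\<close> and 1 on
  \<open>[2/3, 1]\<close>.\<close>

definition bump :: "real \<Rightarrow> real" where "bump t = max 0 (min 1 (1/2 - cos (pi * t)))"

lemma bump_bounds: "0 \<le> bump t" "bump t \<le> 1" by (auto simp: bump_def)

lemma bump_0:
  assumes "0 \<le> t" "t \<le> 1/3" shows "bump t = 0"
proof -
  have "cos (pi / 3) \<le> cos (pi * t)"
    using assms by (intro cos_monotone_0_pi_le) (auto simp: field_simps)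
  then show ?thesis by (simp add: bump_def cos_60)
qed

lemma bump_1:
  assumes "2/3 \<le> t" "t \<le> 1" shows "bump t = 1"
proof -
  have "cos (pi * t) \<le> cos (2 * pi / 3)"
    using assms by (intro cos_monotone_0_pi_le) (auto simp: field_simps)
  then show ?thesis by (simp add: bump_def cos_120)
qed

lemma bump_periodic: "bump (t + 2 * real k) = bump t"
proof -
  have "pi * (t + 2 * real k) = pi * t + 2 * real k * pi" by (simp add: algebra_simps)
  then show ?thesis using cos.plus_of_nat[of "pi * t" k] unfolding bump_def by (simp add: mult.assoc mult.commute mult.left_commute)
qed

lemma continuous_bump: "continuous_on A bump"
  unfolding bump_def by (intro continuous_intros)

text \<open>Ternary digits \<open>0, 2\<close> are read off by \<open>bump\<close>, as in Schoenberg's space-filling curve.\<close>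

lemma ternary_point:
  fixes a :: "nat \<Rightarrow> bool"
  obtains t where "0 \<le> t" "t \<le> 1" "\<And>n. bump (3 ^ n * t) = of_bool (a n)"
proof -
  define r where "r n = (\<Sum>j. 2 * of_bool (a (n + j)) / 3 ^ Suc j :: real)" for n
  have geo: "(\<lambda>j. 2 / 3 ^ Suc j :: real) sums 1"
  proof -
    have "(\<lambda>j. (2/3) * (1/3) ^ j :: real) sums ((2/3) * (1 / (1 - 1/3)))" by (intro sums_mult geometric_sums) simp
    then show ?thesis by (simp add: power_one_over field_simps)
  qed
  have sm: "summable (\<lambda>j. 2 * of_bool (a (n + j)) / 3 ^ Suc j :: real)" for n
    by (rule summable_comparison_test'[OF sums_summable[OF geo], of 0]) (auto simp: divide_right_mono)
  have r: "0 \<le> r n" "r n \<le> 1" for n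
  proof -
    show "0 \<le> r n" unfolding r_def by (rule suminf_nonneg[OF sm]) simp
    have "r n \<le> (\<Sum>j. 2 / 3 ^ Suc j :: real)" unfolding r_def
      by (rule suminf_le[OF _ sm sums_summable[OF geo]]) (auto simp: divide_right_mono)
    then show "r n \<le> 1" using sums_unique[OF geo] by simp
  qed
  have rec: "3 * r n = 2 * of_bool (a n) + r (Suc n)" for n
  proof -
    have "(\<Sum>j. 2 * of_bool (a (n + Suc j)) / 3 ^ Suc (Suc j) :: real) = r (Suc n) / 3"
      unfolding r_def suminf_divide[OF sm, symmetric] by simp
    then show ?thesis using suminf_split_head[OF sm[of n]] unfolding r_def[of n] by simp
  qed
  \<comment> \<open>Multiplication by \<open>3 ^ n\<close> shifts the expansion by \<open>n\<close>
    digits. The digits shed are 0 or 2, so the integer part is even and the period 2 of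
    \<open>bump\<close> ignores it.\<close>
  have shift: "\<exists>k::nat. 3 ^ n * r 0 = r n + 2 * real k" for n
  proof (induction n)
    case (Suc n)
    then obtain k where "3 ^ n * r 0 = r n + 2 * real k" by blast
    then have "3 ^ Suc n * r 0 = r (Suc n) + 2 * real (of_bool (a n) + 3 * k)" using rec[of n] by simp
    then show ?case by blast
  qed (auto intro: exI[of _ 0])
  have "bump (3 ^ n * r 0) = of_bool (a n)" for n
  proof -
    obtain k where "3 ^ n * r 0 = r n + 2 * real k" using shift by blast
    then have "bump (3 ^ n * r 0) = bump (r n)" by (simp add: bump_periodic)
    also have "\<dots> = of_bool (a n)"
      using rec[of n] r[of n] r[of "Suc n"] by (cases "a n") (auto intro: bump_0 bump_1)
    finally show ?thesis .
  qed
  then show ?thesis using that r by blast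
qed

text \<open>Iteration of the doubling map: \<open>s\<close> is the remainder rescaled to the unit
  interval, and the digit is 1 when it is at least 1/2. The value 1 is a fixed point, with all
  digits 1.\<close>

lemma binary_expansion:
  fixes y :: real
  assumes "0 \<le> y" "y \<le> 1"
  obtains c :: "nat \<Rightarrow> bool" where "(\<lambda>k. of_bool (c k) / 2 ^ Suc k) sums y"
proof -
  define s where "s = rec_nat y (\<lambda>_ z. 2 * z - of_bool (z \<ge> 1/2))"
  have s_simps: "s 0 = y" "s (Suc k) = 2 * s k - of_bool (s k \<ge> 1/2)" for k by (simp_all add: s_def)
  have s: "0 \<le> s k \<and> s k \<le> 1" for k by (induction k) (use assms in \<open>auto simp: s_simps\<close>)
  have partial: "(\<Sum>k<n. of_bool (s k \<ge> 1/2) / 2 ^ Suc k) = y - s n / 2 ^ n" for n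
    by (induction n) (auto simp: s_simps field_simps)
  have "(\<lambda>n. s n / 2 ^ n) \<longlonglongrightarrow> 0"
  proof (rule tendsto_sandwich[OF _ _ tendsto_const])
    show "(\<lambda>n. 1 / 2 ^ n :: real) \<longlonglongrightarrow> 0" by (rule LIMSEQ_divide_realpow_zero) simp
  qed (use s in \<open>auto simp: divide_right_mono\<close>)
  then have "(\<lambda>n. y - s n / 2 ^ n) \<longlonglongrightarrow> y - 0" by (intro tendsto_intros)
  then have "(\<lambda>k. of_bool (s k \<ge> 1/2) / 2 ^ Suc k) sums y" unfolding sums_def partial by simp
  then show ?thesis by (rule that)
qed

text \<open>Coordinate \<open>i\<close> takes its binary digits from the ternary digits of
  \<open>t\<close> at the positions congruent to \<open>e i\<close> modulo the dimension.\<close>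

definition curve :: "('d::finite \<Rightarrow> nat) \<Rightarrow> real \<Rightarrow> real^'d" where
  "curve e t = (\<chi> i. \<Sum>k. bump (3 ^ (CARD('d) * k + e i) * t) / 2 ^ Suc k)"

lemma continuous_curve: "continuous_on UNIV (curve e)"
proof -
  have "continuous_on UNIV (\<lambda>t. \<Sum>k. bump (3 ^ (CARD('d) * k + e i) * t) / 2 ^ Suc k)" for e :: "'d::finite \<Rightarrow> nat" and i
  proof (rule uniform_limit_theorem)
    show "\<forall>\<^sub>F n in sequentially. continuous_on UNIV (\<lambda>t. \<Sum>k<n. bump (3 ^ (CARD('d) * k + e i) * t) / 2 ^ Suc k)"
      by (intro always_eventually allI continuous_intros continuous_on_compose2[OF continuous_bump[of UNIV]]) auto
    show "uniform_limit UNIV (\<lambda>n t. \<Sum>k<n. bump (3 ^ (CARD('d) * k + e i) * t) / 2 ^ Suc k)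
        (\<lambda>t. \<Sum>k. bump (3 ^ (CARD('d) * k + e i) * t) / 2 ^ Suc k) sequentially"
    proof (rule Weierstrass_m_test)
      show "norm (bump (3 ^ (CARD('d) * k + e i) * t) / 2 ^ Suc k) \<le> (1/2) ^ Suc k" for k t
        using bump_bounds[of "3 ^ (CARD('d) * k + e i) * t"] by (simp add: power_one_over field_simps)
      show "summable (\<lambda>k. (1/2 :: real) ^ Suc k)" by (intro summable_Suc_iff[THEN iffD2] summable_geometric) simp
    qed
  qed simp
  then show ?thesis unfolding curve_def[abs_def] by (intro continuous_on_vec_lambda) auto
qed

text \<open>The binary digits of all coordinates are interleaved into one ternary point: at position
  \<open>n\<close> the remainder modulo the dimension selects the coordinate, the quotient its
  digit.\<close>

lemma curve_surjective:
  fixes e :: "'d::finite \<Rightarrow> nat" and y :: "real^'d"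
  assumes e: "inj e" "\<And>i. e i < CARD('d)" and y: "\<And>i. 0 \<le> y $ i" "\<And>i. y $ i \<le> 1"
  shows "\<exists>t\<in>{0..1}. curve e t = y"
proof -
  have "\<exists>c :: nat \<Rightarrow> bool. (\<lambda>k. of_bool (c k) / 2 ^ Suc k) sums (y $ i)" for i
    using binary_expansion[OF y(1)[of i] y(2)[of i]] by blast
  then obtain c :: "'d \<Rightarrow> nat \<Rightarrow> bool" where c: "\<And>i. (\<lambda>k. of_bool (c i k) / 2 ^ Suc k) sums (y $ i)" by metis
  obtain t where t: "0 \<le> t" "t \<le> 1" "\<And>n. bump (3 ^ n * t) = of_bool (c (inv e (n mod CARD('d))) (n div CARD('d)))"
    using ternary_point[of "\<lambda>n. c (inv e (n mod CARD('d))) (n div CARD('d))"] by metis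
  have "bump (3 ^ (CARD('d) * k + e i) * t) = of_bool (c i k)" for i k
    using t(3)[of "CARD('d) * k + e i"] e by simp
  moreover have "(\<Sum>k. of_bool (c i k) / 2 ^ Suc k) = y $ i" for i using sums_unique[OF c[of i]] by simp
  ultimately have "curve e t = y" unfolding curve_def by (simp add: vec_eq_iff)
  then show ?thesis using t by auto
qed

lemma ex_space_filling:
  fixes K :: "(real^'d) set"
  assumes K: "compact K"
  obtains G :: "real \<Rightarrow> real^'d" and s :: "real^'d \<Rightarrow> real"
  where "continuous_on UNIV G" "s \<in> borel_measurable borel" "\<And>x. s x \<in> {0..1}" "\<And>x. x \<in> K \<Longrightarrow> G (s x) = x"
proof -
  obtain R where R: "0 < R" "\<And>x. x \<in> K \<Longrightarrow> norm x \<le> R" using compact_imp_bounded[OF K] bounded_pos by metis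
  obtain e :: "'d \<Rightarrow> nat" where e: "bij_betw e UNIV {0..<CARD('d)}"
    using ex_bij_betw_finite_nat[of "UNIV :: 'd set"] by auto
  define G where "G t = (\<chi> i. R * (2 * curve e t $ i - 1))" for t
  have G: "continuous_on UNIV G" unfolding G_def[abs_def]
    by (intro continuous_on_vec_lambda continuous_intros continuous_curve)
  have onto: "\<exists>t\<in>{0..1}. G t = x" if x: "x \<in> K" for x
  proof -
    have xi: "\<bar>x $ i\<bar> \<le> R" for i using R(2)[OF x] component_le_norm_cart[of x i] by linarith
    have "\<exists>t\<in>{0..1}. curve e t = (\<chi> i. (x $ i / R + 1) / 2)"
    proof (rule curve_surjective)
      show "inj e" using e by (simp add: bij_betw_def)
      show "e i < CARD('d)" for i using e by (auto simp: bij_betw_def)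
      show "0 \<le> (\<chi> i. (x $ i / R + 1) / 2) $ i" "(\<chi> i. (x $ i / R + 1) / 2) $ i \<le> 1" for i
        using xi[of i] R(1) by (auto simp: field_simps abs_le_iff)
    qed
    then obtain t where t: "t \<in> {0..1}" "curve e t = (\<chi> i. (x $ i / R + 1) / 2)" by blast
    have "G t = x" using R(1) by (simp add: G_def t(2) vec_eq_iff field_simps)
    with t show ?thesis by blast
  qed
  define A where "A x = {t\<in>{0..1}. G t = x}" for x
  \<comment> \<open>The first parameter at which the curve visits \<open>x\<close>. On
    \<open>K\<close> its sublevel sets are images of compact intervals under \<open>G\<close>, so
    this right inverse is Borel even where it is discontinuous.\<close>
  define s where "s x = (if x \<in> K then Inf (A x) else 0)" for x
  have clA: "closed (A x)" for x
  proof -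
    have "A x = {0..1} \<inter> G -` {x}" by (auto simp: A_def)
    then show ?thesis using continuous_closed_vimage[of "{x}" G] G by (simp add: closed_Int continuous_on_eq_continuous_at)
  qed
  have sA: "s x \<in> A x" if "x \<in> K" for x
  proof -
    have "A x \<noteq> {}" using onto[OF that] by (auto simp: A_def)
    moreover have "bdd_below (A x)" by (auto simp: A_def intro: bdd_belowI[of _ 0])
    ultimately show ?thesis using closed_contains_Inf[OF _ _ clA] that by (simp add: s_def)
  qed
  have s01: "s x \<in> {0..1}" for x using sA[of x] by (cases "x \<in> K") (auto simp: A_def s_def)
  have le_iff: "s x \<le> a \<longleftrightarrow> x \<in> G ` {0..min a 1}" if "x \<in> K" for x a
  proof
    assume "s x \<le> a"
    then show "x \<in> G ` {0..min a 1}" using sA[OF that] by (auto simp: A_def intro!: image_eqI[of _ _ "s x"])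
  next
    assume "x \<in> G ` {0..min a 1}"
    then obtain t where t: "t \<in> {0..min a 1}" "G t = x" by auto
    then have "t \<in> A x" by (auto simp: A_def)
    then have "Inf (A x) \<le> t" by (intro cInf_lower) (auto simp: A_def intro: bdd_belowI[of _ 0])
    then show "s x \<le> a" using that t by (simp add: s_def)
  qed
  have "s \<in> borel_measurable borel"
    unfolding borel_measurable_iff_le
  proof
    fix a
    have "compact (G ` {0..min a 1})" by (intro compact_continuous_image continuous_on_subset[OF G]) auto
    then have [measurable]: "G ` {0..min a 1} \<in> sets borel" "K \<in> sets borel" using K by (auto dest: compact_imp_closed)
    have "{x \<in> space borel. s x \<le> a} = (K \<inter> G ` {0..min a 1}) \<union> (if 0 \<le> a then - K else {})"
      using le_iff by (auto simp: s_def)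
    also have "\<dots> \<in> sets borel" by auto
    finally show "{x \<in> space borel. s x \<le> a} \<in> sets borel" .
  qed
  then show ?thesis using that[OF G _ s01] sA by (auto simp: A_def)
qed

text \<open>The measures are carried to \<open>{0..1}\<close> by \<open>s\<close>, where tightness
  is immediate, and the limit is carried back by \<open>G\<close>. Continuity is required of
  \<open>G\<close> and not of \<open>s\<close>, because the test function on the line is
  \<open>f\<close> composed with \<open>G\<close>, and \<open>G (s x) = x\<close> on
  \<open>K\<close>.\<close>

lemma weak_limit_on_compact:
  fixes K :: "(real^'d) set" and \<nu> :: "nat \<Rightarrow> (real^'d) measure"
  assumes K: "compact K" and prob: "\<And>n. prob_space (\<nu> n)" and sets: "\<And>n. sets (\<nu> n) = sets borel"
    and supp: "\<And>n. AE x in \<nu> n. x \<in> K"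
  obtains r \<mu> where "strict_mono r" "prob_space \<mu>" "sets \<mu> = sets borel"
    "\<And>f B. continuous_on UNIV f \<Longrightarrow> (\<And>x. \<bar>f x\<bar> \<le> B) \<Longrightarrow> (\<lambda>n. \<integral>x. f x \<partial>\<nu> (r n)) \<longlonglongrightarrow> (\<integral>x. f x \<partial>\<mu> :: real)"
proof -
  obtain G s where G: "continuous_on UNIV G" and s: "s \<in> borel_measurable borel" "\<And>x. s x \<in> {0..1::real}"
    and Gs: "\<And>x. x \<in> K \<Longrightarrow> G (s x) = x" using ex_space_filling[OF K] by metis
  have sm: "s \<in> borel_measurable (\<nu> n)" for n using s(1) sets[of n] by (simp cong: measurable_cong_sets)
  have Gm: "G \<in> borel_measurable borel" by (rule borel_measurable_continuous_onI[OF G])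
  define m where "m n = distr (\<nu> n) borel s" for n
  have rd: "real_distribution (m n)" for n
    unfolding m_def real_distribution_def real_distribution_axioms_def
    using prob_space.prob_space_distr[OF prob sm] by simp
  have "tight m" unfolding tight_def
  proof (intro conjI allI impI)
    fix \<epsilon> :: real assume "0 < \<epsilon>"
    have "measure (m n) {-1<..2} = 1" for n
    proof -
      have "s x \<in> {-1<..2}" for x using s(2)[of x] by auto
      then have "s -` {-1<..2} \<inter> space (\<nu> n) = space (\<nu> n)" by blast
      then show ?thesis unfolding m_def using prob_space.prob_space[OF prob[of n]] by (simp add: measure_distr[OF sm])
    qed
    then show "\<exists>a b. a < b \<and> (\<forall>n. 1 - \<epsilon> < measure (m n) {a<..b})" using \<open>0 < \<epsilon>\<close> by (intro exI[of _ "-1"] exI[of _ 2]) auto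
  qed (rule rd)
  from tight_imp_convergent_subsubsequence[OF this strict_mono_id]
  obtain r M' where r: "strict_mono r" and M': "real_distribution M'" and wc: "weak_conv_m (m \<circ> id \<circ> r) M'" by blast
  interpret M': real_distribution M' by fact
  have GM': "G \<in> borel_measurable M'" using Gm by (simp cong: measurable_cong_sets)
  define \<mu> where "\<mu> = distr M' borel G"
  show ?thesis
  proof (rule that[OF r])
    show "prob_space \<mu>" unfolding \<mu>_def by (rule M'.prob_space_distr[OF GM'])
    show "sets \<mu> = sets borel" by (simp add: \<mu>_def)
    fix f :: "real^'d \<Rightarrow> real" and B assume f: "continuous_on UNIV f" "\<And>x. \<bar>f x\<bar> \<le> B"
    have fm: "f \<in> borel_measurable borel" by (rule borel_measurable_continuous_onI[OF f(1)])
    have fG: "(\<lambda>t. f (G t)) \<in> borel_measurable borel" by (rule measurable_compose[OF Gm fm])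
    have "(\<lambda>n. integral\<^sup>L ((m \<circ> id \<circ> r) n) (\<lambda>t. f (G t))) \<longlonglongrightarrow> integral\<^sup>L M' (\<lambda>t. f (G t))"
    proof (rule weak_conv_imp_integral_bdd_continuous_conv[OF _ M' wc])
      show "real_distribution ((m \<circ> id \<circ> r) n)" for n using rd by simp
      have "continuous_on UNIV (\<lambda>t. f (G t))" by (rule continuous_on_compose2[OF f(1) G]) auto
      then show "isCont (\<lambda>t. f (G t)) x" for x by (simp add: continuous_on_eq_continuous_at)
      show "norm (f (G x)) \<le> B" for x using f(2) by simp
    qed
    moreover have "integral\<^sup>L ((m \<circ> id \<circ> r) n) (\<lambda>t. f (G t)) = (\<integral>x. f x \<partial>\<nu> (r n))" for n
    proof -
      have "integral\<^sup>L (m (r n)) (\<lambda>t. f (G t)) = (\<integral>x. f (G (s x)) \<partial>\<nu> (r n))" unfolding m_def by (rule integral_distr[OF sm fG])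
      also have "\<dots> = (\<integral>x. f x \<partial>\<nu> (r n))"
      proof (rule integral_cong_AE)
        show "(\<lambda>x. f (G (s x))) \<in> borel_measurable (\<nu> (r n))" by (rule measurable_compose[OF sm fG])
        show "f \<in> borel_measurable (\<nu> (r n))" using fm sets[of "r n"] by (simp cong: measurable_cong_sets)
        show "AE x in \<nu> (r n). f (G (s x)) = f x" using supp[of "r n"] by eventually_elim (simp add: Gs)
      qed
      finally show ?thesis by simp
    qed
    moreover have "(\<integral>x. f x \<partial>\<mu>) = integral\<^sup>L M' (\<lambda>t. f (G t))" unfolding \<mu>_def by (rule integral_distr[OF GM' fm])
    ultimately show "(\<lambda>n. \<integral>x. f x \<partial>\<nu> (r n)) \<longlonglongrightarrow> (\<integral>x. f x \<partial>\<mu>)" by simp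
  qed
qed

section \<open>Lipschitz approximations to indicators of closed sets\<close>

definition near :: "'b::metric_space set \<Rightarrow> nat \<Rightarrow> 'b \<Rightarrow> real" where
  "near A n x = max 0 (1 - real n * infdist x A)"

lemma near_bounds: "0 \<le> near A n x" "near A n x \<le> 1"
  by (auto simp: near_def infdist_nonneg)

lemma near_abs: "\<bar>near A n x\<bar> \<le> 1" using near_bounds[of A n x] by simp

lemma near_lipschitz: "(real n)-lipschitz_on UNIV (near A n)"
proof (rule lipschitz_onI)
  fix x y
  have "\<bar>near A n x - near A n y\<bar> \<le> \<bar>real n * infdist x A - real n * infdist y A\<bar>" unfolding near_def by (auto simp: max_def)
  also have "\<dots> = real n * \<bar>infdist x A - infdist y A\<bar>" by (simp add: right_diff_distrib[symmetric] abs_mult)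
  also have "\<dots> \<le> real n * dist x y" by (intro mult_left_mono infdist_triangle_abs) simp
  finally show "dist (near A n x) (near A n y) \<le> real n * dist x y" by (simp add: dist_real_def)
qed simp

lemma near_continuous: "continuous_on S (near A n)"
  using continuous_on_subset[OF lipschitz_on_continuous_on[OF near_lipschitz]] by blast

lemma near_measurable [measurable]: "near A n \<in> borel_measurable borel"
  by (rule borel_measurable_continuous_onI[OF near_continuous])

text \<open>Nonemptiness matters: \<open>infdist\<close> to the empty set is 0 by convention, which
  makes \<open>near {} n\<close> constantly 1.\<close>

lemma near_tendsto:
  assumes "closed A" "A \<noteq> {}"
  shows "(\<lambda>n. near A n x) \<longlonglongrightarrow> indicator A x"
proof (cases "x \<in> A")
  case True
  then show ?thesis by (simp add: near_def)
next
  case False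
  then have pos: "0 < infdist x A" using infdist_pos_not_in_closed[OF assms False] by simp
  obtain N where N: "1 / infdist x A < real N" using reals_Archimedean2 by blast
  have "\<forall>\<^sub>F n in sequentially. near A n x = 0"
    using eventually_ge_at_top[of N]
  proof eventually_elim
    case (elim n)
    then have "1 / infdist x A < real n" using N by (meson less_le_trans of_nat_mono)
    then show ?case using pos by (simp add: near_def field_simps)
  qed
  then show ?thesis using False by (simp add: tendsto_eventually)
qed

lemma measure_closed_limit:
  fixes A :: "'b::metric_space set"
  assumes "prob_space \<mu>" "sets \<mu> = sets borel" "closed A" "A \<noteq> {}"
  shows "(\<lambda>n. \<integral>x. near A n x \<partial>\<mu>) \<longlonglongrightarrow> measure \<mu> A"
proof -
  interpret prob_space \<mu> by fact
  have A: "A \<in> sets \<mu>" using assms by simp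
  have [measurable]: "near A n \<in> borel_measurable \<mu>" for n using assms(2) by (simp cong: measurable_cong_sets)
  have "(\<lambda>n. \<integral>x. near A n x \<partial>\<mu>) \<longlonglongrightarrow> (\<integral>x. indicator A x \<partial>\<mu>)"
    by (rule integral_dominated_convergence[where w="\<lambda>_. 1"])
       (use A near_abs near_tendsto[OF assms(3,4)] in \<open>auto intro!: AE_I2\<close>)
  then show ?thesis using A by simp
qed

text \<open>Closed sets are an intersection-stable generator, and their indicators are limits of the
  functions \<open>near\<close>. Hence invariance can be tested on bounded Lipschitz functions, a
  class that \<open>PK\<close> preserves.\<close>

lemma borel_measure_eqI_lipschitz:
  fixes \<mu> \<nu> :: "('b::metric_space) measure"
  assumes \<mu>: "prob_space \<mu>" "sets \<mu> = sets borel" and \<nu>: "prob_space \<nu>" "sets \<nu> = sets borel"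
    and eq: "\<And>f L. L-lipschitz_on UNIV f \<Longrightarrow> (\<And>x. \<bar>f x\<bar> \<le> (1::real)) \<Longrightarrow> (\<integral>x. f x \<partial>\<mu>) = (\<integral>x. f x \<partial>\<nu>)"
  shows "\<mu> = \<nu>"
proof (rule measure_eqI_generator_eq[where E="Collect closed" and \<Omega>=UNIV and A="\<lambda>_. UNIV"])
  interpret m: prob_space \<mu> by fact
  interpret n: prob_space \<nu> by fact
  show "sets \<mu> = sigma_sets UNIV (Collect closed)" "sets \<nu> = sigma_sets UNIV (Collect closed)"
    using \<mu>(2) \<nu>(2) by (simp_all add: borel_eq_closed)
  show "Int_stable (Collect closed)" by (auto simp: Int_stable_def)
  show "emeasure \<mu> UNIV \<noteq> \<infinity>" by simp
  fix A :: "'b set" assume "A \<in> Collect closed"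
  then have A: "closed A" by simp
  show "emeasure \<mu> A = emeasure \<nu> A"
  proof (cases "A = {}")
    case False
    have "(\<integral>x. near A n x \<partial>\<mu>) = (\<integral>x. near A n x \<partial>\<nu>)" for n by (rule eq[OF near_lipschitz near_abs])
    with measure_closed_limit[OF \<mu> A False] measure_closed_limit[OF \<nu> A False]
    have "measure \<mu> A = measure \<nu> A" using LIMSEQ_unique by simp
    then show ?thesis by (simp add: m.emeasure_eq_measure n.emeasure_eq_measure)
  qed simp
qed auto

section \<open>The invariant measure\<close>

text \<open>The same reduction for kernels: integrals of \<open>near\<close> suffice, and for these
  the contraction supplies Lipschitz dependence on the starting point.\<close>

lemma measurable_prob_kernel:
  fixes \<kappa> :: "'a \<Rightarrow> ('b::metric_space) measure"
  assumes prob: "\<And>y. prob_space (\<kappa> y)" and sets: "\<And>y. sets (\<kappa> y) = sets borel"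
    and near: "\<And>A n. (\<lambda>y. \<integral>x. near A n x \<partial>\<kappa> y) \<in> borel_measurable N"
  shows "\<kappa> \<in> measurable N (subprob_algebra borel)"
proof (rule measurable_subprob_algebra_generated[where \<Omega>=UNIV and G="Collect closed"])
  show "sets borel = sigma_sets UNIV (Collect closed :: 'b set set)" by (simp add: borel_eq_closed)
  show "Int_stable (Collect closed :: 'b set set)" by (auto simp: Int_stable_def)
  show "subprob_space (\<kappa> y)" for y using prob by (rule prob_space_imp_subprob_space)
  have em: "emeasure (\<kappa> y) A = ennreal (measure (\<kappa> y) A)" for y A
    using finite_measure.emeasure_eq_measure[of "\<kappa> y" A] prob[of y] by (simp add: prob_space_def)
  show closed: "(\<lambda>y. emeasure (\<kappa> y) A) \<in> borel_measurable N" if "A \<in> Collect closed" for A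
  proof (cases "A = {}")
    case False
    have "(\<lambda>y. measure (\<kappa> y) A) \<in> borel_measurable N"
      by (rule borel_measurable_LIMSEQ_real[OF measure_closed_limit[OF prob sets _ False] near]) (use that in auto)
    then show ?thesis unfolding em by measurable
  qed simp
  show "(\<lambda>y. emeasure (\<kappa> y) UNIV) \<in> borel_measurable N" by (rule closed) simp
qed (use sets in auto)

context reflected_sde
begin

definition law :: "real \<Rightarrow> real^'d \<Rightarrow> (real^'d) measure" where
  "law t y = distr M borel (X (pK y) t)"

text \<open>The synchronous coupling started at \<open>x\<close> and \<open>y\<close>, viewed as a
  kernel in \<open>y\<close> so that it can be averaged over an invariant measure.\<close>

definition law2 :: "real \<Rightarrow> real^'d \<Rightarrow> real^'d \<Rightarrow> ((real^'d) \<times> (real^'d)) measure" where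
  "law2 t x y = distr M borel (\<lambda>\<omega>. (X x t \<omega>, X (pK y) t \<omega>))"

lemma X_pK_measurable [measurable]: "0 \<le> t \<Longrightarrow> X (pK y) t \<in> borel_measurable M"
  by (rule X_measurable_M[OF pK_in])

lemma prob_space_law: "0 \<le> t \<Longrightarrow> prob_space (law t y)"
  unfolding law_def by (intro prob_space_distr X_pK_measurable)

lemma sets_law [simp]: "sets (law t y) = sets borel" by (simp add: law_def)

lemma integral_law:
  assumes "0 \<le> t" and [measurable]: "f \<in> borel_measurable borel"
  shows "(\<integral>z. f z \<partial>law t y) = PK t f y"
  unfolding law_def PK_def P_def using assms by (intro integral_distr X_pK_measurable)

lemma law_measurable: "0 < t \<Longrightarrow> law t \<in> measurable borel (subprob_algebra borel)"
proof (rule measurable_prob_kernel)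
  assume t: "0 < t"
  then show "prob_space (law t y)" for y by (intro prob_space_law) simp
  have "(\<lambda>y. \<integral>x. near A n x \<partial>law t y) = PK t (near A n)" for A n using t by (simp add: integral_law)
  then show "(\<lambda>y. \<integral>x. near A n x \<partial>law t y) \<in> borel_measurable borel" for A n
    using borel_measurable_continuous_onI[OF lipschitz_on_continuous_on[OF PK_lipschitz[OF near_lipschitz near_abs t]]] by simp
qed simp

lemma pair_X_measurable: "x \<in> K \<Longrightarrow> 0 \<le> t \<Longrightarrow> (\<lambda>\<omega>. (X x t \<omega>, X (pK y) t \<omega>)) \<in> borel_measurable M"
  by (intro borel_measurable_Pair X_measurable_M X_pK_measurable)

text \<open>Contraction in first mean makes the integral of a Lipschitz function of the pair
  Lipschitz in \<open>y\<close>. Measurability in the starting point comes from this estimate, as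
  \<open>X\<close> is an unstructured family in that argument.\<close>

lemma law2_measurable:
  assumes x: "x \<in> K" and t: "0 < t"
  shows "law2 t x \<in> measurable borel (subprob_algebra borel)"
proof (rule measurable_prob_kernel)
  have t0: "0 \<le> t" using t by simp
  note pm = pair_X_measurable[OF x t0]
  show "prob_space (law2 t x y)" for y unfolding law2_def by (rule prob_space_distr[OF pm])
  show "sets (law2 t x y) = sets borel" for y by (simp add: law2_def)
  fix A :: "((real^'d) \<times> (real^'d)) set" and n
  let ?N = "near A n"
  have int: "integrable M (\<lambda>\<omega>. ?N (X x t \<omega>, X (pK y) t \<omega>))" for y
    by (rule integrable_const_bound[where B=1])
       (use near_abs[of A n] measurable_compose[OF pm near_measurable] in auto)
  have eq: "(\<integral>p. ?N p \<partial>law2 t x y) = (\<integral>\<omega>. ?N (X x t \<omega>, X (pK y) t \<omega>) \<partial>M)" for y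
    unfolding law2_def by (rule integral_distr[OF pm near_measurable])
  have "(real n * exp (- \<delta> * t))-lipschitz_on UNIV (\<lambda>y. \<integral>p. ?N p \<partial>law2 t x y)"
  proof (rule lipschitz_onI)
    fix y z
    have "dist (\<integral>p. ?N p \<partial>law2 t x y) (\<integral>p. ?N p \<partial>law2 t x z)
      = norm (\<integral>\<omega>. ?N (X x t \<omega>, X (pK y) t \<omega>) - ?N (X x t \<omega>, X (pK z) t \<omega>) \<partial>M)"
      unfolding eq using int by (simp add: dist_norm)
    also have "\<dots> \<le> (\<integral>\<omega>. real n * norm (X (pK y) t \<omega> - X (pK z) t \<omega>) \<partial>M)"
    proof (rule norm_integral_le_integral)
      fix \<omega>
      have "dist (?N (X x t \<omega>, X (pK y) t \<omega>)) (?N (X x t \<omega>, X (pK z) t \<omega>)) \<le> real n * dist (X x t \<omega>, X (pK y) t \<omega>) (X x t \<omega>, X (pK z) t \<omega>)"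
        by (rule lipschitz_onD[OF near_lipschitz]) auto
      then show "norm (?N (X x t \<omega>, X (pK y) t \<omega>) - ?N (X x t \<omega>, X (pK z) t \<omega>)) \<le> real n * norm (X (pK y) t \<omega> - X (pK z) t \<omega>)"
        by (simp add: dist_Pair_Pair dist_norm)
    qed (use int X_diff_integrable[OF pK_in pK_in t0] in auto)
    also have "\<dots> \<le> real n * (exp (- \<delta> * t) * norm (pK y - pK z))"
      using X_contraction_L1[OF pK_in pK_in t] by (simp add: mult_left_mono)
    also have "\<dots> \<le> real n * (exp (- \<delta> * t) * dist y z)"
      using pK_lipschitz by (intro mult_left_mono) (auto simp: dist_norm)
    finally show "dist (\<integral>p. ?N p \<partial>law2 t x y) (\<integral>p. ?N p \<partial>law2 t x z) \<le> real n * exp (- \<delta> * t) * dist y z" by simp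
  qed simp
  then show "(\<lambda>y. \<integral>p. ?N p \<partial>law2 t x y) \<in> borel_measurable borel"
    by (intro borel_measurable_continuous_onI lipschitz_on_continuous_on)
qed

text \<open>Invariance includes \<open>t = 0\<close>, where the equation is imposed only almost
  surely. All Riemann sums vanish there and \<open>ito_part x 0\<close> is \<open>X x 0 - x\<close>,
  so a constant sequence of probabilities tends to 0.\<close>

lemma X_0: "x \<in> K \<Longrightarrow> AE \<omega> in M. X x 0 \<omega> = x"
proof -
  assume x: "x \<in> K"
  note [measurable] = X_measurable_M[OF x order_refl]
  have null: "AE \<omega> in M. \<not> 1 / Suc n < norm (X x 0 \<omega> - x)" for n
  proof -
    have "ito_sum x (0 / 2 ^ k) (2 ^ k) \<omega> - ito_part x 0 \<omega> = - (X x 0 \<omega> - x)" if "\<omega> \<in> space M" for k \<omega>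
      using that by (simp add: ito_sum_def dsum_def ito_part_def \<eta>_0[OF x])
    then have "{\<omega> \<in> space M. 1 / Suc n < norm (ito_sum x (0 / 2 ^ k) (2 ^ k) \<omega> - ito_part x 0 \<omega>)} = {\<omega> \<in> space M. 1 / Suc n < norm (X x 0 \<omega> - x)}" for k
      by (intro Collect_cong conj_cong refl) (simp only: norm_minus_cancel)
    then have "(\<lambda>k::nat. prob {\<omega> \<in> space M. 1 / Suc n < norm (X x 0 \<omega> - x)}) \<longlonglongrightarrow> 0"
      using ito_part_dyadic[OF x order_refl, of "1 / Suc n"] by simp
    then have "prob {\<omega> \<in> space M. 1 / Suc n < norm (X x 0 \<omega> - x)} = 0" by (simp add: LIMSEQ_const_iff)
    then show ?thesis by (subst AE_iff_measurable[OF _ refl]) (auto simp: emeasure_eq_measure)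
  qed
  then have "AE \<omega> in M. \<forall>n. \<not> 1 / Suc n < norm (X x 0 \<omega> - x)" unfolding AE_all_countable by blast
  then show "AE \<omega> in M. X x 0 \<omega> = x"
  proof eventually_elim
    case (elim \<omega>)
    show ?case
    proof (rule ccontr)
      assume "X x 0 \<omega> \<noteq> x"
      then have "0 < norm (X x 0 \<omega> - x)" by simp
      then obtain n where "inverse (real (Suc n)) < norm (X x 0 \<omega> - x)" using reals_Archimedean by blast
      then show False using elim by (auto simp: inverse_eq_divide)
    qed
  qed
qed

abbreviation "inv_law \<mu> \<equiv> invariant_prob (\<lambda>t x. distr M borel (X x t)) K \<mu>"

lemma AE_in_K:
  fixes \<mu> :: "(real^'d) measure"
  assumes "prob_space \<mu>" "sets \<mu> = sets borel" "emeasure \<mu> K = 1"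
  shows "AE y in \<mu>. y \<in> K"
proof -
  interpret mu: prob_space \<mu> by fact
  have "mu.prob K = 1" using assms(3) by (simp add: measure_def)
  moreover have "K \<in> sets \<mu>" using assms(2) by simp
  ultimately show ?thesis using mu.AE_in_set_eq_1 by blast
qed

text \<open>The measure is carried by \<open>K\<close>, where \<open>pK\<close> is the identity; the
  set integral in \<open>invariant_prob\<close> becomes an ordinary integral of a kernel defined
  everywhere.\<close>

lemma set_nn_integral_law:
  assumes "prob_space \<mu>" "sets \<mu> = sets borel" "emeasure \<mu> K = 1"
  shows "(\<integral>\<^sup>+x\<in>K. emeasure (distr M borel (X x t)) A \<partial>\<mu>) = (\<integral>\<^sup>+y. emeasure (law t y) A \<partial>\<mu>)"
  using AE_in_K[OF assms] by (intro nn_integral_cong_AE) (auto simp: law_def pK_self elim!: eventually_mono)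

lemma integral_bind_law:
  assumes \<mu>: "prob_space \<mu>" "sets \<mu> = sets borel" and t: "0 < t"
    and f: "L-lipschitz_on UNIV f" "\<And>x. \<bar>f x\<bar> \<le> (1::real)"
  shows "(\<integral>x. f x \<partial>(\<mu> \<bind> law t)) = (\<integral>y. PK t f y \<partial>\<mu>)"
proof -
  interpret mu: prob_space \<mu> by fact
  have fm: "f \<in> borel_measurable borel" by (rule borel_measurable_continuous_onI[OF lipschitz_on_continuous_on[OF f(1)]])
  have k: "law t \<in> measurable \<mu> (subprob_algebra borel)" using law_measurable[OF t] \<mu>(2) by (simp cong: measurable_cong_sets)
  have "(\<integral>x. f x \<partial>(\<mu> \<bind> law t)) = (\<integral>y. (\<integral>x. f x \<partial>law t y) \<partial>\<mu>)"
  proof (rule integral_bind[where K=borel and B=1 and B'=1, OF fm f(2) k mu.finite_measure_axioms])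
    show "AE y in \<mu>. emeasure (law t y) (space (law t y)) \<le> ennreal 1"
      using prob_space.emeasure_space_1[OF prob_space_law[OF less_imp_le[OF t]]] by (intro AE_I2) simp
  qed
  then show ?thesis using t by (simp add: integral_law fm)
qed

lemma prob_space_bind_law:
  assumes \<mu>: "prob_space \<mu>" "sets \<mu> = sets borel" and t: "0 < t"
  shows "prob_space (\<mu> \<bind> law t)" "sets (\<mu> \<bind> law t) = sets borel"
    "A \<in> sets borel \<Longrightarrow> emeasure (\<mu> \<bind> law t) A = (\<integral>\<^sup>+y. emeasure (law t y) A \<partial>\<mu>)"
proof -
  interpret mu: prob_space \<mu> by fact
  have k: "law t \<in> measurable \<mu> (subprob_algebra borel)" using law_measurable[OF t] \<mu>(2) by (simp cong: measurable_cong_sets)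
  show "prob_space (\<mu> \<bind> law t)" using t by (intro mu.prob_space_bind[OF _ k] AE_I2 prob_space_law) simp
  show "sets (\<mu> \<bind> law t) = sets borel" by (intro sets_bind sets_law mu.not_empty)
  show "A \<in> sets borel \<Longrightarrow> emeasure (\<mu> \<bind> law t) A = (\<integral>\<^sup>+y. emeasure (law t y) A \<partial>\<mu>)"
    by (rule emeasure_bind[OF mu.not_empty k])
qed

lemma inv_law_bind:
  assumes inv: "inv_law \<mu>" and t: "0 < t"
  shows "\<mu> \<bind> law t = \<mu>"
proof (rule measure_eqI)
  have \<mu>: "prob_space \<mu>" "sets \<mu> = sets borel" "emeasure \<mu> K = 1"
    and eq: "\<And>A. A \<in> sets borel \<Longrightarrow> emeasure \<mu> A = (\<integral>\<^sup>+x\<in>K. emeasure (distr M borel (X x t)) A \<partial>\<mu>)"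
    using inv t unfolding invariant_prob_def by auto
  show "sets (\<mu> \<bind> law t) = sets \<mu>" using prob_space_bind_law(2)[OF \<mu>(1,2) t] \<mu>(2) by simp
  fix A assume "A \<in> sets (\<mu> \<bind> law t)"
  then have A: "A \<in> sets borel" using prob_space_bind_law(2)[OF \<mu>(1,2) t] by simp
  show "emeasure (\<mu> \<bind> law t) A = emeasure \<mu> A"
    unfolding prob_space_bind_law(3)[OF \<mu>(1,2) t A] eq[OF A] set_nn_integral_law[OF \<mu>] ..
qed

text \<open>A Lipschitz observable forgets its starting point exponentially fast, uniformly because
  \<open>K\<close> is bounded. Both uniqueness and existence rest on this.\<close>

lemma PK_close:
  assumes f: "L-lipschitz_on UNIV f" "\<And>x. \<bar>f x\<bar> \<le> c" and t: "0 < t"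
  shows "\<bar>PK t f y - PK t f z\<bar> \<le> L * exp (- \<delta> * t) * (2 * CK)"
proof -
  have "\<bar>PK t f y - PK t f z\<bar> \<le> L * exp (- \<delta> * t) * norm (pK y - pK z)"
    unfolding PK_def by (rule P_lipschitz[OF f pK_in pK_in t])
  also have "\<dots> \<le> L * exp (- \<delta> * t) * (2 * CK)"
    using lipschitz_on_nonneg[OF f(1)] by (intro mult_left_mono K_diff_bound pK_in) auto
  finally show ?thesis .
qed

lemma integrable_PK:
  assumes "prob_space \<mu>" "sets \<mu> = sets borel" and f: "L-lipschitz_on UNIV f" "\<And>x. \<bar>f x\<bar> \<le> c" and t: "0 < t"
  shows "integrable \<mu> (PK t f)"
proof -
  interpret mu: prob_space \<mu> by fact
  have "PK t f \<in> borel_measurable \<mu>"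
    using borel_measurable_continuous_onI[OF lipschitz_on_continuous_on[OF PK_lipschitz[OF f t]]] assms(2) by (simp cong: measurable_cong_sets)
  then show ?thesis using P_bound[OF f(2)] by (intro mu.integrable_const_bound[where B=c]) (auto simp: PK_def)
qed

lemma exp_decay: "(\<lambda>n. L * exp (- \<delta> * real (Suc n)) * c) \<longlonglongrightarrow> 0"
proof -
  have "(\<lambda>n. exp (- \<delta>) ^ Suc n) \<longlonglongrightarrow> 0"
    by (rule LIMSEQ_Suc[OF LIMSEQ_realpow_zero]) (use delta_pos in auto)
  moreover have "exp (- \<delta>) ^ Suc n = exp (- \<delta> * real (Suc n))" for n
    by (metis exp_of_nat_mult mult.commute)
  ultimately have "(\<lambda>n. exp (- \<delta> * real (Suc n))) \<longlonglongrightarrow> 0" by (simp only:)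
  then show ?thesis by (intro tendsto_mult_left_zero tendsto_mult_right_zero)
qed

lemma inv_law_unique:
  assumes "inv_law \<mu>" "inv_law \<nu>"
  shows "\<mu> = \<nu>"
proof -
  have \<mu>: "prob_space \<mu>" "sets \<mu> = sets borel" and \<nu>: "prob_space \<nu>" "sets \<nu> = sets borel"
    using assms unfolding invariant_prob_def by auto
  show ?thesis
  proof (rule borel_measure_eqI_lipschitz[OF \<mu> \<nu>])
    fix f :: "real^'d \<Rightarrow> real" and L assume f: "L-lipschitz_on UNIV f" "\<And>x. \<bar>f x\<bar> \<le> (1::real)"
    \<comment> \<open>An invariant measure integrates \<open>f\<close> as it integrates
      \<open>PK t f\<close>, which is nearly constant. The reference point 0 is arbitrary, and
      \<open>pK\<close> makes it legitimate outside \<open>K\<close>.\<close>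
    have near: "\<bar>(\<integral>x. f x \<partial>\<rho>) - PK t f 0\<bar> \<le> L * exp (- \<delta> * t) * (2 * CK)" if "inv_law \<rho>" "0 < t" for \<rho> t
    proof -
      have \<rho>: "prob_space \<rho>" "sets \<rho> = sets borel" using that(1) unfolding invariant_prob_def by auto
      interpret r: prob_space \<rho> by fact
      note i = integrable_PK[OF \<rho> f that(2)]
      have "(\<integral>x. f x \<partial>\<rho>) = (\<integral>y. PK t f y \<partial>\<rho>)" using integral_bind_law[OF \<rho> that(2) f] inv_law_bind[OF that] by simp
      then have "\<bar>(\<integral>x. f x \<partial>\<rho>) - PK t f 0\<bar> = norm (\<integral>y. PK t f y - PK t f 0 \<partial>\<rho>)" using i by (simp add: r.prob_space)
      also have "\<dots> \<le> (\<integral>y. L * exp (- \<delta> * t) * (2 * CK) \<partial>\<rho>)"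
        by (rule norm_integral_le_integral) (use i PK_close[OF f that(2)] in auto)
      finally show ?thesis by (simp add: r.prob_space)
    qed
    have "\<bar>(\<integral>x. f x \<partial>\<mu>) - (\<integral>x. f x \<partial>\<nu>)\<bar> \<le> L * exp (- \<delta> * real (Suc n)) * (4 * CK)" for n
      using near[OF assms(1), of "Suc n"] near[OF assms(2), of "Suc n"] by simp
    then have "\<bar>(\<integral>x. f x \<partial>\<mu>) - (\<integral>x. f x \<partial>\<nu>)\<bar> \<le> 0"
      by (intro LIMSEQ_le_const[OF exp_decay]) auto
    then show "(\<integral>x. f x \<partial>\<mu>) = (\<integral>x. f x \<partial>\<nu>)" by simp
  qed
qed

lemma inv_law_exists: "\<exists>\<mu>. inv_law \<mu>"
proof -
  \<comment> \<open>Plain time marginals instead of time averages: the contraction makes their weak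
    limits invariant.\<close>
  define \<nu> where "\<nu> n = law (real (Suc n)) a0" for n
  have \<nu>: "prob_space (\<nu> n)" "sets (\<nu> n) = sets borel" for n by (auto simp: \<nu>_def intro: prob_space_law)
  have \<nu>K: "AE x in \<nu> n. x \<in> K" for n
    unfolding \<nu>_def law_def by (subst AE_distr_iff) (auto intro!: AE_I2 X_in_K[OF pK_in] X_pK_measurable)
  obtain r \<mu> where r: "strict_mono r" and \<mu>: "prob_space \<mu>" "sets \<mu> = sets borel"
    and conv: "\<And>f B. continuous_on UNIV f \<Longrightarrow> (\<And>x. \<bar>f x\<bar> \<le> B) \<Longrightarrow> (\<lambda>n. \<integral>x. f x \<partial>\<nu> (r n)) \<longlonglongrightarrow> (\<integral>x. f x \<partial>\<mu> :: real)"
  proof (rule weak_limit_on_compact[where \<nu>=\<nu>, OF K_compact \<nu> \<nu>K])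
    fix r \<mu>
    assume 1: "strict_mono r" "prob_space \<mu>" "sets \<mu> = sets borel"
      and 2: "\<And>f B. continuous_on UNIV f \<Longrightarrow> (\<And>x. \<bar>f x\<bar> \<le> B) \<Longrightarrow> (\<lambda>n. \<integral>x. f x \<partial>\<nu> (r n)) \<longlonglongrightarrow> (\<integral>x. f x \<partial>\<mu> :: real)"
    show thesis by (rule that[OF 1 2])
  qed
  interpret mu: prob_space \<mu> by fact
  have \<mu>K: "emeasure \<mu> K = 1"
  proof -
    have "(\<integral>x. near K n x \<partial>\<mu>) = 1" for n
    proof -
      have "(\<integral>x. near K n x \<partial>\<nu> k) = 1" for k
      proof -
        have nm: "near K n \<in> borel_measurable (\<nu> k)" using near_measurable \<nu>(2)[of k] by (simp cong: measurable_cong_sets)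
        have "(\<integral>x. near K n x \<partial>\<nu> k) = (\<integral>x. 1 \<partial>\<nu> k)"
          by (rule integral_cong_AE[OF nm]) (use \<nu>K[of k] in \<open>auto simp: near_def elim!: eventually_mono\<close>)
        then show ?thesis using prob_space.prob_space[OF \<nu>(1)[of k]] by simp
      qed
      then have "(\<lambda>k::nat. 1) \<longlonglongrightarrow> (\<integral>x. near K n x \<partial>\<mu>)" using conv[OF near_continuous near_abs, of K n] by simp
      then show ?thesis by (simp add: LIMSEQ_const_iff)
    qed
    then have "(\<lambda>n::nat. 1) \<longlonglongrightarrow> measure \<mu> K" using measure_closed_limit[OF \<mu> K_closed K_nonempty] by simp
    then show ?thesis by (simp add: LIMSEQ_const_iff mu.emeasure_eq_measure)
  qed
  have fm: "f \<in> borel_measurable borel" if "L-lipschitz_on UNIV f" for f :: "real^'d \<Rightarrow> real" and L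
    by (rule borel_measurable_continuous_onI[OF lipschitz_on_continuous_on[OF that]])
  have \<nu>int: "(\<integral>x. f x \<partial>\<nu> n) = P (real (Suc n)) f a0" if "L-lipschitz_on UNIV f" for f L n
    unfolding \<nu>_def using integral_law[OF _ fm[OF that], of "real (Suc n)" a0] by (simp add: PK_def pK_self[OF a0_in_K])
  \<comment> \<open>Commuting the two operators puts the long time \<open>Suc n\<close> inside,
    where it produces a nearly constant function. Letting the process run for \<open>?t\<close>
    beforehand then changes little, so \<open>PK ?t f\<close> and \<open>f\<close> have the same
    limit along \<open>\<nu>\<close>.\<close>
  have rational: "(\<integral>y. PK (real p * (1 / real q)) f y \<partial>\<mu>) = (\<integral>x. f x \<partial>\<mu>)"
    if f: "L-lipschitz_on UNIV f" "\<And>x. \<bar>f x\<bar> \<le> (1::real)" and p: "0 < p" and q: "0 < q" for f L and p q :: nat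
  proof -
    let ?\<tau> = "1 / real q" and ?t = "real p * (1 / real q)"
    have t: "0 < ?t" and \<tau>: "0 < ?\<tau>" using p q by auto
    have n: "real (Suc n * q) * ?\<tau> = real (Suc n)" for n using q by (simp only: of_nat_mult) simp
    have nq: "0 < Suc n * q" for n using q by simp
    \<comment> \<open>Both sides equal \<open>P\<close> at the sum of the two times. They are
      multiples of \<open>1 / real q\<close>, the integer time being \<open>Suc n * q\<close> of
      these.\<close>
    have comm: "P (real (Suc n)) (PK ?t f) a0 = P ?t (PK (real (Suc n)) f) a0" for n
      using semigroup[OF f \<tau> nq p a0_in_K, of n] semigroup[OF f \<tau> p nq a0_in_K, of n] unfolding n add.commute[of p] by simp
    have close: "\<bar>P ?t (PK (real (Suc n)) f) a0 - P (real (Suc n)) f a0\<bar> \<le> L * exp (- \<delta> * real (Suc n)) * (2 * CK)" for n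
    proof -
      let ?g = "PK (real (Suc n)) f"
      have s: "0 < real (Suc n)" by simp
      have gm: "(\<lambda>\<omega>. ?g (X a0 ?t \<omega>)) \<in> borel_measurable M"
        by (rule measurable_compose[OF X_measurable_M[OF a0_in_K less_imp_le[OF t]] fm[OF PK_lipschitz[OF f s]]])
      have gb: "\<bar>?g z\<bar> \<le> 1" for z unfolding PK_def by (rule P_bound[OF f(2)])
      have gi: "integrable M (\<lambda>\<omega>. ?g (X a0 ?t \<omega>))"
        by (rule integrable_const_bound[where B=1, OF AE_I2 gm]) (simp only: real_norm_def gb)
      have "P ?t ?g a0 - P (real (Suc n)) f a0 = (\<integral>\<omega>. ?g (X a0 ?t \<omega>) - ?g a0 \<partial>M)"
      proof -
        have e: "P ?t ?g a0 = (\<integral>\<omega>. ?g (X a0 ?t \<omega>) \<partial>M)" "P (real (Suc n)) f a0 = ?g a0"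
          by (rule P_def) (simp only: PK_def pK_self[OF a0_in_K])
        show ?thesis unfolding e using gi by (simp add: prob_space)
      qed
      then have "\<bar>P ?t ?g a0 - P (real (Suc n)) f a0\<bar> = norm (\<integral>\<omega>. ?g (X a0 ?t \<omega>) - ?g a0 \<partial>M)" by simp
      also have "\<dots> \<le> (\<integral>\<omega>. L * exp (- \<delta> * real (Suc n)) * (2 * CK) \<partial>M)"
        by (rule norm_integral_le_integral) (use gi PK_close[OF f s] in auto)
      finally show ?thesis by (simp add: prob_space)
    qed
    have c1: "(\<lambda>n. \<integral>x. PK ?t f x \<partial>\<nu> (r n)) \<longlonglongrightarrow> (\<integral>y. PK ?t f y \<partial>\<mu>)"
      by (rule conv[OF lipschitz_on_continuous_on[OF PK_lipschitz[OF f t]], of 1]) (use P_bound[OF f(2)] in \<open>simp add: PK_def\<close>)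
    have c2: "(\<lambda>n. \<integral>x. f x \<partial>\<nu> (r n)) \<longlonglongrightarrow> (\<integral>x. f x \<partial>\<mu>)"
      by (rule conv[OF lipschitz_on_continuous_on[OF f(1)] f(2)])
    have "(\<lambda>n. (\<integral>x. PK ?t f x \<partial>\<nu> (r n)) - (\<integral>x. f x \<partial>\<nu> (r n))) \<longlonglongrightarrow> 0"
    proof (rule Lim_null_comparison)
      show "(\<lambda>n. L * exp (- \<delta> * real (Suc (r n))) * (2 * CK)) \<longlonglongrightarrow> 0"
        using LIMSEQ_subseq_LIMSEQ[OF exp_decay r] by (simp add: comp_def)
      show "\<forall>\<^sub>F n in sequentially. norm ((\<integral>x. PK ?t f x \<partial>\<nu> (r n)) - (\<integral>x. f x \<partial>\<nu> (r n))) \<le> L * exp (- \<delta> * real (Suc (r n))) * (2 * CK)"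
        unfolding \<nu>int[OF f(1)] \<nu>int[OF PK_lipschitz[OF f t]] comm using close by (auto simp del: of_nat_Suc)
    qed
    with tendsto_diff[OF c1 c2] show ?thesis using LIMSEQ_unique by fastforce
  qed
  have stationary: "(\<integral>y. PK t f y \<partial>\<mu>) = (\<integral>x. f x \<partial>\<mu>)"
    if f: "L-lipschitz_on UNIV f" "\<And>x. \<bar>f x\<bar> \<le> (1::real)" and t: "0 < t" for f L t
  proof -
    \<comment> \<open>\<open>t\<close> is approached from above by rationals of denominator
      \<open>Suc n\<close>; rounding up keeps them positive. Continuity of paths and dominated
      convergence, under \<open>M\<close> and then under \<mu>, carry the identity over to
      \<open>t\<close>.\<close>
    let ?p = "\<lambda>n. nat \<lceil>t * real (Suc n)\<rceil>"
    let ?s = "\<lambda>n. real (?p n) * (1 / real (Suc n))"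
    have p: "0 < ?p n" for n using t by simp
    have s: "0 < ?s n" for n using p by simp
    have bounds: "t \<le> ?s n" "?s n \<le> t + 1 / real (Suc n)" for n
    proof -
      have tn: "0 < t * real (Suc n)" using t by simp
      have q: "t * real (Suc n) \<le> real (?p n)" "real (?p n) \<le> t * real (Suc n) + 1"
        using tn ceiling_correct[of "t * real (Suc n)"] by linarith+
      show "t \<le> ?s n" "?s n \<le> t + 1 / real (Suc n)"
        using divide_right_mono[OF q(1), of "real (Suc n)"] divide_right_mono[OF q(2), of "real (Suc n)"]
        by (simp_all add: add_divide_distrib del: of_nat_Suc)
    qed
    have slim: "?s \<longlonglongrightarrow> t"
    proof (rule tendsto_sandwich[OF _ _ tendsto_const])
      have "(\<lambda>n. t + 1 / real (Suc n)) \<longlonglongrightarrow> t + 0" by (intro tendsto_intros LIMSEQ_Suc[OF lim_const_over_n])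
      then show "(\<lambda>n. t + 1 / real (Suc n)) \<longlonglongrightarrow> t" by simp
    qed (use bounds in auto)
    have PKm: "PK s f \<in> borel_measurable \<mu>" if "0 < s" for s
      using fm[OF PK_lipschitz[OF f that]] \<mu>(2) by (simp cong: measurable_cong_sets)
    have "(\<lambda>n. \<integral>y. PK (?s n) f y \<partial>\<mu>) \<longlonglongrightarrow> (\<integral>y. PK t f y \<partial>\<mu>)"
    proof (rule integral_dominated_convergence[where w="\<lambda>_. 1"])
      show "AE y in \<mu>. (\<lambda>n. PK (?s n) f y) \<longlonglongrightarrow> PK t f y"
      proof (rule AE_I2)
        fix y
        note Xm = X_measurable_M[OF pK_in[of y]]
        show "(\<lambda>n. PK (?s n) f y) \<longlonglongrightarrow> PK t f y"
          unfolding PK_def P_def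
        proof (rule integral_dominated_convergence[where w="\<lambda>_. 1"])
          show "AE \<omega> in M. (\<lambda>n. f (X (pK y) (?s n) \<omega>)) \<longlonglongrightarrow> f (X (pK y) t \<omega>)"
          proof (rule AE_I2)
            fix \<omega> assume w: "\<omega> \<in> space M"
            have "continuous_on {0..} (\<lambda>u. f (X (pK y) u \<omega>))"
              by (rule continuous_on_compose2[OF lipschitz_on_continuous_on[OF f(1)] X_continuous[OF pK_in w]]) auto
            then show "(\<lambda>n. f (X (pK y) (?s n) \<omega>)) \<longlonglongrightarrow> f (X (pK y) t \<omega>)"
            proof (rule continuous_on_tendsto_compose[OF _ slim])
              show "t \<in> {0..}" using t by simp
              show "\<forall>\<^sub>F n in sequentially. ?s n \<in> {0..}" using less_imp_le[OF s] by (intro always_eventually allI) (simp only: atLeast_iff)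
            qed
          qed
          show "(\<lambda>\<omega>. f (X (pK y) t \<omega>)) \<in> borel_measurable M"
            by (rule measurable_compose[OF Xm fm[OF f(1)]]) (use t in simp)
          show "(\<lambda>\<omega>. f (X (pK y) (?s n) \<omega>)) \<in> borel_measurable M" for n
            by (rule measurable_compose[OF Xm fm[OF f(1)]]) (use s[of n] in simp)
        qed (use f(2) in auto)
      qed
      show "PK t f \<in> borel_measurable \<mu>" by (rule PKm[OF t])
      show "PK (?s n) f \<in> borel_measurable \<mu>" for n by (rule PKm[OF s])
    qed (use P_bound[OF f(2)] in \<open>auto simp: PK_def\<close>)
    then have "(\<lambda>n::nat. \<integral>x. f x \<partial>\<mu>) \<longlonglongrightarrow> (\<integral>y. PK t f y \<partial>\<mu>)"
      unfolding rational[OF f p zero_less_Suc] .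
    then show ?thesis by (simp add: LIMSEQ_const_iff)
  qed
  have bind: "\<mu> \<bind> law t = \<mu>" if t: "0 < t" for t
    by (rule borel_measure_eqI_lipschitz[OF prob_space_bind_law(1,2)[OF \<mu> t] \<mu>])
       (simp add: integral_bind_law[OF \<mu> t] stationary t)
  have "inv_law \<mu>" unfolding invariant_prob_def
  proof (intro conjI \<mu> \<mu>K allI impI ballI)
    fix t :: real and A :: "(real^'d) set" assume t: "0 \<le> t" and A: "A \<in> sets borel"
    show "emeasure \<mu> A = (\<integral>\<^sup>+x\<in>K. emeasure (distr M borel (X x t)) A \<partial>\<mu>)"
    proof (cases "t = 0")
      case False
      then have "0 < t" using t by simp
      from prob_space_bind_law(3)[OF \<mu> this A] bind[OF this] show ?thesis
        unfolding set_nn_integral_law[OF \<mu> \<mu>K] by simp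
    next
      case True
      have em: "emeasure (distr M borel (X x 0)) A = indicator A x" if x: "x \<in> K" for x
      proof -
        have xm: "X x 0 \<in> borel_measurable M" by (rule X_measurable_M[OF x order_refl])
        have "emeasure (distr M borel (X x 0)) A = (\<integral>\<^sup>+z. indicator A z \<partial>distr M borel (X x 0))" using A by simp
        also have "\<dots> = (\<integral>\<^sup>+\<omega>. indicator A (X x 0 \<omega>) \<partial>M)" by (rule nn_integral_distr[OF xm]) (use A in simp)
        also have "\<dots> = (\<integral>\<^sup>+\<omega>. indicator A x \<partial>M)" using X_0[OF x] by (intro nn_integral_cong_AE) (auto elim!: eventually_mono)
        finally show ?thesis by (simp add: emeasure_space_1)
      qed
      have "(\<integral>\<^sup>+x\<in>K. emeasure (distr M borel (X x t)) A \<partial>\<mu>) = (\<integral>\<^sup>+x. indicator A x \<partial>\<mu>)"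
        unfolding True using AE_in_K[OF \<mu> \<mu>K] by (intro nn_integral_cong_AE) (auto simp: em elim!: eventually_mono)
      then show ?thesis using A \<mu>(2) by simp
    qed
  qed
  then show ?thesis by blast
qed

lemma W2_bound:
  assumes inv: "inv_law \<mu>" and x: "x \<in> K" and t: "0 < t"
  shows "W2 (distr M borel (X x t)) \<mu> \<le> exp (- \<delta> * t) * sqrt (\<integral>y. (norm (x - y))\<^sup>2 \<partial>\<mu>)"
proof -
  have \<mu>: "prob_space \<mu>" "sets \<mu> = sets borel" "emeasure \<mu> K = 1" using inv unfolding invariant_prob_def by auto
  interpret mu: prob_space \<mu> by fact
  have t0: "0 \<le> t" using t by simp
  note pm = pair_X_measurable[OF x t0]
  have k: "law2 t x \<in> measurable \<mu> (subprob_algebra borel)" using law2_measurable[OF x t] \<mu>(2) by (simp cong: measurable_cong_sets)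
  define \<pi> where "\<pi> = \<mu> \<bind> law2 t x"
  have sets_\<pi>: "sets \<pi> = sets borel" unfolding \<pi>_def by (intro sets_bind mu.not_empty) (simp add: law2_def)
  have prob_\<pi>: "prob_space \<pi>" unfolding \<pi>_def
    by (intro mu.prob_space_bind[OF _ k] AE_I2) (auto simp: law2_def intro!: prob_space_distr pm)
  have em: "emeasure \<pi> A = (\<integral>\<^sup>+y. emeasure (law2 t x y) A \<partial>\<mu>)" if "A \<in> sets borel" for A
    unfolding \<pi>_def by (rule emeasure_bind[OF mu.not_empty k that])
  \<comment> \<open>The first marginal of the kernel does not depend on \<open>y\<close>, so
    averaging leaves it unchanged.\<close>
  have fst: "distr \<pi> borel fst = distr M borel (X x t)"
  proof (rule measure_eqI)
    fix A assume "A \<in> sets (distr \<pi> borel fst)"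
    then have A: "A \<in> sets borel" by simp
    have fA: "fst -` A \<in> sets (borel :: ((real^'d) \<times> (real^'d)) measure)"
      using measurable_sets[OF borel_measurable_continuous_onI[OF continuous_on_fst[OF continuous_on_id]] A] by simp
    have "emeasure (distr \<pi> borel fst) A = emeasure \<pi> (fst -` A)"
      using sets_eq_imp_space_eq[OF sets_\<pi>] by (subst emeasure_distr) (auto intro!: A borel_measurable_continuous_onI continuous_intros simp: sets_\<pi> cong: measurable_cong_sets)
    also have "\<dots> = (\<integral>\<^sup>+y. emeasure (distr M borel (X x t)) A \<partial>\<mu>)"
      unfolding em[OF fA] law2_def using A fA X_measurable_M[OF x t0]
      by (intro nn_integral_cong) (simp add: emeasure_distr[OF pm] emeasure_distr vimage_def)
    finally show "emeasure (distr \<pi> borel fst) A = emeasure (distr M borel (X x t)) A" by (simp add: mu.emeasure_space_1)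
  qed simp
  \<comment> \<open>The second marginal is \<mu> transported for time \<open>t\<close>; this is
    where invariance enters.\<close>
  have snd: "distr \<pi> borel snd = \<mu>"
  proof (rule measure_eqI)
    fix A assume "A \<in> sets (distr \<pi> borel snd)"
    then have A: "A \<in> sets borel" by simp
    have sA: "snd -` A \<in> sets (borel :: ((real^'d) \<times> (real^'d)) measure)"
      using measurable_sets[OF borel_measurable_continuous_onI[OF continuous_on_snd[OF continuous_on_id]] A] by simp
    have "emeasure (distr \<pi> borel snd) A = emeasure \<pi> (snd -` A)"
      using sets_eq_imp_space_eq[OF sets_\<pi>] by (subst emeasure_distr) (auto intro!: A borel_measurable_continuous_onI continuous_intros simp: sets_\<pi> cong: measurable_cong_sets)
    also have "\<dots> = (\<integral>\<^sup>+y. emeasure (law t y) A \<partial>\<mu>)"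
      unfolding em[OF sA] law2_def law_def using A sA X_pK_measurable[OF t0]
      by (intro nn_integral_cong) (simp add: emeasure_distr[OF pm] emeasure_distr vimage_def)
    also have "\<dots> = emeasure \<mu> A"
      unfolding prob_space_bind_law(3)[OF \<mu>(1,2) t A, symmetric] inv_law_bind[OF inv t] ..
    finally show "emeasure (distr \<pi> borel snd) A = emeasure \<mu> A" .
  qed (simp add: \<mu>(2))
  let ?d = "\<lambda>p :: (real^'d) \<times> (real^'d). ennreal ((dist (fst p) (snd p))\<^sup>2)"
  let ?c = "exp (- 2 * \<delta> * t)"
  let ?I = "\<integral>y. (norm (x - y))\<^sup>2 \<partial>\<mu>"
  have dm: "?d \<in> borel_measurable borel"
    by (intro measurable_compose[OF _ measurable_ennreal] borel_measurable_continuous_onI continuous_intros)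
  have pKm: "(\<lambda>y. (norm (x - pK y))\<^sup>2) \<in> borel_measurable \<mu>"
  proof -
    have "continuous_on UNIV pK" unfolding pK_def by (rule continuous_on_closest_point[OF K_convex K_closed K_nonempty])
    then have "(\<lambda>y. (norm (x - pK y))\<^sup>2) \<in> borel_measurable borel" by (intro borel_measurable_continuous_onI continuous_intros)
    then show ?thesis using \<mu>(2) by (simp cong: measurable_cong_sets)
  qed
  have "(norm (x - pK y))\<^sup>2 \<le> (2 * CK)\<^sup>2" for y by (intro power_mono K_diff_bound x pK_in) auto
  then have pKi: "integrable \<mu> (\<lambda>y. (norm (x - pK y))\<^sup>2)"
    using pKm by (intro mu.integrable_const_bound[where B="(2 * CK)\<^sup>2"] AE_I2) auto
  have "(\<integral>\<^sup>+p. ?d p \<partial>\<pi>) = (\<integral>\<^sup>+y. (\<integral>\<^sup>+p. ?d p \<partial>law2 t x y) \<partial>\<mu>)"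
    unfolding \<pi>_def by (rule nn_integral_bind[OF dm k])
  also have "\<dots> \<le> (\<integral>\<^sup>+y. ennreal (?c * (norm (x - pK y))\<^sup>2) \<partial>\<mu>)"
  proof (rule nn_integral_mono)
    fix y
    have "(\<integral>\<^sup>+p. ?d p \<partial>law2 t x y) = (\<integral>\<^sup>+\<omega>. ennreal ((norm (X x t \<omega> - X (pK y) t \<omega>))\<^sup>2) \<partial>M)"
    proof -
      have "(\<integral>\<^sup>+p. ?d p \<partial>law2 t x y) = (\<integral>\<^sup>+\<omega>. ?d (X x t \<omega>, X (pK y) t \<omega>) \<partial>M)"
        unfolding law2_def by (rule nn_integral_distr[OF pm]) (simp only: measurable_distr_eq1 dm)
      then show ?thesis by (simp add: dist_norm)
    qed
    also have "\<dots> = ennreal (\<integral>\<omega>. (norm (X x t \<omega> - X (pK y) t \<omega>))\<^sup>2 \<partial>M)"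
      by (rule nn_integral_eq_integral[OF X_diff_integrable(1)[OF x pK_in t0]]) simp
    also have "\<dots> \<le> ennreal (?c * (norm (x - pK y))\<^sup>2)" by (rule ennreal_leI[OF X_contraction[OF x pK_in t]])
    finally show "(\<integral>\<^sup>+p. ?d p \<partial>law2 t x y) \<le> ennreal (?c * (norm (x - pK y))\<^sup>2)" .
  qed
  also have "\<dots> = ennreal (\<integral>y. ?c * (norm (x - pK y))\<^sup>2 \<partial>\<mu>)"
    by (rule nn_integral_eq_integral) (use pKi in auto)
  also have "(\<integral>y. ?c * (norm (x - pK y))\<^sup>2 \<partial>\<mu>) = ?c * ?I"
  proof -
    have "(\<integral>y. (norm (x - pK y))\<^sup>2 \<partial>\<mu>) = ?I"
    proof (rule integral_cong_AE[OF pKm])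
      have "(\<lambda>y. (norm (x - y))\<^sup>2) \<in> borel_measurable borel" by measurable
      then show "(\<lambda>y. (norm (x - y))\<^sup>2) \<in> borel_measurable \<mu>" using \<mu>(2) by (simp cong: measurable_cong_sets)
      show "AE y in \<mu>. (norm (x - pK y))\<^sup>2 = (norm (x - y))\<^sup>2" using AE_in_K[OF \<mu>] by eventually_elim (simp add: pK_self)
    qed
    then show ?thesis by simp
  qed
  finally have cost: "(\<integral>\<^sup>+p. ?d p \<partial>\<pi>) \<le> ennreal (?c * ?I)" .
  have "\<pi> \<in> couplings (distr M borel (X x t)) \<mu>"
    unfolding couplings_def using prob_\<pi> sets_\<pi> fst snd by simp
  then have "(INF \<pi>\<in>couplings (distr M borel (X x t)) \<mu>. \<integral>\<^sup>+p. ?d p \<partial>\<pi>) \<le> ennreal (?c * ?I)"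
    using cost by (rule INF_lower2)
  \<comment> \<open>\<open>enn2real\<close> sends infinity to 0, so its monotonicity needs the
    finiteness of the upper bound.\<close>
  then have "enn2real (INF \<pi>\<in>couplings (distr M borel (X x t)) \<mu>. \<integral>\<^sup>+p. ?d p \<partial>\<pi>) \<le> enn2real (ennreal (?c * ?I))"
    by (rule enn2real_mono) simp
  also have "enn2real (ennreal (?c * ?I)) = ?c * ?I" by (rule enn2real_ennreal) simp
  finally have "W2 (distr M borel (X x t)) \<mu> \<le> sqrt (?c * ?I)" unfolding W2_def by (rule real_sqrt_le_mono)
  also have "?c = (exp (- \<delta> * t))\<^sup>2" by (simp add: power2_eq_square mult_exp_exp)
  also have "sqrt ((exp (- \<delta> * t))\<^sup>2 * ?I) = exp (- \<delta> * t) * sqrt ?I" by (simp add: real_sqrt_mult)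
  finally show ?thesis .
qed

end

lemma locally_lipschitz_imp_continuous:
  fixes f :: "'b::metric_space \<Rightarrow> 'c::metric_space"
  assumes "\<forall>x. \<exists>e>0. \<exists>L. L-lipschitz_on (ball x e) f"
  shows "continuous_on UNIV f"
proof (rule continuous_at_imp_continuous_on, rule ballI)
  fix x
  obtain e L where "0 < e" "L-lipschitz_on (ball x e) f" using assms by blast
  then show "isCont f x" using lipschitz_on_continuous_on continuous_on_eq_continuous_at[OF open_ball, of x e f] by auto
qed

theorem mainTheorem4:
  fixes M :: "'a measure" and F :: "real \<Rightarrow> 'a measure" and B :: "real \<Rightarrow> 'a \<Rightarrow> real^'d"
    and b :: "real^'d \<Rightarrow> real^'d" and \<sigma> :: "real^'d \<Rightarrow> real^'d^'d"
    and U :: "(real^'d) set" and \<delta> :: real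
    and X \<eta> :: "real^'d \<Rightarrow> real \<Rightarrow> 'a \<Rightarrow> real^'d"
  assumes prob: "prob_space M"
    and filt: "usual_filtration M F"
    and BM: "brownian_motion M F B"
    and dom: "open U" "connected U" "U \<noteq> {}" "bounded U" "convex U"
    and H1: "\<forall>x. \<exists>e>0. \<exists>L. L-lipschitz_on (ball x e) b"
            "\<forall>x. \<exists>e>0. \<exists>L. L-lipschitz_on (ball x e) \<sigma>"
    and H2: "\<exists>K>0. \<forall>x. (norm (b x))\<^sup>2 + (norm (\<sigma> x))\<^sup>2 \<le> K * (1 + (norm x)\<^sup>2)"
    and H3: "\<delta> > 0" "\<forall>x y. (norm (\<sigma> x - \<sigma> y))\<^sup>2 + 2 * ((x - y) \<bullet> (b x - b y)) \<le> - 2 * \<delta> * (norm (x - y))\<^sup>2"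
    and sigma_bdd: "\<exists>C. \<forall>x z. norm z \<le> 1 \<longrightarrow> norm (\<sigma> x *v z) \<le> C"
    and sol: "\<forall>x\<in>closure U. strong_solution M F B b \<sigma> U x (X x) (\<eta> x)"
  shows "(\<exists>!\<mu>. invariant_prob (\<lambda>t x. distr M borel (X x t)) (closure U) \<mu>) \<and>
         (\<forall>\<mu>. invariant_prob (\<lambda>t x. distr M borel (X x t)) (closure U) \<mu> \<longrightarrow>
            (\<forall>x\<in>closure U. \<forall>t>0.
               W2 (distr M borel (X x t)) \<mu> \<le> exp (- \<delta> * t) * sqrt (\<integral>y. (norm (x - y))\<^sup>2 \<partial>\<mu>)))"
proof -
  interpret prob_space M by (rule prob)
  interpret reflected_sde M F B b \<sigma> U \<delta> X \<eta>
  proof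
    show "usual_filtration M F" "brownian_motion M F B" by (fact filt BM)+
    show "open U" "U \<noteq> {}" "bounded U" "convex U" by (fact dom)+
    show "continuous_on UNIV b" "continuous_on UNIV \<sigma>" using H1 by (auto intro: locally_lipschitz_imp_continuous)
    show "0 < \<delta>" by (fact H3(1))
    show "(norm (\<sigma> x - \<sigma> y))\<^sup>2 + 2 * ((x - y) \<bullet> (b x - b y)) \<le> - 2 * \<delta> * (norm (x - y))\<^sup>2" for x y using H3(2) by blast
    show "strong_solution M F B b \<sigma> U x (X x) (\<eta> x)" if "x \<in> closure U" for x using sol that by blast
  qed
  show ?thesis using inv_law_exists inv_law_unique W2_bound by blast
qed

end
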